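(* Let $H_1,\dots,H_q$ be hyperplanes in general position in $\mathbb{P}^n$ with $q>2n$, let $m_i\in\mathbb{Z}_{\ge1}\cup\{\infty\}$ and $\Delta=\sum_{i=1}^q(1-\frac1{m_i})H_i$, with $$\deg\Delta:=\sum_{i=1}^q\Big(1-\frac1{m_i}\Big)>q-\frac qn+1+\frac1n .$$ Then every orbifold morphism $f:\mathbb{C}\to(\mathbb{P}^n/\Delta)$ is constant.
   Context: General position: any $n+1$ of the hyperplanes have linearly independent defining linear forms. A holomorphic $f:\mathbb{C}\to\mathbb{P}^n$ is an orbifold morphism to $(\mathbb{P}^n/\Delta)$ if $f(\mathbb{C})\not\subset\bigcup_iH_i$ and for each $i$ and each $x$ with $f(x)\in H_i$, the multiplicity of $f^*H_i$ at $x$ is $\geq m_i$ (if $m_i=\infty$, $f(\mathbb{C})\cap H_i=\emptyset$). *)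

theory Defs
  imports "HOL-Analysis.Analysis" "HOL-Library.Extended_Nat"
begin

(* Points of C^{n+1} are functions nat => complex, only indices j <= n matter.
   Hyperplane H_i in P^n is given by its linear form with coefficients a i j, j <= n. *)

definition lin_form :: "nat \<Rightarrow> (nat \<Rightarrow> complex) \<Rightarrow> (nat \<Rightarrow> complex) \<Rightarrow> complex" where
  "lin_form n h v = (\<Sum>j\<le>n. h j * v j)"

definition hyp_general_position :: "nat \<Rightarrow> nat \<Rightarrow> (nat \<Rightarrow> nat \<Rightarrow> complex) \<Rightarrow> bool" where
  "hyp_general_position n q a \<longleftrightarrow>
     (\<forall>S. S \<subseteq> {..<q} \<longrightarrow> card S = n + 1 \<longrightarrow>
        (\<forall>c. (\<forall>j\<le>n. (\<Sum>i\<in>S. c i * a i j) = 0) \<longrightarrow> (\<forall>i\<in>S. c i = 0)))"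

(* reduced representation F = (F_0,...,F_n) of a holomorphic map C -> P^n:
   entire functions without common zeros *)
definition reduced_rep :: "nat \<Rightarrow> (nat \<Rightarrow> complex \<Rightarrow> complex) \<Rightarrow> bool" where
  "reduced_rep n F \<longleftrightarrow> (\<forall>j\<le>n. F j holomorphic_on UNIV) \<and> (\<forall>z. \<exists>j\<le>n. F j z \<noteq> 0)"

(* the entire function H_i(F) whose zero divisor is f^*H_i *)
definition hyp_pullback :: "nat \<Rightarrow> (nat \<Rightarrow> complex) \<Rightarrow> (nat \<Rightarrow> complex \<Rightarrow> complex) \<Rightarrow> complex \<Rightarrow> complex" where
  "hyp_pullback n h F = (\<lambda>z. lin_form n h (\<lambda>j. F j z))"

definition mult_ge :: "(complex \<Rightarrow> complex) \<Rightarrow> complex \<Rightarrow> nat \<Rightarrow> bool" where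
  "mult_ge g x k \<longleftrightarrow> (\<forall>l<k. (deriv ^^ l) g x = 0)"

definition orbifold_morphism ::
  "nat \<Rightarrow> nat \<Rightarrow> (nat \<Rightarrow> nat \<Rightarrow> complex) \<Rightarrow> (nat \<Rightarrow> enat) \<Rightarrow> (nat \<Rightarrow> complex \<Rightarrow> complex) \<Rightarrow> bool" where
  "orbifold_morphism n q a m F \<longleftrightarrow>
     reduced_rep n F \<and>
     (\<exists>z. \<forall>i<q. hyp_pullback n (a i) F z \<noteq> 0) \<and>
     (\<forall>i<q. \<forall>x. hyp_pullback n (a i) F x = 0 \<longrightarrow>
        (case m i of enat k \<Rightarrow> mult_ge (hyp_pullback n (a i) F) x k | \<infinity> \<Rightarrow> False))"

definition orbifold_weight :: "enat \<Rightarrow> real" where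
  "orbifold_weight mi = (case mi of enat k \<Rightarrow> 1 - 1 / real k | \<infinity> \<Rightarrow> 1)"

definition constant_proj :: "nat \<Rightarrow> (nat \<Rightarrow> complex \<Rightarrow> complex) \<Rightarrow> bool" where
  "constant_proj n F \<longleftrightarrow> (\<forall>z w. \<exists>c. \<forall>j\<le>n. F j w = c * F j z)"

end

theory Submission
  imports Defs "HOL-Complex_Analysis.Complex_Analysis" "Jordan_Normal_Form.Determinant"
begin

text \<open>Cartan's argument with Nochka weights, in a form without integrals. Let \<open>R - 1\<close> be the
  dimension of the linear span of the image and let \<open>h\<^sub>i = H\<^sub>i(F)\<close>. Nochka weights \<open>w\<^sub>i\<close> compensate for
  the hyperplanes being only in subgeneral position in that span. The multiplicities and the
  truncation at level \<open>R - 1\<close> make \<open>G = W\<^sup>N / \<Prod> h\<^sub>i^p\<^sub>i\<close> entire, where \<open>W\<close> is the Wronskian of the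
  span and \<open>p\<^sub>i\<close> is about \<open>N w\<^sub>i max(0, 1 - (R - 1) / m\<^sub>i)\<close>. The degree condition gives
  \<open>\<Sum> p\<^sub>i > N R\<close>, so a bound on logarithmic derivatives bounds \<open>G\<close> times a positive power of \<open>\<parallel>F\<parallel>\<close>.

  The characteristic \<open>T(r)\<close> is \<open>Re p\<^sub>r(0)\<close> for an entire \<open>p\<^sub>r\<close> with \<open>Re p\<^sub>r\<close> close to \<open>log \<parallel>F\<parallel>\<close> on the circle
  \<open>|z| = r\<close>; it exists by Stone--Weierstrass, and the maximum principle for products with \<open>exp p\<^sub>r\<close>
  replaces Jensen's formula. As \<open>F exp(-p\<^sub>r)\<close> is bounded on the disc, Blaschke factors and the
  Borel--Caratheodory inequality bound its logarithmic derivatives pointwise on a suitable circle.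
  This yields \<open>T(\<rho>) = O(log (T(r) + r + 1 / (r - \<rho>)))\<close> for \<open>\<rho> < r\<close>. Replacing \<open>F(z)\<close> by \<open>F(c + exp z)\<close>
  at the outset makes the curve periodic, so \<open>T\<close> grows at least linearly, and the two are
  incompatible.\<close>

section \<open>Nochka weights\<close>

text \<open>The degree hypothesis says that the sum of the \<open>1 / m_i\<close> is less than
  \<open>(q - n - 1) / n\<close>. The obstacle is linear degeneracy: if the image spans only
  dimension \<open>R - 1 < n\<close>, up to \<open>n\<close> of the forms may be small at one point,
  whereas a basis of their span has only \<open>R\<close> members. Weights with
  \<open>w_i \<le> l\<close> and total \<open>l * (q - 2 * n - 2 + R) + R\<close> solve this: since
  the sum of \<open>w_i / m_i\<close> is at most \<open>l\<close> times the sum of the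
  \<open>1 / m_i\<close>, the required inequality
  \<open>\<Sum> w_i * (1 - (R - 1) / m_i) > R\<close> follows once
  \<open>(R - 1) * \<Sum> 1 / m_i < q - 2 * n - 2 + R\<close>. For \<open>R = n + 1\<close> this is
  exactly the degree hypothesis, and \<open>q > 2 * n\<close> covers the smaller \<open>R\<close>.
  One matroid inequality between weights and bases serves twice: for the orders of zeros, where it
  makes \<open>G\<close> entire, and for the logarithms of sizes, where it bounds \<open>G\<close>.
  The exponential substitution is not cosmetic: a curve given by polynomials has
  \<open>T(r) = O(log r)\<close>, which is compatible with the logarithmic estimate, so a lower
  bound on \<open>T\<close> stronger than logarithmic has to be built in.\<close>

locale finite_matroid =
  fixes E :: "'a set" and indep :: "'a set \<Rightarrow> bool"
  assumes finite_ground: "finite E"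
    and indep_subset_ground: "indep I \<Longrightarrow> I \<subseteq> E"
    and indep_empty: "indep {}"
    and indep_mono: "indep I \<Longrightarrow> J \<subseteq> I \<Longrightarrow> indep J"
    and exchange: "indep I \<Longrightarrow> indep J \<Longrightarrow> card I < card J \<Longrightarrow> \<exists>x\<in>J - I. indep (insert x I)"
begin

definition rk :: "'a set \<Rightarrow> nat" where
  "rk B = Max (card ` {I. I \<subseteq> B \<and> indep I})"

lemma finite_cards: "finite (card ` {I. I \<subseteq> B \<and> indep I})"
proof -
  have "{I. I \<subseteq> B \<and> indep I} \<subseteq> Pow E"
    using indep_subset_ground by auto
  then show ?thesis
    using finite_ground by (meson finite_Pow_iff finite_imageI finite_subset)
qed

lemma card_indep_le_rk:
  assumes "indep I" "I \<subseteq> B" shows "card I \<le> rk B"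
  unfolding rk_def using assms finite_cards by (intro Max_ge) auto

lemma rk_witness: "\<exists>I\<subseteq>B. indep I \<and> card I = rk B"
proof -
  have "rk B \<in> card ` {I. I \<subseteq> B \<and> indep I}"
    unfolding rk_def using finite_cards indep_empty by (intro Max_in) auto
  then show ?thesis by auto
qed

lemma finite_indep: "indep I \<Longrightarrow> finite I"
  using finite_ground indep_subset_ground finite_subset by blast

lemma indep_extend:
  assumes "indep I" "I \<subseteq> B"
  shows "\<exists>J. I \<subseteq> J \<and> J \<subseteq> B \<and> indep J \<and> card J = rk B"
  using assms
proof (induction "rk B - card I" arbitrary: I)
  case 0
  then show ?case using card_indep_le_rk[of I B] by auto
next
  case (Suc d)
  obtain J where J: "J \<subseteq> B" "indep J" "card J = rk B" using rk_witness by blast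
  have "card I < card J" using Suc.hyps(2) J by linarith
  then obtain x where x: "x \<in> J - I" "indep (insert x I)" using exchange Suc.prems J by blast
  have "d = rk B - card (insert x I)"
    using Suc.hyps(2) x finite_indep[OF Suc.prems(1)] by simp
  moreover have "insert x I \<subseteq> B" using x J Suc.prems by auto
  ultimately obtain K where "insert x I \<subseteq> K" "K \<subseteq> B" "indep K" "card K = rk B"
    using Suc.hyps(1)[OF _ x(2)] by blast
  then show ?case by blast
qed

lemma rk_mono: "A \<subseteq> B \<Longrightarrow> rk A \<le> rk B"
proof -
  assume "A \<subseteq> B"
  obtain I where "I \<subseteq> A" "indep I" "card I = rk A" using rk_witness by blast
  then show ?thesis using card_indep_le_rk[of I B] \<open>A \<subseteq> B\<close> by auto
qed

lemma rk_le_card: "finite B \<Longrightarrow> rk B \<le> card B"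
proof -
  assume "finite B"
  obtain I where "I \<subseteq> B" "indep I" "card I = rk B" using rk_witness by blast
  then show ?thesis using card_mono[OF \<open>finite B\<close>, of I] by simp
qed

lemma rk_empty: "rk {} = 0"
  using rk_le_card[of "{}"] by simp

text \<open>A base of \<open>A \<inter> B\<close> is enlarged inside \<open>A\<close> to
  \<open>D\<close>, then inside \<open>A \<union> B\<close> to \<open>J\<close>. Maximality of
  \<open>D\<close> in \<open>A\<close> forces \<open>J - D\<close> into \<open>B\<close>.\<close>

lemma rk_submodular: "rk (A \<union> B) + rk (A \<inter> B) \<le> rk A + rk B"
proof -
  obtain C where C: "C \<subseteq> A \<inter> B" "indep C" "card C = rk (A \<inter> B)" using rk_witness by blast
  then obtain D where D: "C \<subseteq> D" "D \<subseteq> A" "indep D" "card D = rk A"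
    using indep_extend[of C A] by auto
  then obtain J where J: "D \<subseteq> J" "J \<subseteq> A \<union> B" "indep J" "card J = rk (A \<union> B)"
    using indep_extend[of D "A \<union> B"] by auto
  have "J \<inter> A = D"
  proof (rule ccontr)
    assume "J \<inter> A \<noteq> D"
    then have "D \<subset> J \<inter> A" using J D by auto
    then have "card D < card (J \<inter> A)" using finite_indep[OF J(3)] by (simp add: psubset_card_mono)
    moreover have "card (J \<inter> A) \<le> rk A" using indep_mono[OF J(3)] by (intro card_indep_le_rk) auto
    ultimately show False using D by simp
  qed
  then have sub: "C \<union> (J - D) \<subseteq> B" using C J by auto
  have "indep (C \<union> (J - D))" using indep_mono[OF J(3)] D J by auto
  then have "card (C \<union> (J - D)) \<le> rk B" using sub card_indep_le_rk by blast
  moreover have "card (C \<union> (J - D)) = card C + (card J - card D)"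
    using finite_indep[OF C(2)] finite_indep[OF D(3)] finite_indep[OF J(3)] C D J
    by (subst card_Un_disjoint) (auto simp: card_Diff_subset)
  moreover have "card D \<le> card J" using card_mono[OF finite_indep[OF J(3)] J(1)] .
  ultimately show ?thesis using C D J by linarith
qed

text \<open>Subtracting the minimum of \<open>e\<close> and inducting over the level sets is the layer-cake
  decomposition of both sides; on each level set the claim is the hypothesis.\<close>

lemma greedy_independent:
  fixes e w :: "'a \<Rightarrow> real"
  assumes "S \<subseteq> E" "\<forall>i\<in>S. 0 \<le> e i" "\<forall>B\<subseteq>S. sum w B \<le> real (rk B)"
  shows "\<exists>I\<subseteq>S. indep I \<and> (\<Sum>i\<in>S. w i * e i) \<le> (\<Sum>i\<in>I. e i)"
  using assms
proof (induction "card S" arbitrary: S e rule: less_induct)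
  case less
  have finS: "finite S" using less.prems finite_ground finite_subset by blast
  show ?case
  proof (cases "S = {}")
    case True
    then show ?thesis using indep_empty by auto
  next
    case False
    define t where "t = Min (e ` S)"
    define S' where "S' = {i\<in>S. t < e i}"
    have tmin: "t \<le> e i" if "i \<in> S" for i using that finS by (simp add: t_def)
    have "t \<in> e ` S" unfolding t_def using finS False by (intro Min_in) auto
    then obtain i0 where i0: "i0 \<in> S" "e i0 = t" by auto
    have t0: "0 \<le> t" using i0 less.prems by auto
    have "S' \<subset> S" using i0 by (auto simp: S'_def)
    then have "card S' < card S" using finS psubset_card_mono by blast
    moreover have "S' \<subseteq> E" "\<forall>i\<in>S'. 0 \<le> e i - t" "\<forall>B\<subseteq>S'. sum w B \<le> real (rk B)"
      using less.prems \<open>S' \<subset> S\<close> by (auto simp: S'_def)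
    ultimately obtain I' where I': "I' \<subseteq> S'" "indep I'"
      "(\<Sum>i\<in>S'. w i * (e i - t)) \<le> (\<Sum>i\<in>I'. e i - t)"
      using less.hyps[of S' "\<lambda>i. e i - t"] by auto
    \<comment> \<open>The bottom layer has height \<open>t\<close> on all of \<open>S\<close>, so
      \<open>I'\<close> is enlarged to a base of \<open>S\<close>: its cardinality
      \<open>rk S\<close> pays for \<open>t * sum w S\<close>, and the added elements contribute
      nonnegative terms \<open>e i - t\<close>.\<close>
    obtain I where I: "I' \<subseteq> I" "I \<subseteq> S" "indep I" "card I = rk S"
      using indep_extend[of I' S] I' \<open>S' \<subset> S\<close> by auto
    have "(\<Sum>i\<in>S. w i * e i) = (\<Sum>i\<in>S. w i * (e i - t)) + t * sum w S"
      by (simp add: algebra_simps sum.distrib sum_subtractf sum_distrib_left)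
    also have "(\<Sum>i\<in>S. w i * (e i - t)) = (\<Sum>i\<in>S'. w i * (e i - t))"
      using finS tmin by (intro sum.mono_neutral_right) (force simp: S'_def)+
    also have "\<dots> \<le> (\<Sum>i\<in>I'. e i - t)" by (rule I')
    also have "\<dots> \<le> (\<Sum>i\<in>I. e i - t)"
      using I finS tmin by (intro sum_mono2) (auto intro: finite_subset)
    also have "t * sum w S \<le> t * real (rk S)"
      using less.prems t0 by (intro mult_left_mono) auto
    also have "(\<Sum>i\<in>I. e i - t) + t * real (rk S) = (\<Sum>i\<in>I. e i)"
      using I(4) by (simp add: sum_subtractf)
    finally show ?thesis using I by auto
  qed
qed

end

text \<open>Edmonds' greedy algorithm: \<open>w\<close> is the sequence of increments of \<open>\<rho>\<close> along an enumeration of \<open>F\<close>.\<close>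

lemma polymatroid_base:
  fixes \<rho> :: "'a set \<Rightarrow> real"
  assumes "finite F" "\<rho> {} = 0"
    and "\<And>A B. A \<subseteq> B \<Longrightarrow> B \<subseteq> F \<Longrightarrow> \<rho> A \<le> \<rho> B"
    and "\<And>A B. A \<subseteq> F \<Longrightarrow> B \<subseteq> F \<Longrightarrow> \<rho> (A \<union> B) + \<rho> (A \<inter> B) \<le> \<rho> A + \<rho> B"
  shows "\<exists>w. sum w F = \<rho> F \<and> (\<forall>B\<subseteq>F. sum w B \<le> \<rho> B) \<and> (\<forall>i. 0 \<le> w i)"
  using assms
proof (induction F)
  case empty
  then show ?case by (auto intro!: exI[of _ "\<lambda>_. 0"])
next
  case (insert x F)
  have "\<exists>w. sum w F = \<rho> F \<and> (\<forall>B\<subseteq>F. sum w B \<le> \<rho> B) \<and> (\<forall>i. 0 \<le> w i)"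
  proof (rule insert.IH)
    show "\<rho> {} = 0" by (rule insert.prems)
    show "\<rho> A \<le> \<rho> B" if "A \<subseteq> B" "B \<subseteq> F" for A B
      using insert.prems(2)[of A B] that by auto
    show "\<rho> (A \<union> B) + \<rho> (A \<inter> B) \<le> \<rho> A + \<rho> B" if "A \<subseteq> F" "B \<subseteq> F" for A B
      using insert.prems(3)[of A B] that by auto
  qed
  then obtain w where w: "sum w F = \<rho> F" "\<forall>B\<subseteq>F. sum w B \<le> \<rho> B" "\<forall>i. 0 \<le> w i"
    by blast
  define w' where "w' = w(x := \<rho> (insert x F) - \<rho> F)"
  have eq: "sum w' B = sum w B" if "x \<notin> B" for B
    using that by (intro sum.cong) (auto simp: w'_def)
  have "sum w' (insert x F) = \<rho> (insert x F)"
    using insert.hyps w eq by (simp add: w'_def)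
  moreover have "sum w' B \<le> \<rho> B" if B: "B \<subseteq> insert x F" for B
  proof (cases "x \<in> B")
    case True
    have fB: "finite B" using B insert.hyps finite_subset by blast
    have "sum w' B = w' x + sum w' (B - {x})" using fB True by (simp add: sum.remove)
    also have "\<dots> = \<rho> (insert x F) - \<rho> F + sum w (B - {x})" using eq by (simp add: w'_def)
    also have "sum w (B - {x}) \<le> \<rho> (B - {x})" using w(2) B by blast
    also have "\<rho> (insert x F) - \<rho> F + \<rho> (B - {x}) \<le> \<rho> B"
    proof -
      have "B \<union> F = insert x F" "B \<inter> F = B - {x}" using B True insert.hyps by auto
      then show ?thesis using insert.prems(3)[OF B subset_insertI] by simp
    qed
    finally show ?thesis by simp
  next
    case False
    then show ?thesis using w(2) B eq by auto
  qed
  moreover have "0 \<le> w' i" for i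
    using w(3) insert.prems(2)[of F "insert x F"] by (auto simp: w'_def)
  ultimately show ?case by blast
qed

context finite_matroid
begin

text \<open>The function \<open>\<rho>\<close> of the proof is the convolution of the rank with
  \<open>l\<close> times the cardinality. It is again a polymatroid, and weights below it obey both
  the rank bounds and the cap \<open>l\<close>. The hypothesis \<open>cap\<close> says that
  \<open>\<rho> F\<close> is still the full rank of \<open>F\<close>.\<close>

lemma capped_base:
  assumes F: "F \<subseteq> E" and l: "0 \<le> l"
    and cap: "\<And>A. A \<subseteq> F \<Longrightarrow> real (rk F) \<le> real (rk A) + l * real (card (F - A))"
  shows "\<exists>w. sum w F = real (rk F) \<and> (\<forall>B\<subseteq>F. sum w B \<le> real (rk B)) \<and> (\<forall>i. 0 \<le> w i) \<and> (\<forall>i\<in>F. w i \<le> l)"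
proof -
  define c where "c A B = real (rk A) + l * real (card (B - A))" for A B
  define \<rho> where "\<rho> B = Min ((\<lambda>A. c A B) ` Pow B)" for B
  have finF: "finite F" using F finite_ground finite_subset by blast
  have finite_sub: "finite B" if "B \<subseteq> F" for B using that finF finite_subset by blast
  have le: "\<rho> B \<le> c A B" if "A \<subseteq> B" "B \<subseteq> F" for A B
    unfolding \<rho>_def using that finite_sub[of B] by (intro Min_le) auto
  have wit: "\<exists>A\<subseteq>B. \<rho> B = c A B" if "B \<subseteq> F" for B
  proof -
    have "\<rho> B \<in> (\<lambda>A. c A B) ` Pow B"
      unfolding \<rho>_def using that finite_sub[of B] by (intro Min_in) auto
    then show ?thesis by auto
  qed
  have "\<exists>w. sum w F = \<rho> F \<and> (\<forall>B\<subseteq>F. sum w B \<le> \<rho> B) \<and> (\<forall>i. 0 \<le> w i)"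
  proof (rule polymatroid_base[OF finF])
    show "\<rho> {} = 0" by (simp add: \<rho>_def c_def rk_empty)
  next
    fix A B assume AB: "A \<subseteq> B" "B \<subseteq> F"
    obtain X where X: "X \<subseteq> B" "\<rho> B = c X B" using wit[OF AB(2)] by blast
    have "\<rho> A \<le> c (X \<inter> A) A" using le[of "X \<inter> A" A] AB by auto
    also have "\<dots> \<le> c X B"
    proof -
      have "card (A - X \<inter> A) \<le> card (B - X)"
        using AB finite_sub[of B] by (intro card_mono) auto
      then show ?thesis unfolding c_def using l rk_mono[of "X \<inter> A" X]
        by (intro add_mono mult_left_mono) auto
    qed
    finally show "\<rho> A \<le> \<rho> B" using X by simp
  next
    fix A B assume AB: "A \<subseteq> F" "B \<subseteq> F"
    have fin: "finite A" "finite B" using AB finite_sub by auto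
    obtain X where X: "X \<subseteq> A" "\<rho> A = c X A" using wit[OF AB(1)] by blast
    obtain Y where Y: "Y \<subseteq> B" "\<rho> B = c Y B" using wit[OF AB(2)] by blast
    have fXY: "finite X" "finite Y" using X Y fin finite_subset by blast+
    have "\<rho> (A \<union> B) \<le> c (X \<union> Y) (A \<union> B)" "\<rho> (A \<inter> B) \<le> c (X \<inter> Y) (A \<inter> B)"
      using X Y AB le[of "X \<union> Y" "A \<union> B"] le[of "X \<inter> Y" "A \<inter> B"] by auto
    moreover have "c (X \<union> Y) (A \<union> B) + c (X \<inter> Y) (A \<inter> B) \<le> c X A + c Y B"
    proof -
      have d: "real (card (Q - P)) = real (card Q) - real (card P)" if "P \<subseteq> Q" "finite Q" for P Q :: "'a set"
        using that by (simp add: card_Diff_subset finite_subset of_nat_diff card_mono)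
      have "card (A \<union> B) + card (A \<inter> B) = card A + card B" using fin card_Un_Int by fastforce
      moreover have "card (X \<union> Y) + card (X \<inter> Y) = card X + card Y" using fXY card_Un_Int by fastforce
      moreover have "X \<union> Y \<subseteq> A \<union> B" "X \<inter> Y \<subseteq> A \<inter> B" using X Y by auto
      ultimately have eq: "real (card (A \<union> B - (X \<union> Y))) + real (card (A \<inter> B - (X \<inter> Y)))
          = real (card (A - X)) + real (card (B - Y))"
        using X Y fin by (simp add: d)
      have "l * real (card (A \<union> B - (X \<union> Y))) + l * real (card (A \<inter> B - (X \<inter> Y)))
          = l * real (card (A - X)) + l * real (card (B - Y))"
        unfolding distrib_left[symmetric] eq ..
      then show ?thesis using rk_submodular[of X Y] by (simp add: c_def)
    qed
    ultimately show "\<rho> (A \<union> B) + \<rho> (A \<inter> B) \<le> \<rho> A + \<rho> B" using X Y by linarith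
  qed
  then obtain w where w: "sum w F = \<rho> F" "\<forall>B\<subseteq>F. sum w B \<le> \<rho> B" "\<forall>i. 0 \<le> w i" by blast
  have "\<rho> F = real (rk F)"
  proof (rule antisym)
    show "\<rho> F \<le> real (rk F)" using le[of F F] by (simp add: c_def)
    show "real (rk F) \<le> \<rho> F" using wit[of F] cap by (auto simp: c_def)
  qed
  moreover have "sum w B \<le> real (rk B)" if "B \<subseteq> F" for B
    using w(2)[rule_format, OF that] le[of B B] that by (simp add: c_def)
  moreover have "w i \<le> l" if "i \<in> F" for i
  proof -
    have "sum w {i} \<le> \<rho> {i}" using w(2)[rule_format, of "{i}"] that by simp
    also have "\<dots> \<le> c {} {i}" using that by (intro le) auto
    finally show ?thesis by (simp add: c_def rk_empty)
  qed
  ultimately show ?thesis using w(1,3) by (intro exI[of _ w]) auto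
qed

text \<open>The cap \<open>l\<close> is the slope of the supporting line of the points \<open>(card F, rk F)\<close>,
  \<open>rk F < rk E\<close>, through the point \<open>(2n + 2 - rk E, rk E)\<close>.\<close>

theorem nochka_weights:
  assumes big: "2 * n < card E" and pos: "1 \<le> rk E"
    and span: "\<And>B. B \<subseteq> E \<Longrightarrow> card B = n + 1 \<Longrightarrow> rk B = rk E"
  shows "\<exists>w l. 0 < l \<and> (\<forall>i\<in>E. 0 \<le> w i \<and> w i \<le> l)
    \<and> sum w E = l * (real (card E) - 2 * real n - 2 + real (rk E)) + real (rk E)
    \<and> (\<forall>B\<subseteq>E. card B \<le> n \<longrightarrow> sum w B \<le> real (rk B))"
proof -
  define R where "R = rk E"
  have finite_sub: "finite B" if "B \<subseteq> E" for B using that finite_ground finite_subset by blast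
  \<comment> \<open>Each of the \<open>n + 1 - card B\<close> elements completing \<open>B\<close>
    to a set of full rank raises the rank by at most one.\<close>
  have rank_ge: "card B + R \<le> rk B + n + 1" if B: "B \<subseteq> E" "card B \<le> n + 1" for B
  proof -
    have "n + 1 - card B \<le> card (E - B)"
      using B big by (simp add: card_Diff_subset finite_sub)
    then obtain D where D: "D \<subseteq> E - B" "card D = n + 1 - card B" "finite D"
      using obtain_subset_with_card_n by blast
    have "card (B \<union> D) = n + 1"
      using B D finite_sub by (subst card_Un_disjoint) auto
    then have "rk (B \<union> D) = R" using span[of "B \<union> D"] B D by (auto simp: R_def)
    then have "R \<le> rk B + rk D" using rk_submodular[of B D] by simp
    then show ?thesis using rk_le_card[of D] D B by simp
  qed
  have card_le: "card B \<le> n" if B: "B \<subseteq> E" "rk B < R" for B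
  proof (rule ccontr)
    assume "\<not> card B \<le> n"
    then have "n + 1 \<le> card B" by simp
    then obtain D where "D \<subseteq> B" "card D = n + 1" using obtain_subset_with_card_n by metis
    then show False using span[of D] rk_mono[of D B] B by (auto simp: R_def)
  qed
  obtain B0 where B0: "B0 \<subseteq> E" "card B0 = n + 1"
    using obtain_subset_with_card_n[of "n + 1" E] big by auto
  have Rn: "R \<le> n + 1" using span[OF B0] rk_le_card[of B0] B0 finite_sub by (simp add: R_def)
  define X where "X = 2 * real n + 2 - real R"
  define \<F> where "\<F> = {A. A \<subseteq> E \<and> rk A < R}"
  define s where "s A = (real R - real (rk A)) / (X - real (card A))" for A
  have fin\<F>: "finite \<F>" using finite_ground by (simp add: \<F>_def)
  have emp: "{} \<in> \<F>" using pos rk_empty by (simp add: \<F>_def R_def)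
  define l where "l = Max (s ` \<F>)"
  have denom: "0 < X - real (card A)" if "A \<in> \<F>" for A
    using card_le[of A] that Rn by (auto simp: \<F>_def X_def)
  have "l \<in> s ` \<F>" unfolding l_def using fin\<F> emp by (intro Max_in) auto
  then obtain A where A: "A \<in> \<F>" "l = s A" by auto
  have l_ge: "s B \<le> l" if "B \<in> \<F>" for B
    unfolding l_def using fin\<F> that by simp
  have l0: "0 < l"
    using A denom[OF A(1)] by (auto simp: s_def \<F>_def)
  have A1: "real (rk A) = real R - l * (X - real (card A))"
    using A denom[OF A(1)] by (simp add: s_def)
  have above: "real R - l * (X - real (card B)) \<le> real (rk B)" if "B \<in> \<F>" for B
    using l_ge[OF that] denom[OF that] by (simp add: s_def divide_le_eq algebra_simps)
  have AE: "A \<subseteq> E" "rk A < R" "card A \<le> n" using A card_le by (auto simp: \<F>_def)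
  have cardA: "real (card A) + real R \<le> real (rk A) + real n + 1"
    using rank_ge[of A] AE by linarith
  have l1: "l \<le> 1"
  proof -
    have "real R - real (rk A) \<le> X - real (card A)" using cardA Rn by (simp add: X_def)
    then show ?thesis using A denom[OF A(1)] by (simp add: s_def)
  qed
  \<comment> \<open>By extremality of \<open>A\<close>, every subset of \<open>A\<close> lies on or
    above the line of slope \<open>l\<close> through the point of \<open>A\<close>. This is the
    hypothesis \<open>cap\<close> of \<open>capped_base\<close>.\<close>
  have "\<exists>w. sum w A = real (rk A) \<and> (\<forall>B\<subseteq>A. sum w B \<le> real (rk B)) \<and> (\<forall>i. 0 \<le> w i) \<and> (\<forall>i\<in>A. w i \<le> l)"
  proof (rule capped_base)
    fix B assume B: "B \<subseteq> A"
    then have "B \<in> \<F>" using AE rk_mono[of B A] by (auto simp: \<F>_def)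
    from above[OF this] have "real R - l * (X - real (card B)) \<le> real (rk B)" .
    moreover have "real (card (A - B)) = real (card A) - real (card B)"
      using B AE finite_sub by (simp add: card_Diff_subset finite_subset of_nat_diff card_mono)
    ultimately show "real (rk A) \<le> real (rk B) + l * real (card (A - B))"
      using A1 by (simp add: right_diff_distrib)
  qed (use AE l0 in auto)
  then obtain v where v: "sum v A = real (rk A)" "\<forall>B\<subseteq>A. sum v B \<le> real (rk B)"
    "\<forall>i. 0 \<le> v i" "\<forall>i\<in>A. v i \<le> l" by blast
  \<comment> \<open>Off \<open>A\<close> every weight equals the cap, so \<open>sum w E\<close> is
    the height of the supporting line at abscissa \<open>card E\<close>.\<close>
  define w where "w i = (if i \<in> A then v i else l)" for i
  have wsum: "sum w B = sum v (B \<inter> A) + l * real (card (B - A))" if "B \<subseteq> E" for B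
  proof -
    have "sum w B = sum w (B \<inter> A) + sum w (B - A)"
      using finite_sub[OF that] by (rule sum.Int_Diff)
    also have "sum w (B \<inter> A) = sum v (B \<inter> A)" by (intro sum.cong) (auto simp: w_def)
    also have "sum w (B - A) = (\<Sum>i\<in>B - A. l)" by (intro sum.cong) (auto simp: w_def)
    finally show ?thesis by simp
  qed
  have wE: "sum w E = l * (real (card E) - 2 * real n - 2 + real R) + real R"
  proof -
    have "E \<inter> A = A" using AE by auto
    moreover have "real (card (E - A)) = real (card E) - real (card A)"
      using AE finite_sub by (simp add: card_Diff_subset of_nat_diff card_mono finite_ground)
    ultimately have "sum w E = real (rk A) + l * (real (card E) - real (card A))"
      using wsum[of E] v by simp
    then show ?thesis using A1 by (simp add: X_def algebra_simps)
  qed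
  have wB: "sum w B \<le> real (rk B)" if B: "B \<subseteq> E" "card B \<le> n" for B
  proof -
    have 1: "sum w B \<le> real (rk (B \<inter> A)) + l * real (card (B - A))"
      using wsum[of B] v B by simp
    have sm: "rk (B \<union> A) + rk (B \<inter> A) \<le> rk B + rk A" by (rule rk_submodular)
    show ?thesis
    proof (cases "rk (B \<union> A) < R")
      case True
      then have "B \<union> A \<in> \<F>" using B AE by (auto simp: \<F>_def)
      from above[OF this] have "real R - l * (X - real (card (B \<union> A))) \<le> real (rk (B \<union> A))" .
      moreover have "card (B \<union> A) = card A + card (B - A)"
        using card_Un_disjoint[of A "B - A"] B AE finite_sub by (simp add: Un_commute)
      ultimately have "l * real (card (B - A)) \<le> real (rk (B \<union> A)) - real (rk A)"
        using A1 by (simp add: algebra_simps)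
      then show ?thesis using 1 sm by linarith
    next
      case False
      then have full: "R + rk (B \<inter> A) \<le> rk B + rk A" using sm by linarith
      show ?thesis
      proof (cases "real (card (B - A)) \<le> X - real (card A)")
        case True
        then have "l * real (card (B - A)) \<le> real R - real (rk A)"
          using A1 l0 by simp
        then show ?thesis using 1 full by linarith
      next
        case False
        have "card B = card (B \<inter> A) + card (B - A)"
          using B finite_sub card_Int_Diff[of B A] by simp
        moreover have "card B + R \<le> rk B + n + 1" using rank_ge B by simp
        moreover have "rk (B \<inter> A) \<le> card (B \<inter> A)" using B finite_sub by (intro rk_le_card) auto
        ultimately have 2: "real (rk (B \<inter> A)) + real (card (B - A)) + real R \<le> real (rk B) + real n + 1"
          by linarith
        \<comment> \<open>The deficit \<open>n + 1 - R\<close> in \<open>rank_ge\<close> must be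
          absorbed by \<open>(1 - l) * card (B - A)\<close>. As \<open>card A - rk A\<close> is
          itself only bounded by \<open>n + 1 - R\<close>, this argument needs an abscissa
          \<open>X\<close> of at least \<open>2 * n + 2 - R\<close>, which is the value
          chosen.\<close>
        have "(1 - l) * (X - real (card A)) \<le> (1 - l) * real (card (B - A))"
          using False l1 by (intro mult_left_mono) auto
        moreover have "(1 - l) * (X - real (card A)) = X - real (card A) - real R + real (rk A)"
          using A1 by (simp add: algebra_simps)
        ultimately have "real n + 1 - real R \<le> (1 - l) * real (card (B - A))"
          using cardA by (simp add: X_def)
        then show ?thesis using 1 2 by (simp add: algebra_simps)
      qed
    qed
  qed
  have "\<forall>i\<in>E. 0 \<le> w i \<and> w i \<le> l" using v l0 by (auto simp: w_def)
  then show ?thesis using l0 wE wB unfolding R_def by blast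
qed

end

section \<open>Maximum principle and division by a zero, for entire functions\<close>

lemma maximum_modulus_cball:
  assumes "f holomorphic_on UNIV" "0 < R" "\<And>z. norm z = R \<Longrightarrow> norm (f z) \<le> B" "norm z \<le> R"
  shows "norm (f z) \<le> B"
proof (rule maximum_modulus_frontier[of f "cball 0 R"])
  show "f holomorphic_on interior (cball 0 R)" using assms(1) by (rule holomorphic_on_subset) auto
  show "continuous_on (closure (cball 0 R)) f"
    using holomorphic_on_imp_continuous_on[OF assms(1)] by (rule continuous_on_subset) auto
  show "norm (f w) \<le> B" if "w \<in> frontier (cball 0 R)" for w
    using that assms(2,3) by simp
qed (use assms in auto)

lemma entire_divide_root:
  assumes "f holomorphic_on UNIV" "f a = 0"
  obtains g where "g holomorphic_on UNIV" "\<And>z. f z = (z - a) * g z"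
proof
  let ?g = "\<lambda>z. if z = a then deriv f a else f z / (z - a)"
  show "?g holomorphic_on UNIV"
    by (rule pole_theorem_open_0[OF assms(1), of a]) (use assms in auto)
  show "f z = (z - a) * ?g z" for z using assms by auto
qed

section \<open>Blaschke factors\<close>

text \<open>The factor \<open>R * (z - a) / (R\<^sup>2 - cnj a * z)\<close> has modulus one on the
  circle, so dividing by it keeps the bound 1. The relation is stated without a quotient, so that it
  also makes sense at the pole of the factor and for \<open>norm a = R\<close>.\<close>

lemma blaschke_divide:
  assumes h: "h holomorphic_on UNIV" and R: "0 < R" and le: "\<And>z. norm z \<le> R \<Longrightarrow> norm (h z) \<le> 1"
    and a: "h a = 0" "norm a \<le> R"
  obtains g where "g holomorphic_on UNIV" "\<And>z. norm z \<le> R \<Longrightarrow> norm (g z) \<le> 1"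
    "\<And>z. h z * (of_real (R\<^sup>2) - cnj a * z) = of_real R * (z - a) * g z"
    "\<And>z. h z = 0 \<Longrightarrow> z \<noteq> a \<Longrightarrow> g z = 0"
proof -
  obtain k where k: "k holomorphic_on UNIV" "\<And>z. h z = (z - a) * k z"
    using entire_divide_root[OF h a(1)] by blast
  define g where "g z = k z * (of_real (R\<^sup>2) - cnj a * z) / of_real R" for z
  have gh: "g holomorphic_on UNIV" unfolding g_def using k R by (intro holomorphic_intros) auto
  have "norm (g z) \<le> 1" if z: "norm z = R" for z
  proof -
    have "of_real (R\<^sup>2) = z * cnj z" using z complex_norm_square[of z] by simp
    then have "of_real (R\<^sup>2) - cnj a * z = z * cnj (z - a)" by (simp add: algebra_simps)
    then have "norm (of_real (R\<^sup>2) - cnj a * z) = R * norm (z - a)"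
      using z by (metis complex_mod_cnj norm_mult)
    then have "norm (g z) = norm (h z)"
      using R k(2)[of z] by (simp add: g_def norm_mult norm_divide)
    then show ?thesis using le[of z] z by simp
  qed
  then have "norm (g z) \<le> 1" if "norm z \<le> R" for z
    using maximum_modulus_cball[OF gh R _ that] by blast
  moreover have "h z * (of_real (R\<^sup>2) - cnj a * z) = of_real R * (z - a) * g z" for z
    using R by (simp add: g_def k(2))
  moreover have "g z = 0" if "h z = 0" "z \<noteq> a" for z
    using that k(2)[of z] by (simp add: g_def)
  ultimately show thesis using that gh by blast
qed

text \<open>Stands in for the zero-counting part of Jensen's formula: dividing out the Blaschke
  factor of a zero \<open>a\<close> turns the value at 0 into one larger by the factor
  \<open>R / norm a\<close>, at least \<open>R / R1\<close>. Zeros are counted without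
  multiplicity.\<close>

lemma norm_le_power_zeros:
  assumes "finite S" and R: "0 < R" "0 \<le> R1" "R1 \<le> R" and "S \<subseteq> cball 0 R1"
    and "h holomorphic_on UNIV" "\<And>z. norm z \<le> R \<Longrightarrow> norm (h z) \<le> 1" "\<And>z. z \<in> S \<Longrightarrow> h z = 0"
  shows "norm (h 0) \<le> (R1 / R) ^ card S"
  using assms(1,5-)
proof (induction S arbitrary: h)
  case empty
  then show ?case using R by simp
next
  case (insert a S)
  have na: "norm a \<le> R1" using insert.prems(1) by auto
  then have "norm a \<le> R" using R by linarith
  then obtain g where g: "g holomorphic_on UNIV" "\<And>z. norm z \<le> R \<Longrightarrow> norm (g z) \<le> 1"
    "\<And>z. h z * (of_real (R\<^sup>2) - cnj a * z) = of_real R * (z - a) * g z"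
    "\<And>z. h z = 0 \<Longrightarrow> z \<noteq> a \<Longrightarrow> g z = 0"
    using blaschke_divide[OF insert.prems(2) R(1) insert.prems(3)] insert.prems(4)[of a] by blast
  have IH: "norm (g 0) \<le> (R1 / R) ^ card S"
  proof (rule insert.IH)
    show "g z = 0" if "z \<in> S" for z using g(4) insert.prems(4)[of z] insert.hyps(2) that by auto
  qed (use g insert.prems in auto)
  have "norm (h 0) * R\<^sup>2 = R * norm a * norm (g 0)"
    using arg_cong[OF g(3)[of 0], of norm] R by (simp add: norm_mult norm_power)
  then have "norm (h 0) = norm a / R * norm (g 0)" using R by (simp add: field_simps power2_eq_square)
  also have "\<dots> \<le> R1 / R * (R1 / R) ^ card S"
    using na R IH by (intro mult_mono divide_right_mono) auto
  finally show ?case using insert.hyps by simp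
qed

text \<open>\<open>M\<close> is a budget of divisions: each removed zero raises the modulus at 0 by
  a factor of at least \<open>R / R1\<close>, and 1 is never exceeded. A multiple zero is divided
  out repeatedly but enters \<open>Z\<close> once. At distance \<open>d\<close> from its zero a
  Blaschke factor has modulus at least \<open>d / (2 * R)\<close>, because its denominator is at
  most \<open>2 * R\<^sup>2\<close>; this gives the lower bound for \<open>h\<close>.\<close>

lemma blaschke_factorization:
  assumes R: "0 < R1" "R1 < R"
    and "h holomorphic_on UNIV" "\<And>z. norm z \<le> R \<Longrightarrow> norm (h z) \<le> 1" "(R1 / R) ^ M \<le> norm (h 0)"
  shows "\<exists>g Z. g holomorphic_on UNIV \<and> (\<forall>z. norm z \<le> R \<longrightarrow> norm (g z) \<le> 1) \<and> (\<forall>z. norm z \<le> R1 \<longrightarrow> g z \<noteq> 0)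
     \<and> norm (h 0) \<le> norm (g 0) \<and> finite Z \<and> card Z \<le> M \<and> {z. norm z \<le> R1 \<and> h z = 0} \<subseteq> Z
     \<and> (\<forall>d z. 0 \<le> d \<longrightarrow> d \<le> 2 * R \<longrightarrow> norm z \<le> R \<longrightarrow> (\<forall>a\<in>Z. d \<le> norm (z - a)) \<longrightarrow>
            norm (g z) * (d / (2 * R)) ^ M \<le> norm (h z))"
  using assms(3-)
proof (induction M arbitrary: h)
  case (0 h)
  have "h a \<noteq> 0" if a: "norm a \<le> R1" for a
  proof
    assume "h a = 0"
    then have "norm (h 0) \<le> (R1 / R) ^ card {a}"
      using a R 0 by (intro norm_le_power_zeros) auto
    also have "\<dots> < 1" using R by simp
    finally show False using 0(3) by simp
  qed
  then show ?case using 0 by (intro exI[of _ h] exI[of _ "{}"]) auto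
next
  case (Suc M h)
  show ?case
  proof (cases "\<exists>a. norm a \<le> R1 \<and> h a = 0")
    case False
    have "norm (h z) * (d / (2 * R)) ^ Suc M \<le> norm (h z)" if "0 \<le> d" "d \<le> 2 * R" for d z
      using that R power_le_one[of "d / (2 * R)" "Suc M"] by (intro mult_left_le) auto
    then show ?thesis using False Suc.prems by (intro exI[of _ h] exI[of _ "{}"]) auto
  next
    case True
    then obtain a where a: "norm a \<le> R1" "h a = 0" by auto
    have R0: "0 < R" "norm a \<le> R" using R a by auto
    obtain g where g: "g holomorphic_on UNIV" "\<And>z. norm z \<le> R \<Longrightarrow> norm (g z) \<le> 1"
      "\<And>z. h z * (of_real (R\<^sup>2) - cnj a * z) = of_real R * (z - a) * g z"
      "\<And>z. h z = 0 \<Longrightarrow> z \<noteq> a \<Longrightarrow> g z = 0"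
      using blaschke_divide[OF Suc.prems(1) R0(1) Suc.prems(2) a(2) R0(2)] by blast
    have "norm (h 0) * R\<^sup>2 = R * norm a * norm (g 0)"
      using arg_cong[OF g(3)[of 0], of norm] R by (simp add: norm_mult norm_power)
    then have h0: "norm (h 0) * R = norm a * norm (g 0)" using R by (simp add: field_simps power2_eq_square)
    also have "\<dots> \<le> R1 * norm (g 0)" using a by (intro mult_right_mono) auto
    finally have h1: "norm (h 0) * R \<le> R1 * norm (g 0)" .
    have "(R1 / R) ^ Suc M * R \<le> R1 * norm (g 0)"
      using mult_right_mono[OF Suc.prems(3), of R] R h1 by linarith
    then have g0: "(R1 / R) ^ M \<le> norm (g 0)" using R by simp
    have "norm (h 0) * R \<le> R * norm (g 0)"
      using order_trans[OF h1 mult_right_mono[OF less_imp_le[OF R(2)] norm_ge_zero]] .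
    then have hg: "norm (h 0) \<le> norm (g 0)" using R by simp
    obtain k Z where k: "k holomorphic_on UNIV" "\<forall>z. norm z \<le> R \<longrightarrow> norm (k z) \<le> 1" "\<forall>z. norm z \<le> R1 \<longrightarrow> k z \<noteq> 0"
     "norm (g 0) \<le> norm (k 0)" "finite Z" "card Z \<le> M" "{z. norm z \<le> R1 \<and> g z = 0} \<subseteq> Z"
     "\<And>d z. 0 \<le> d \<Longrightarrow> d \<le> 2 * R \<Longrightarrow> norm z \<le> R \<Longrightarrow> \<forall>a\<in>Z. d \<le> norm (z - a) \<Longrightarrow>
            norm (k z) * (d / (2 * R)) ^ M \<le> norm (g z)"
      using Suc.IH[OF g(1,2) g0] by blast
    have "norm (k z) * (d / (2 * R)) ^ Suc M \<le> norm (h z)"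
      if d: "0 \<le> d" "d \<le> 2 * R" "norm z \<le> R" "\<forall>b\<in>insert a Z. d \<le> norm (z - b)" for d z
    proof -
      have "norm (of_real (R\<^sup>2) - cnj a * z) \<le> R\<^sup>2 + norm a * norm z"
        by (rule order_trans[OF norm_triangle_ineq4]) (simp add: norm_mult norm_power)
      also have "norm a * norm z \<le> R * R" using d R0 by (intro mult_mono) auto
      finally have B: "norm (of_real (R\<^sup>2) - cnj a * z) \<le> 2 * R * R" by (simp add: power2_eq_square)
      have "norm (k z) * (d / (2 * R)) ^ Suc M * (2 * R * R) = (norm (k z) * (d / (2 * R)) ^ M) * (R * d)"
        using R by (simp add: field_simps)
      also have "\<dots> \<le> norm (g z) * (R * norm (z - a))"
        using k(8)[of d z] d R by (intro mult_mono) auto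
      also have "\<dots> = norm (h z) * norm (of_real (R\<^sup>2) - cnj a * z)"
        using arg_cong[OF g(3)[of z], of norm] R by (simp add: norm_mult mult_ac)
      also have "\<dots> \<le> norm (h z) * (2 * R * R)" using B by (intro mult_left_mono) auto
      finally show ?thesis by (rule mult_right_le_imp_le) (use R in simp)
    qed
    moreover have "{z. norm z \<le> R1 \<and> h z = 0} \<subseteq> insert a Z" using k(7) g(4) by auto
    moreover have "card (insert a Z) \<le> Suc M" using k(5,6) by (simp add: card_insert_if)
    moreover have "norm (h 0) \<le> norm (k 0)" using hg k(4) by simp
    ultimately show ?thesis
      using k(1,2,3,5) by (intro exI[of _ k] exI[of _ "insert a Z"]) auto
  qed
qed

section \<open>Lower bounds and logarithmic derivatives\<close>

text \<open>The Moebius map \<open>u / (2 * A - u)\<close> fixes 0 and sends the half-plane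
  \<open>Re u < A\<close> into the unit disc, so Schwarz's lemma applies.\<close>

lemma borel_caratheodory:
  assumes f: "f holomorphic_on ball 0 r" "f 0 = 0" and A: "\<And>z. norm z < r \<Longrightarrow> Re (f z) < A"
    and z: "norm z < r"
  shows "norm (f z) \<le> 2 * A * norm z / (r - norm z)"
proof -
  have r: "0 < r" using z norm_ge_zero[of z] by linarith
  have A0: "0 < A" using A[of 0] f r by simp
  have nz: "2 * of_real A - f w \<noteq> 0" if "norm w < r" for w
    using A[OF that] A0 by (auto simp: complex_eq_iff)
  have less: "norm (f w) < norm (2 * of_real A - f w)" if "norm w < r" for w
  proof -
    have "norm (f w) ^ 2 < norm (2 * of_real A - f w) ^ 2"
    proof -
      have "norm (2 * of_real A - f w) ^ 2 = norm (f w) ^ 2 + 4 * A * (A - Re (f w))"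
        unfolding cmod_power2 by (simp add: power2_eq_square algebra_simps)
      then show ?thesis using A[OF that] A0 by simp
    qed
    then show ?thesis by (rule power2_less_imp_less) simp
  qed
  define g where "g w = f (of_real r * w) / (2 * of_real A - f (of_real r * w))" for w
  have in_ball: "norm (of_real r * w) < r" if "norm w < 1" for w :: complex
    using that r by (simp add: norm_mult)
  have "(f \<circ> (\<lambda>w. of_real r * w)) holomorphic_on ball 0 1"
    by (rule holomorphic_on_compose_gen[OF _ f(1)]) (use in_ball in \<open>auto intro!: holomorphic_intros\<close>)
  then have fr: "(\<lambda>w. f (of_real r * w)) holomorphic_on ball 0 1" by (simp add: o_def)
  have g1: "g holomorphic_on ball 0 1"
    unfolding g_def using nz in_ball by (intro holomorphic_intros fr) auto
  have g0: "g 0 = 0" using f(2) by (simp add: g_def)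
  have g2: "norm (g w) < 1" if "norm w < 1" for w
    using less[OF in_ball[OF that]] nz[OF in_ball[OF that]] by (simp add: g_def norm_divide divide_simps)
  have g3: "norm (z / of_real r) < 1" using z r by (simp add: norm_divide)
  have "norm (g (z / of_real r)) \<le> norm (z / of_real r)"
    by (rule Schwarz_Lemma(1)[OF g1 g0 g2 g3])
  then have "norm (f z) / norm (2 * of_real A - f z) \<le> norm z / r"
    using r by (simp add: g_def norm_divide)
  then have "norm (f z) * r \<le> norm z * norm (2 * of_real A - f z)"
    using r nz[OF z] by (simp add: divide_simps mult_ac)
  also have "\<dots> \<le> norm z * (2 * A + norm (f z))"
    using A0 norm_triangle_ineq4[of "2 * of_real A" "f z"] by (intro mult_left_mono) auto
  finally show ?thesis using z by (simp add: field_simps)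
qed

text \<open>A substitute for Harnack's inequality: the logarithm of \<open>g\<close>, normalized to
  vanish at \<open>c\<close>, has real part at most \<open>A\<close>, and Borel-Caratheodory turns
  this one-sided bound into a two-sided one.\<close>

lemma nonvanishing_growth:
  assumes g: "g holomorphic_on ball c R" "\<And>z. z \<in> ball c R \<Longrightarrow> g z \<noteq> 0" "\<And>z. z \<in> ball c R \<Longrightarrow> norm (g z) \<le> 1"
    and A: "exp (- A) \<le> norm (g c)" and z: "norm z < R"
  shows "exp (- (2 * (A + 1) * norm z / (R - norm z))) * norm (g c) \<le> norm (g (c + z))"
    and "norm (g (c + z)) \<le> exp (2 * (A + 1) * norm z / (R - norm z)) * norm (g c)"
proof -
  have R: "0 < R" using z norm_ge_zero[of z] by linarith
  have "contractible (ball c R)" by (simp add: convex_imp_contractible)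
  then obtain \<phi> where \<phi>: "\<phi> holomorphic_on ball c R" "\<And>z. z \<in> ball c R \<Longrightarrow> g z = exp (\<phi> z)"
    using contractible_imp_holomorphic_log[OF g(1)] g(2) by blast
  define f where "f w = \<phi> (c + w) - \<phi> c" for w
  have inb: "c + w \<in> ball c R" if "norm w < R" for w using that by (simp add: dist_norm)
  have "(\<phi> \<circ> (\<lambda>w. c + w)) holomorphic_on ball 0 R"
    by (rule holomorphic_on_compose_gen[OF _ \<phi>(1)]) (use inb in \<open>auto intro!: holomorphic_intros\<close>)
  then have f1: "f holomorphic_on ball 0 R" unfolding f_def o_def by (intro holomorphic_intros)
  have fe: "norm (g (c + w)) = exp (Re (f w)) * norm (g c)" if "norm w < R" for w
    using \<phi>(2)[OF inb[OF that]] \<phi>(2)[of c] R by (simp add: f_def exp_diff)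
  \<comment> \<open>The extra 1 buys the strict inequality that \<open>borel_caratheodory\<close>
    asks for.\<close>
  have "Re (f w) < A + 1" if "norm w < R" for w
  proof -
    have "exp (Re (f w)) * exp (- A) \<le> exp (Re (f w)) * norm (g c)" using A by simp
    also have "\<dots> \<le> 1" using g(3)[OF inb[OF that]] fe[OF that] by simp
    finally have "exp (Re (f w) - A) \<le> 1" by (simp add: exp_diff exp_minus field_simps)
    then show ?thesis by simp
  qed
  then have "norm (f z) \<le> 2 * (A + 1) * norm z / (R - norm z)"
    by (intro borel_caratheodory[OF f1 _ _ z]) (simp_all add: f_def)
  then have "\<bar>Re (f z)\<bar> \<le> 2 * (A + 1) * norm z / (R - norm z)"
    using abs_Re_le_cmod[of "f z"] by linarith
  then have *: "Re (f z) \<le> 2 * (A + 1) * norm z / (R - norm z)" "- (2 * (A + 1) * norm z / (R - norm z)) \<le> Re (f z)"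
    by linarith+
  show "exp (- (2 * (A + 1) * norm z / (R - norm z))) * norm (g c) \<le> norm (g (c + z))"
    unfolding fe[OF z] using *(2) by (intro mult_right_mono) auto
  show "norm (g (c + z)) \<le> exp (2 * (A + 1) * norm z / (R - norm z)) * norm (g c)"
    unfolding fe[OF z] using *(1) by (intro mult_right_mono) auto
qed

text \<open>The radius \<open>t = d / (2 * A + 3)\<close> makes the exponent of
  \<open>nonvanishing_growth\<close> equal to 1. On the circle of that radius \<open>h\<close>
  exceeds its central value by at most the factor \<open>exp 1\<close>, and Cauchy's inequality does
  the rest.\<close>

lemma higher_logarithmic_derivative_bound:
  assumes h: "h holomorphic_on UNIV" "0 < d" "\<And>w. w \<in> ball z d \<Longrightarrow> h w \<noteq> 0" "\<And>w. w \<in> ball z d \<Longrightarrow> norm (h w) \<le> 1"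
    and A: "exp (- A) \<le> norm (h z)" "0 \<le> A"
  shows "norm ((deriv ^^ l) h z) \<le> fact l * exp 1 * ((2 * A + 3) / d) ^ l * norm (h z)"
proof -
  define t where "t = d / (2 * A + 3)"
  have t: "0 < t" "t < d" using h(2) A(2) by (auto simp: t_def divide_simps)
  have td: "2 * (A + 1) * t / (d - t) = 1"
    using t h(2) A(2) by (simp add: t_def divide_simps) (simp add: algebra_simps)
  have "norm (h x) \<le> exp 1 * norm (h z)" if x: "norm (z - x) = t" for x
  proof -
    have "norm (h (z + (x - z))) \<le> exp (2 * (A + 1) * norm (x - z) / (d - norm (x - z))) * norm (h z)"
      by (rule nonvanishing_growth(2)[OF holomorphic_on_subset[OF h(1)]])
         (use h A x t in \<open>auto simp: norm_minus_commute\<close>)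
    moreover have "norm (x - z) = t" using x by (simp add: norm_minus_commute)
    ultimately show ?thesis by (simp only: td add_diff_cancel_left' add_diff_cancel_right' diff_add_cancel add.commute[of z])
  qed
  then have "norm ((deriv ^^ l) h z) \<le> fact l * (exp 1 * norm (h z)) / t ^ l"
    using t by (intro Cauchy_inequality holomorphic_on_subset[OF h(1)]
        continuous_on_subset[OF holomorphic_on_imp_continuous_on[OF h(1)]]) auto
  then show ?thesis by (simp add: t_def power_divide mult_ac)
qed

text \<open>Pigeonhole: among \<open>N + 1\<close> radii with spacing twice the required distance,
  each point spoils at most one.\<close>

lemma circle_avoiding_points:
  fixes Z :: "complex set"
  assumes "finite Z" "card Z \<le> N" "\<rho> < \<sigma>"
  shows "\<exists>r. \<rho> < r \<and> r < \<sigma> \<and> (\<forall>a\<in>Z. (\<sigma> - \<rho>) / (2 * (real N + 1)) \<le> \<bar>r - norm a\<bar>)"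
proof (rule ccontr)
  assume con: "\<not> ?thesis"
  define d where "d = (\<sigma> - \<rho>) / (2 * (real N + 1))"
  have d: "0 < d" using assms by (simp add: d_def)
  define t where "t i = \<rho> + (2 * real i + 1) * d" for i :: nat
  have "\<exists>a\<in>Z. \<bar>t i - norm a\<bar> < d" if "i \<le> N" for i
  proof -
    have "(2 * real i + 1) * d < (2 * (real N + 1)) * d"
      using that d by (intro mult_strict_right_mono) auto
    also have "\<dots> = \<sigma> - \<rho>" by (simp add: d_def)
    finally have "\<rho> < t i" "t i < \<sigma>" using d by (auto simp: t_def)
    then show ?thesis using con by (auto simp: d_def not_le)
  qed
  then obtain a where a: "\<And>i. i \<le> N \<Longrightarrow> a i \<in> Z" "\<And>i. i \<le> N \<Longrightarrow> \<bar>t i - norm (a i)\<bar> < d"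
    by metis
  have "inj_on a {..N}"
  proof (rule inj_onI)
    fix i j assume ij: "i \<in> {..N}" "j \<in> {..N}" "a i = a j"
    then have "\<bar>t i - t j\<bar> < 2 * d" using a(2)[of i] a(2)[of j] by auto
    moreover have "t i - t j = (2 * d) * (real i - real j)" by (simp add: t_def algebra_simps)
    ultimately have "\<bar>real i - real j\<bar> < 1" using d by (simp add: abs_mult)
    then show "i = j" by linarith
  qed
  then have "card {..N} \<le> card Z" using a(1) assms(1) by (intro card_inj_on_le[of a]) auto
  then show False using assms(2) by simp
qed

text \<open>In place of the integrated lemma on the logarithmic derivative: off small discs around the
  at most \<open>2 X\<^sup>3\<close> zeros of each function the bound is pointwise, and some circle avoids these discs.\<close>

lemma logarithmic_derivatives_on_circle:
  fixes q k :: nat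
  shows "\<exists>C\<ge>1. \<forall>X \<rho> R (h :: nat \<Rightarrow> complex \<Rightarrow> complex). 1 \<le> X \<longrightarrow> 0 < \<rho> \<longrightarrow> \<rho> < R \<longrightarrow> R \<le> X \<longrightarrow> 3 / (R - \<rho>) \<le> X \<longrightarrow>
    (\<forall>i<q. h i holomorphic_on UNIV \<and> (\<forall>z. norm z \<le> R \<longrightarrow> norm (h i z) \<le> 1) \<and> exp (- X) \<le> norm (h i 0)) \<longrightarrow>
    (\<exists>r. \<rho> < r \<and> r < R \<and> (\<forall>i<q. \<forall>z. norm z = r \<longrightarrow> h i z \<noteq> 0 \<and>
      (\<forall>l\<le>k. norm ((deriv ^^ l) (h i) z) \<le> C * X ^ (12 * k) * norm (h i z))))"
proof -
  define c where "c = (32 * real q + 31) * (2 * (2 * real q + 1))"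
  have c1: "1 \<le> c" unfolding c_def by (rule mult_ge1_I) auto
  define C where "C = fact k * exp 1 * c ^ k"
  have "1 \<le> C"
  proof -
    have "1 \<le> exp (1::real)" by simp
    then show ?thesis unfolding C_def using c1 by (intro mult_ge1_I one_le_power fact_ge_1) auto
  qed
  moreover have "\<exists>r. \<rho> < r \<and> r < R \<and> (\<forall>i<q. \<forall>z. norm z = r \<longrightarrow> h i z \<noteq> 0 \<and>
      (\<forall>l\<le>k. norm ((deriv ^^ l) (h i) z) \<le> C * X ^ (12 * k) * norm (h i z)))"
    if X: "1 \<le> X" and rho: "0 < \<rho>" "\<rho> < R" "R \<le> X" "3 / (R - \<rho>) \<le> X"
    and h: "\<forall>i<q. h i holomorphic_on UNIV \<and> (\<forall>z. norm z \<le> R \<longrightarrow> norm (h i z) \<le> 1) \<and> exp (- X) \<le> norm (h i 0)"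
    for X \<rho> R and h :: "nat \<Rightarrow> complex \<Rightarrow> complex"
  proof -
    \<comment> \<open>Three zones of width \<open>\<eta>\<close>: the circle is sought below
      \<open>\<rho> + \<eta>\<close>, zeros are removed up to
      \<open>R1 = \<rho> + 2 * \<eta>\<close>, and the bound by 1 holds up to \<open>R\<close>. The
      assumption on \<open>X\<close> makes \<open>\<eta>\<close> at least
      \<open>1 / X\<close>.\<close>
    define \<eta> where "\<eta> = (R - \<rho>) / 3"
    have eta: "0 < \<eta>" "1 / X \<le> \<eta>" "R = \<rho> + 3 * \<eta>"
      using rho X by (auto simp: \<eta>_def field_simps)
    define R1 where "R1 = \<rho> + 2 * \<eta>"
    have R1: "0 < R1" "R1 < R" "R1 = R - \<eta>" using rho eta by (auto simp: R1_def)
    \<comment> \<open>Since \<open>1 - R1 / R = \<eta> / R \<ge> 1 / X ^ 2\<close>, about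
      \<open>X ^ 3\<close> divisions use up the initial deficit \<open>exp (- X)\<close>.\<close>
    define M where "M = nat \<lceil>X ^ 3\<rceil>"
    have X3: "1 \<le> X ^ 3" using X by simp
    have M: "X ^ 3 \<le> real M" "real M \<le> 2 * X ^ 3" using X3 unfolding M_def by linarith+
    have pM: "(R1 / R) ^ M \<le> exp (- X)"
    proof -
      have "R1 / R = 1 + - (\<eta> / R)" using R1 by (simp add: field_simps)
      also have "\<dots> \<le> exp (- (\<eta> / R))" by (rule exp_ge_add_one_self)
      also have "\<dots> \<le> exp (- (1 / X ^ 2))"
      proof -
        have "1 / X ^ 2 = (1 / X) / X" by (simp add: power2_eq_square)
        also have "\<dots> \<le> \<eta> / R" using eta R1 rho X by (intro frac_le) auto
        finally show ?thesis by simp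
      qed
      finally have "(R1 / R) ^ M \<le> exp (- (1 / X ^ 2)) ^ M" using R1 by (intro power_mono) auto
      also have "\<dots> = exp (- (real M / X ^ 2))" by (simp add: exp_of_nat_mult[symmetric])
      also have "\<dots> \<le> exp (- X)"
      proof -
        have "X = X ^ 3 / X ^ 2" using X by (simp add: power2_eq_square power3_eq_cube)
        also have "\<dots> \<le> real M / X ^ 2" using M X by (intro divide_right_mono) auto
        finally show ?thesis by simp
      qed
      finally show ?thesis .
    qed
    define Q where "Q i g Z \<longleftrightarrow> g holomorphic_on UNIV \<and> (\<forall>z. norm z \<le> R \<longrightarrow> norm (g z) \<le> 1) \<and> (\<forall>z. norm z \<le> R1 \<longrightarrow> g z \<noteq> 0)
     \<and> norm (h i 0) \<le> norm (g 0) \<and> finite Z \<and> card Z \<le> M \<and> {z. norm z \<le> R1 \<and> h i z = 0} \<subseteq> Z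
     \<and> (\<forall>d z. 0 \<le> d \<longrightarrow> d \<le> 2 * R \<longrightarrow> norm z \<le> R \<longrightarrow> (\<forall>a\<in>Z. d \<le> norm (z - a)) \<longrightarrow>
            norm (g z) * (d / (2 * R)) ^ M \<le> norm (h i z))" for i g Z
    have "\<exists>g Z. Q i g Z" if "i < q" for i
      unfolding Q_def
    proof (rule blaschke_factorization[OF R1(1,2)])
      show "(R1 / R) ^ M \<le> norm (h i 0)" using pM h that by fastforce
    qed (use h that in auto)
    then have "\<forall>i. \<exists>g Z. i < q \<longrightarrow> Q i g Z" by blast
    then obtain g where "\<forall>i. \<exists>Z. i < q \<longrightarrow> Q i (g i) Z" by (rule choice[THEN exE])
    then obtain Z where "\<forall>i. i < q \<longrightarrow> Q i (g i) (Z i)" by (rule choice[THEN exE])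
    then have gZ: "\<And>i. i < q \<Longrightarrow> g i holomorphic_on UNIV" "\<And>i z. i < q \<Longrightarrow> norm z \<le> R \<Longrightarrow> norm (g i z) \<le> 1"
      "\<And>i z. i < q \<Longrightarrow> norm z \<le> R1 \<Longrightarrow> g i z \<noteq> 0" "\<And>i. i < q \<Longrightarrow> norm (h i 0) \<le> norm (g i 0)"
      "\<And>i. i < q \<Longrightarrow> finite (Z i)" "\<And>i. i < q \<Longrightarrow> card (Z i) \<le> M" "\<And>i. i < q \<Longrightarrow> {z. norm z \<le> R1 \<and> h i z = 0} \<subseteq> Z i"
      "\<And>i d z. i < q \<Longrightarrow> 0 \<le> d \<Longrightarrow> d \<le> 2 * R \<Longrightarrow> norm z \<le> R \<Longrightarrow> (\<forall>a\<in>Z i. d \<le> norm (z - a)) \<Longrightarrow>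
            norm (g i z) * (d / (2 * R)) ^ M \<le> norm (h i z)"
      unfolding Q_def by simp_all
    have cardZ: "card (\<Union>i<q. Z i) \<le> q * M"
    proof -
      have "card (\<Union>i<q. Z i) \<le> (\<Sum>i<q. card (Z i))" by (rule card_UN_le) simp
      also have "\<dots> \<le> (\<Sum>i<q. M)" using gZ(6) by (intro sum_mono) auto
      finally show ?thesis by simp
    qed
    obtain r where r: "\<rho> < r" "r < \<rho> + \<eta>"
      "\<forall>a\<in>(\<Union>i<q. Z i). (\<rho> + \<eta> - \<rho>) / (2 * (real (q * M) + 1)) \<le> \<bar>r - norm a\<bar>"
      using circle_avoiding_points[of "\<Union>i<q. Z i" "q * M" \<rho> "\<rho> + \<eta>"] gZ(5) cardZ eta(1) by auto
    \<comment> \<open>A zone of width at least \<open>1 / X\<close>, shared by at most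
      \<open>2 * q * X ^ 3\<close> zeros, leaves a clearance of order
      \<open>1 / X ^ 4\<close>.\<close>
    define d where "d = 1 / (2 * (2 * real q + 1) * X ^ 4)"
    have d0: "0 < d" using X by (simp add: d_def)
    have X4: "1 / X ^ 4 = (1 / X) / X ^ 3" by (simp add: power_numeral_reduce)
    have d_le: "d \<le> \<eta> / (2 * (real (q * M) + 1))"
    proof -
      have "real (q * M) + 1 \<le> real q * (2 * X ^ 3) + X ^ 3"
        using M X3 by (simp add: mult_left_mono add_mono)
      also have "\<dots> = (2 * real q + 1) * X ^ 3" by (simp add: algebra_simps)
      finally have "2 * (real (q * M) + 1) \<le> 2 * (2 * real q + 1) * X ^ 3" by (simp add: algebra_simps)
      then have "(1 / X) / (2 * (2 * real q + 1) * X ^ 3) \<le> \<eta> / (2 * (real (q * M) + 1))"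
        using eta X by (intro frac_le) (auto intro: add_nonneg_pos)
      moreover have "d = (1 / X) / (2 * (2 * real q + 1) * X ^ 3)"
        by (simp add: d_def power_numeral_reduce)
      ultimately show ?thesis by simp
    qed
    have d_eta: "d \<le> \<eta>"
    proof -
      have "\<eta> / (2 * (real (q * M) + 1)) \<le> \<eta> / 1"
        using eta by (intro divide_left_mono) (auto intro!: add_nonneg_pos)
      then show ?thesis using d_le by simp
    qed
    have far: "d \<le> norm (z - a)" if "i < q" "a \<in> Z i" "norm z = r" for i a z
    proof -
      have "\<eta> / (2 * (real (q * M) + 1)) \<le> \<bar>r - norm a\<bar>" using r(3) that by auto
      also have "\<dots> \<le> norm (z - a)" using that norm_triangle_ineq3[of z a] by simp
      finally show ?thesis using d_le by simp
    qed
    \<comment> \<open>\<open>exp (- A)\<close> is the guaranteed size of \<open>h i\<close> on the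
      circle. The zero-free factor accounts for \<open>X\<close> at the origin and for
      \<open>2 * (X + 1) * X ^ 2\<close> on the way out; each of \<open>M\<close> Blaschke factors
      costs at most \<open>2 * X / d\<close>. Hence \<open>A\<close> is of order at most
      \<open>X ^ 8\<close> and \<open>(2 * A + 3) / d\<close> of order at most
      \<open>X ^ 12\<close>, which is the source of the exponent \<open>12 * k\<close>.\<close>
    define A where "A = X + 2 * (X + 1) * X ^ 2 + real M * (2 * X / d)"
    have A0: "0 \<le> A" unfolding A_def using X d0 by (intro add_nonneg_nonneg mult_nonneg_nonneg divide_nonneg_pos) auto
    have Xp: "X ^ i \<le> X ^ j" if "i \<le> j" for i j :: nat using X that by (rule power_increasing[rotated])
    have A_le: "(2 * A + 3) / d \<le> c * X ^ 12"
    proof -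
      have "2 * (X + 1) * X ^ 2 = 2 * X ^ 3 + 2 * X ^ 2" by (simp add: algebra_simps power_numeral_reduce)
      also have "\<dots> \<le> 2 * X ^ 8 + 2 * X ^ 8" using Xp[of 3 8] Xp[of 2 8] by simp
      finally have 1: "2 * (X + 1) * X ^ 2 \<le> 4 * X ^ 8" by simp
      have "real M * (2 * X / d) \<le> (2 * X ^ 3) * (2 * X / d)"
        using M X d0 by (intro mult_right_mono) auto
      also have "\<dots> = (8 * (2 * real q + 1)) * X ^ 8" by (simp add: d_def power_numeral_reduce)
      finally have "A \<le> X ^ 8 + 4 * X ^ 8 + (8 * (2 * real q + 1)) * X ^ 8"
        unfolding A_def using 1 Xp[of 1 8] by simp
      then have "2 * A + 3 \<le> 2 * (X ^ 8 + 4 * X ^ 8 + (8 * (2 * real q + 1)) * X ^ 8) + 5 * X ^ 8"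
        using Xp[of 0 8] by simp
      also have "\<dots> = (32 * real q + 31) * X ^ 8" by (simp add: algebra_simps)
      finally have "(2 * A + 3) / d \<le> (32 * real q + 31) * X ^ 8 / d"
        using d0 by (intro divide_right_mono) auto
      also have "\<dots> = c * X ^ 12" by (simp add: d_def c_def power_numeral_reduce)
      finally show ?thesis .
    qed
    have "h i z \<noteq> 0 \<and> (\<forall>l\<le>k. norm ((deriv ^^ l) (h i) z) \<le> C * X ^ (12 * k) * norm (h i z))"
      if i: "i < q" and z: "norm z = r" for i z
    proof -
      have hi: "h i holomorphic_on UNIV" "\<And>z. norm z \<le> R \<Longrightarrow> norm (h i z) \<le> 1" "exp (- X) \<le> norm (h i 0)"
        using h i by auto
      have zR: "norm z \<le> R1 - \<eta>" using z r by (simp add: R1_def)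
      have ball: "norm w \<le> R1" "h i w \<noteq> 0" if w: "w \<in> ball z d" for w
      proof -
        have dw: "norm (z - w) < d" using w by (simp add: dist_norm)
        have "norm w \<le> norm z + norm (z - w)" using norm_triangle_ineq4[of z "z - w"] by simp
        then show w1: "norm w \<le> R1" using zR d_eta dw by linarith
        show "h i w \<noteq> 0"
        proof
          assume "h i w = 0"
          then have "w \<in> Z i" using gZ(7)[OF i] w1 by auto
          then show False using far[OF i _ z] dw by fastforce
        qed
      qed
      have lower: "exp (- A) \<le> norm (h i z)"
      proof -
        have gi: "exp (- X) \<le> norm (g i 0)" using gZ(4)[OF i] hi(3) by linarith
        have frac: "2 * (X + 1) * norm z / (R1 - norm z) \<le> 2 * (X + 1) * X ^ 2"
        proof -
          have "norm z / (R1 - norm z) \<le> X / (1 / X)"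
            using zR R1 rho eta X by (intro frac_le) auto
          then show ?thesis
            using X mult_left_mono[of "norm z / (R1 - norm z)" "X / (1 / X)" "2 * (X + 1)"]
            by (simp add: power2_eq_square)
        qed
        have "exp (- (2 * (X + 1) * X ^ 2)) * exp (- X)
            \<le> exp (- (2 * (X + 1) * norm z / (R1 - norm z))) * norm (g i 0)"
          using frac gi by (intro mult_mono) auto
        also have "\<dots> \<le> norm (g i (0 + z))"
          by (rule nonvanishing_growth(1)[OF holomorphic_on_subset[OF gZ(1)[OF i]]])
             (use gZ i R1 zR gi eta in auto)
        finally have g1: "exp (- (2 * (X + 1) * X ^ 2)) * exp (- X) \<le> norm (g i z)" by simp
        have d2: "d \<le> 2 * R" using d_eta eta rho by linarith
        have "exp (- (2 * X / d)) \<le> exp (- (2 * R / d))"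
          using d0 rho by (simp add: divide_right_mono)
        also have "exp (- (2 * R / d)) \<le> d / (2 * R)"
        proof -
          have "2 * R / d \<le> exp (2 * R / d)" using exp_ge_add_one_self[of "2 * R / d"] by linarith
          then have "inverse (exp (2 * R / d)) \<le> inverse (2 * R / d)"
            using d0 rho by (intro le_imp_inverse_le) auto
          then show ?thesis by (simp add: exp_minus inverse_eq_divide)
        qed
        finally have "exp (- (2 * X / d)) ^ M \<le> (d / (2 * R)) ^ M" by (intro power_mono) auto
        then have d3: "exp (- (real M * (2 * X / d))) \<le> (d / (2 * R)) ^ M"
          by (simp add: exp_of_nat_mult[symmetric])
        have "exp (- A) = (exp (- (2 * (X + 1) * X ^ 2)) * exp (- X)) * exp (- (real M * (2 * X / d)))"
          by (simp add: A_def exp_add[symmetric])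
        also have "\<dots> \<le> norm (g i z) * (d / (2 * R)) ^ M"
          using g1 d3 by (intro mult_mono) auto
        also have "\<dots> \<le> norm (h i z)"
          using gZ(8)[OF i, of d z] d0 d2 far[OF i _ z] zR R1 eta by auto
        finally show ?thesis .
      qed
      have "norm ((deriv ^^ l) (h i) z) \<le> C * X ^ (12 * k) * norm (h i z)" if l: "l \<le> k" for l
      proof -
        have "norm ((deriv ^^ l) (h i) z) \<le> fact l * exp 1 * ((2 * A + 3) / d) ^ l * norm (h i z)"
          by (rule higher_logarithmic_derivative_bound[OF hi(1) d0 _ _ lower A0])
             (use ball hi(2) R1 in force)+
        also have "\<dots> \<le> C * X ^ (12 * k) * norm (h i z)"
        proof (intro mult_right_mono)
          have "((2 * A + 3) / d) ^ l \<le> (c * X ^ 12) ^ l"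
            using A_le A0 d0 by (intro power_mono) auto
          also have "\<dots> \<le> (c * X ^ 12) ^ k"
            using l c1 X by (intro power_increasing mult_ge1_I one_le_power) auto
          finally have "((2 * A + 3) / d) ^ l \<le> c ^ k * X ^ (12 * k)"
            by (simp add: power_mult_distrib power_mult)
          then have "fact l * exp 1 * ((2 * A + 3) / d) ^ l \<le> fact k * exp 1 * (c ^ k * X ^ (12 * k))"
            using l A0 d0 by (intro mult_mono fact_mono) auto
          then show "fact l * exp 1 * ((2 * A + 3) / d) ^ l \<le> C * X ^ (12 * k)"
            by (simp add: C_def mult_ac)
        qed auto
        finally show ?thesis .
      qed
      moreover have "h i z \<noteq> 0" using ball(2)[of z] d0 by simp
      ultimately show ?thesis by blast
    qed
    moreover have "r < R" using r eta by linarith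
    ultimately show ?thesis using r(1) by blast
  qed
  ultimately show ?thesis by blast
qed

section \<open>Harmonic approximation on circles\<close>

text \<open>Real parts of polynomials, restricted to the circle, form an algebra:
  \<open>Re x * Re y = Re (x * y / 2) + Re (x * cnj y / 2)\<close>, and
  \<open>z * cnj z = R\<^sup>2\<close> reduces a mixed monomial to a power of \<open>z\<close> or to
  the conjugate of one, which has the same real part.\<close>

lemma real_polynomial_on_circle:
  assumes "real_polynomial_function (v :: complex \<Rightarrow> real)"
  shows "\<exists>p. \<forall>z. norm z = R \<longrightarrow> v z = Re (poly p z)"
  using assms
proof (induction v rule: real_polynomial_function.induct)
  case (linear f)
  interpret bounded_linear f by fact
  have "f z = Re (poly [:0, of_real (f 1) - \<i> * of_real (f \<i>):] z)" for z
  proof -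
    have "z = Re z *\<^sub>R 1 + Im z *\<^sub>R \<i>" by (simp add: complex_eq_iff)
    then have "f z = Re z * f 1 + Im z * f \<i>" by (metis add scaleR real_scaleR_def)
    then show ?thesis by (simp add: algebra_simps)
  qed
  then show ?case by blast
next
  case (const c)
  then show ?case by (intro exI[of _ "[:of_real c:]"]) simp
next
  case (add f g)
  then obtain p1 p2 where "\<forall>z. norm z = R \<longrightarrow> f z = Re (poly p1 z)" "\<forall>z. norm z = R \<longrightarrow> g z = Re (poly p2 z)"
    by blast
  then show ?case by (intro exI[of _ "p1 + p2"]) simp
next
  case (mult f g)
  then obtain p1 p2 where p: "\<forall>z. norm z = R \<longrightarrow> f z = Re (poly p1 z)" "\<forall>z. norm z = R \<longrightarrow> g z = Re (poly p2 z)"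
    by blast
  have mono: "\<exists>p. \<forall>z. norm z = R \<longrightarrow> Re (c * z ^ i * cnj z ^ j) = Re (poly p z)" for c i j
  proof (cases "j \<le> i")
    case True
    have "c * z ^ i * cnj z ^ j = poly (monom (c * of_real (R\<^sup>2) ^ j) (i - j)) z" if "norm z = R" for z
    proof -
      have "c * z ^ i * cnj z ^ j = c * (z * cnj z) ^ j * z ^ (i - j)"
        using True by (simp add: power_mult_distrib power_add[symmetric] mult_ac)
      then show ?thesis using that by (simp only: complex_norm_square[symmetric]) (simp add: poly_monom)
    qed
    then have "\<forall>z. norm z = R \<longrightarrow> Re (c * z ^ i * cnj z ^ j) = Re (poly (monom (c * of_real (R\<^sup>2) ^ j) (i - j)) z)"
      by metis
    then show ?thesis by blast
  next
    case False
    have "cnj (c * z ^ i * cnj z ^ j) = poly (monom (cnj c * of_real (R\<^sup>2) ^ i) (j - i)) z" if "norm z = R" for z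
    proof -
      have "cnj (c * z ^ i * cnj z ^ j) = cnj c * (z * cnj z) ^ i * z ^ (j - i)"
        using False by (simp add: power_mult_distrib power_add[symmetric] mult_ac)
      then show ?thesis using that by (simp only: complex_norm_square[symmetric]) (simp add: poly_monom)
    qed
    then have "\<forall>z. norm z = R \<longrightarrow> Re (c * z ^ i * cnj z ^ j) = Re (poly (monom (cnj c * of_real (R\<^sup>2) ^ i) (j - i)) z)"
      by (metis complex_cnj_cnj complex.sel(1) cnj.sel(1))
    then show ?thesis by blast
  qed
  have sums: "\<exists>p. \<forall>z. norm z = R \<longrightarrow> (\<Sum>i\<in>I. u i z) = Re (poly p z)"
    if "finite I" "\<forall>i\<in>I. \<exists>p. \<forall>z. norm z = R \<longrightarrow> u i z = Re (poly p z)" for I :: "nat set" and u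
  proof -
    from that(2) obtain p where "\<forall>i\<in>I. \<forall>z. norm z = R \<longrightarrow> u i z = Re (poly (p i) z)"
      by (rule bchoice[THEN exE])
    then show ?thesis by (intro exI[of _ "\<Sum>i\<in>I. p i"]) (simp add: poly_sum)
  qed
  have term_eq: "Re x * Re y = Re (x * y / 2) + Re (x * cnj y / 2)" for x y :: complex
    by (simp add: add_divide_distrib diff_divide_distrib algebra_simps)
  have terms: "\<exists>p. \<forall>z. norm z = R \<longrightarrow> Re (coeff p1 i * z ^ i) * Re (coeff p2 j * z ^ j) = Re (poly p z)" for i j
  proof -
    obtain r1 where r1: "\<forall>z. norm z = R \<longrightarrow> Re ((coeff p1 i * coeff p2 j / 2) * z ^ (i + j) * cnj z ^ 0) = Re (poly r1 z)"
      using mono by blast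
    obtain r2 where r2: "\<forall>z. norm z = R \<longrightarrow> Re ((coeff p1 i * cnj (coeff p2 j) / 2) * z ^ i * cnj z ^ j) = Re (poly r2 z)"
      using mono by blast
    have "Re (coeff p1 i * z ^ i) * Re (coeff p2 j * z ^ j) = Re (poly (r1 + r2) z)" if z: "norm z = R" for z
    proof -
      have e1: "(coeff p1 i * z ^ i) * (coeff p2 j * z ^ j) / 2 = (coeff p1 i * coeff p2 j / 2) * z ^ (i + j) * cnj z ^ 0"
        by (simp add: power_add)
      have e2: "(coeff p1 i * z ^ i) * cnj (coeff p2 j * z ^ j) / 2 = (coeff p1 i * cnj (coeff p2 j) / 2) * z ^ i * cnj z ^ j"
        by simp
      have "Re (coeff p1 i * z ^ i) * Re (coeff p2 j * z ^ j)
          = Re ((coeff p1 i * z ^ i) * (coeff p2 j * z ^ j) / 2) + Re ((coeff p1 i * z ^ i) * cnj (coeff p2 j * z ^ j) / 2)"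
        by (rule term_eq)
      also have "\<dots> = Re (poly r1 z) + Re (poly r2 z)"
        unfolding e1 e2 by (simp only: r1[rule_format, OF z] r2[rule_format, OF z])
      finally show ?thesis by simp
    qed
    then show ?thesis by blast
  qed
  have "\<exists>p. \<forall>z. norm z = R \<longrightarrow> (\<Sum>i\<le>degree p1. \<Sum>j\<le>degree p2. Re (coeff p1 i * z ^ i) * Re (coeff p2 j * z ^ j)) = Re (poly p z)"
    by (intro sums ballI finite_atMost terms)
  moreover have "f z * g z = (\<Sum>i\<le>degree p1. \<Sum>j\<le>degree p2. Re (coeff p1 i * z ^ i) * Re (coeff p2 j * z ^ j))" if "norm z = R" for z
    using p that by (simp only: poly_altdef Re_sum sum_product)
  ultimately show ?case by auto
qed

lemma harmonic_approximation_circle: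
  assumes "continuous_on (sphere 0 R) u" "0 < e"
  shows "\<exists>p. p holomorphic_on UNIV \<and> (\<forall>z::complex. norm z = R \<longrightarrow> \<bar>u z - Re (p z)\<bar> < e)"
proof -
  obtain g where g: "real_polynomial_function g" "\<And>z. z \<in> sphere 0 R \<Longrightarrow> \<bar>u z - g z\<bar> < e"
    using Stone_Weierstrass_real_polynomial_function[OF compact_sphere assms] by blast
  obtain p where "\<forall>z. norm z = R \<longrightarrow> g z = Re (poly p z)"
    using real_polynomial_on_circle[OF g(1)] by blast
  then show ?thesis using g(2) by (intro exI[of _ "poly p"]) (auto intro!: holomorphic_intros)
qed

section \<open>Orders of vanishing\<close>

text \<open>A point where \<open>h\<close> does not vanish makes the order at \<open>a\<close>
  finite. The local cofactor and \<open>h w / (w - a) ^ n\<close> agree off \<open>a\<close>, so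
  together they are entire.\<close>

lemma entire_factor_order:
  assumes h: "h holomorphic_on UNIV" "h z0 \<noteq> 0"
  obtains \<nu> g where "g holomorphic_on UNIV" "g a \<noteq> 0" "\<And>w. h w = (w - a) ^ \<nu> * g w"
proof (cases "h a = 0")
  case False
  then show thesis using that[of h 0] h by simp
next
  case True
  have "\<not> h constant_on UNIV" unfolding constant_on_def using True h(2) by (metis UNIV_I)
  then show thesis
  proof (rule holomorphic_factor_zero_nonconstant[OF h(1) open_UNIV connected_UNIV UNIV_I True])
    fix g r and n :: nat
    assume g: "0 < r" "ball a r \<subseteq> UNIV" "g holomorphic_on ball a r"
      "\<And>w. w \<in> ball a r \<Longrightarrow> h w = (w - a) ^ n * g w" "\<And>w. w \<in> ball a r \<Longrightarrow> g w \<noteq> 0"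
    define G where "G w = (if w = a then g a else h w / (w - a) ^ n)" for w
    have "G holomorphic_on ball a r"
      by (rule holomorphic_transform[OF g(3)]) (auto simp: G_def g(4))
    moreover have "G holomorphic_on - {a}"
    proof (rule holomorphic_transform[of "\<lambda>w. h w / (w - a) ^ n"])
      show "(\<lambda>w. h w / (w - a) ^ n) holomorphic_on - {a}"
        using holomorphic_on_subset[OF h(1), of "- {a}"] by (intro holomorphic_intros) auto
    qed (auto simp: G_def)
    ultimately have "G holomorphic_on ball a r \<union> - {a}" by (intro holomorphic_on_Un) auto
    moreover have "ball a r \<union> - {a} = UNIV" using g(1) by auto
    moreover have "h w = (w - a) ^ n * G w" for w using g(1) g(4)[of a] by (auto simp: G_def)
    moreover have "G a \<noteq> 0" using g(1,5) by (simp add: G_def)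
    ultimately show thesis using that by metis
  qed
qed

text \<open>Each derivative lowers the order by exactly one until it reaches 0. From then on the
  truncated exponent \<open>\<nu> - l\<close> stays 0 and nothing is claimed about
  \<open>k a\<close>.\<close>

lemma higher_deriv_factored:
  assumes "g holomorphic_on UNIV"
  shows "\<exists>k. k holomorphic_on UNIV \<and> (\<forall>w. (deriv ^^ l) (\<lambda>w. (w - a) ^ \<nu> * g w) w = (w - a) ^ (\<nu> - l) * k w)
     \<and> (l \<le> \<nu> \<longrightarrow> g a \<noteq> 0 \<longrightarrow> k a \<noteq> 0)"
proof (induction l)
  case 0
  then show ?case using assms by auto
next
  case (Suc l)
  then obtain k where k: "k holomorphic_on UNIV" "\<forall>w. (deriv ^^ l) (\<lambda>w. (w - a) ^ \<nu> * g w) w = (w - a) ^ (\<nu> - l) * k w"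
     "l \<le> \<nu> \<longrightarrow> g a \<noteq> 0 \<longrightarrow> k a \<noteq> 0" by blast
  define m where "m = \<nu> - l"
  have eq: "(deriv ^^ Suc l) (\<lambda>w. (w - a) ^ \<nu> * g w) w = deriv (\<lambda>w. (w - a) ^ m * k w) w" for w
  proof -
    have "(deriv ^^ l) (\<lambda>w. (w - a) ^ \<nu> * g w) = (\<lambda>w. (w - a) ^ m * k w)"
      using k(2) by (intro ext) (simp add: m_def)
    then show ?thesis by simp
  qed
  have dk: "(k has_field_derivative deriv k w) (at w)" for w
    using k(1) by (simp add: holomorphic_derivI)
  have d: "deriv (\<lambda>w. (w - a) ^ m * k w) w = of_nat m * (w - a) ^ (m - 1) * k w + (w - a) ^ m * deriv k w" for w
    by (rule DERIV_imp_deriv) (auto intro!: derivative_eq_intros dk)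
  have dh: "deriv k holomorphic_on UNIV" using k(1) by (simp add: holomorphic_deriv)
  show ?case
  proof (cases "m = 0")
    case True
    then show ?thesis using dh by (intro exI[of _ "deriv k"]) (auto simp only: eq d, auto simp: m_def)
  next
    case False
    then have "(deriv ^^ Suc l) (\<lambda>w. (w - a) ^ \<nu> * g w) w = (w - a) ^ (\<nu> - Suc l) * (of_nat m * k w + (w - a) * deriv k w)" for w
    proof -
      have p: "(w - a) ^ m = (w - a) ^ (\<nu> - Suc l) * (w - a)" "m - 1 = \<nu> - Suc l"
        using False power_minus_mult[of m "w - a"] by (auto simp: m_def)
      show ?thesis unfolding eq d p by (simp add: algebra_simps)
    qed
    moreover have "(\<lambda>w. of_nat m * k w + (w - a) * deriv k w) holomorphic_on UNIV"
      using k(1) dh by (auto intro!: holomorphic_intros)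
    moreover have "of_nat m * k a + (a - a) * deriv k a \<noteq> 0" if "g a \<noteq> 0"
      using k(3) that False by (auto simp: m_def)
    ultimately show ?thesis by blast
  qed
qed

text \<open>The hypothesis says that at every \<open>a\<close> the order of \<open>Q\<close> is
  finite and does not exceed that of \<open>P\<close>. Defining \<open>G\<close> by a limit makes it
  global from the start, so the local quotients need no gluing.\<close>

lemma entire_quotient:
  assumes "\<And>a. \<exists>\<nu> p g. p holomorphic_on UNIV \<and> g holomorphic_on UNIV \<and> g a \<noteq> 0
      \<and> (\<forall>w. P w = (w - a) ^ \<nu> * p w) \<and> (\<forall>w. Q w = (w - a) ^ \<nu> * g w)"
  shows "\<exists>G. G holomorphic_on UNIV \<and> (\<forall>w::complex. P w = G w * Q w)"
proof -
  define G where "G a = Lim (at a) (\<lambda>w. P w / Q w)" for a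
  have "\<exists>e>0. G holomorphic_on ball a e \<and> P a = G a * Q a" for a
  proof -
    obtain \<nu> p g where pg: "p holomorphic_on UNIV" "g holomorphic_on UNIV" "g a \<noteq> 0"
      "\<And>w. P w = (w - a) ^ \<nu> * p w" "\<And>w. Q w = (w - a) ^ \<nu> * g w"
      using assms by blast
    have cont: "continuous_on UNIV p" "continuous_on UNIV g"
      using pg holomorphic_on_imp_continuous_on by blast+
    then have "isCont g a" by (simp add: continuous_on_eq_continuous_at)
    then obtain e where e: "0 < e" "\<And>w. w \<in> ball a e \<Longrightarrow> g w \<noteq> 0"
      using continuous_at_avoid[of a g 0] pg(3) by (auto simp: dist_commute)
    have Geq: "G w = p w / g w" if w: "w \<in> ball a e" for w
    proof -
      have "isCont (\<lambda>u. p u / g u) w"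
        using cont e(2)[OF w] by (intro continuous_divide) (auto simp: continuous_on_eq_continuous_at)
      then have "((\<lambda>u. p u / g u) \<longlongrightarrow> p w / g w) (at w)" by (simp add: isCont_def)
      moreover have "eventually (\<lambda>u. p u / g u = P u / Q u) (at w)"
      proof -
        have "eventually (\<lambda>u. u \<noteq> a) (at w)"
          by (rule eventually_neq_at_within)
        then show ?thesis by eventually_elim (simp add: pg)
      qed
      ultimately have "((\<lambda>u. P u / Q u) \<longlongrightarrow> p w / g w) (at w)"
        by (rule Lim_transform_eventually)
      then show ?thesis unfolding G_def by (intro tendsto_Lim) auto
    qed
    have "(\<lambda>w. p w / g w) holomorphic_on ball a e"
      using pg e(2) by (intro holomorphic_intros) (auto intro: holomorphic_on_subset)
    then have "G holomorphic_on ball a e"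
      by (rule holomorphic_transform) (simp add: Geq)
    moreover have "P a = G a * Q a" using Geq[of a] e pg by simp
    ultimately show ?thesis using e(1) by blast
  qed
  then have "\<And>a. \<exists>e>0. G holomorphic_on ball a e" "\<And>a. P a = G a * Q a" by blast+
  moreover then have "G analytic_on UNIV" by (auto simp: analytic_on_def)
  ultimately show ?thesis using analytic_imp_holomorphic by blast
qed

section \<open>A growth lemma\<close>

text \<open>A function satisfying these conditions would double on \<open>[\<rho>, \<rho> + 1 / T \<rho>]\<close>, so it would
  be unbounded on a bounded interval.\<close>

lemma no_slow_self_growth:
  fixes T :: "real \<Rightarrow> real"
  assumes mono: "\<And>\<rho> R. 0 < \<rho> \<Longrightarrow> \<rho> < R \<Longrightarrow> T \<rho> \<le> T R + K"
    and lin: "0 < c" "\<And>\<rho>. 1 \<le> \<rho> \<Longrightarrow> c * \<rho> - L \<le> T \<rho>"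
    and log: "\<And>\<rho> R X. 1 \<le> \<rho> \<Longrightarrow> \<rho> < R \<Longrightarrow> T R + L' \<le> X \<Longrightarrow> R \<le> X \<Longrightarrow> 3 / (R - \<rho>) \<le> X \<Longrightarrow> 1 \<le> X \<Longrightarrow>
      T \<rho> \<le> D * (1 + ln X)"
  shows False
proof -
  \<comment> \<open>Chosen so that \<open>X = b * T \<rho>\<close> meets every bound in the
    hypothesis \<open>log\<close> for the radius \<open>\<rho> + 1 / T \<rho>\<close>: the 3 is for
    the gap \<open>1 / T \<rho>\<close>, \<open>L'\<close> for the shift, and the last summand
    bounds \<open>\<rho>\<close> itself through the linear growth.\<close>
  define b where "b = 3 + \<bar>L'\<bar> + (1 + \<bar>L\<bar>) / c"
  have b: "3 \<le> b" using lin(1) by (simp add: b_def)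
  have "((\<lambda>t. D * (1 + ln (b * t)) / t) \<longlongrightarrow> 0) at_top"
    using b by real_asymp
  then have "eventually (\<lambda>t. D * (1 + ln (b * t)) / t < 1) at_top" by (rule order_tendstoD) simp
  then have "eventually (\<lambda>t. 1 \<le> t \<and> D * (1 + ln (b * t)) / t < 1) at_top"
    using eventually_ge_at_top by (rule eventually_conj[rotated])
  then obtain \<tau> where tau0: "\<And>t. \<tau> \<le> t \<Longrightarrow> 1 \<le> t \<and> D * (1 + ln (b * t)) / t < 1"
    by (auto simp: eventually_at_top_linorder)
  have tau: "D * (1 + ln (b * t)) < t" "1 \<le> t" if "\<tau> \<le> t" for t
    using tau0[OF that] by (auto simp: divide_simps split: if_splits)
  have double: "2 * T \<rho> \<le> T (\<rho> + 1 / T \<rho>)" if rho: "1 \<le> \<rho>" "\<tau> \<le> T \<rho>" for \<rho>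
  proof (rule ccontr)
    assume "\<not> ?thesis"
    then have less: "T (\<rho> + 1 / T \<rho>) < 2 * T \<rho>" by simp
    have T1: "1 \<le> T \<rho>" using tau rho by blast
    have bT: "b * T \<rho> = 3 * T \<rho> + \<bar>L'\<bar> * T \<rho> + (1 + \<bar>L\<bar>) / c * T \<rho>" by (simp add: b_def algebra_simps)
    have p1: "\<bar>L'\<bar> \<le> \<bar>L'\<bar> * T \<rho>" using mult_left_mono[OF T1, of "\<bar>L'\<bar>"] by simp
    have p2: "0 \<le> (1 + \<bar>L\<bar>) / c * T \<rho>" using lin T1 by simp
    have "\<rho> \<le> (1 + \<bar>L\<bar>) / c * T \<rho>"
    proof -
      have "\<bar>L\<bar> \<le> \<bar>L\<bar> * T \<rho>" using T1 by (auto simp: mult_le_cancel_left1)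
      then have "c * \<rho> \<le> (1 + \<bar>L\<bar>) * T \<rho>" using lin(2)[OF rho(1)] by (simp add: algebra_simps)
      then show ?thesis using lin(1) by (simp add: field_simps)
    qed
    moreover have "1 / T \<rho> \<le> 1" using T1 by simp
    ultimately have R: "\<rho> + 1 / T \<rho> \<le> b * T \<rho>" using T1 p1 bT by linarith
    have X: "1 \<le> b * T \<rho>" using T1 p1 p2 bT by linarith
    have "T \<rho> \<le> D * (1 + ln (b * T \<rho>))"
    proof (rule log[OF rho(1) _ _ R _ X])
      show "\<rho> < \<rho> + 1 / T \<rho>" using T1 by simp
      show "T (\<rho> + 1 / T \<rho>) + L' \<le> b * T \<rho>" using less p1 p2 bT T1 by linarith
      show "3 / (\<rho> + 1 / T \<rho> - \<rho>) \<le> b * T \<rho>" using T1 p1 p2 bT by simp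
    qed
    then show False using tau(1)[OF rho(2)] by linarith
  qed
  define \<rho>0 where "\<rho>0 = max 1 ((\<bar>\<tau>\<bar> + L) / c)"
  have "\<bar>\<tau>\<bar> + L \<le> c * \<rho>0" using lin(1) by (simp add: \<rho>0_def max_def field_simps)
  then have T0: "1 \<le> \<rho>0" "\<tau> \<le> T \<rho>0" using lin(2)[of \<rho>0] by (auto simp: \<rho>0_def)
  \<comment> \<open>Since \<open>T (s i) \<ge> 2 ^ i\<close>, the steps \<open>1 / T (s i)\<close>
    add up to at most 2.\<close>
  define s where "s = rec_nat \<rho>0 (\<lambda>_ \<rho>. \<rho> + 1 / T \<rho>)"
  have s: "s 0 = \<rho>0" "s (Suc i) = s i + 1 / T (s i)" for i by (simp_all add: s_def)
  have inv: "1 \<le> s i \<and> \<tau> \<le> T (s i) \<and> 2 ^ i \<le> T (s i) \<and> s i \<le> \<rho>0 + 2 - 2 / 2 ^ i" for i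
  proof (induction i)
    case 0
    then show ?case using T0 tau by (auto simp: s)
  next
    case (Suc i)
    then have IH: "1 \<le> s i" "\<tau> \<le> T (s i)" "2 ^ i \<le> T (s i)" "s i \<le> \<rho>0 + 2 - 2 / 2 ^ i" by auto
    have T1: "1 \<le> T (s i)" using tau(2) IH(2) by blast
    have "2 * T (s i) \<le> T (s (Suc i))" using double[OF IH(1,2)] by (simp add: s)
    moreover have "1 / T (s i) \<le> 1 / 2 ^ i" using IH by (intro frac_le) auto
    moreover have "0 \<le> 1 / T (s i)" using T1 by simp
    moreover have "2 / 2 ^ Suc i = 1 / (2::real) ^ i" "2 / 2 ^ i = 2 * (1 / (2::real) ^ i)" by simp_all
    ultimately show ?case using IH T1 s(2)[of i] unfolding power_Suc by (intro conjI) linarith+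
  qed
  have "(2::real) ^ i \<le> T (\<rho>0 + 3) + K" for i
  proof -
    have "0 < 2 / (2::real) ^ i" by simp
    then have "0 < s i" "s i < \<rho>0 + 3" using inv[of i] by linarith+
    then show ?thesis using mono[of "s i" "\<rho>0 + 3"] inv[of i] by linarith
  qed
  moreover obtain i where "T (\<rho>0 + 3) + K < 2 ^ i" using real_arch_pow[of 2] by auto
  ultimately show False by (metis not_less)
qed

section \<open>Wronskians\<close>

definition wronskian :: "nat \<Rightarrow> (nat \<Rightarrow> complex \<Rightarrow> complex) \<Rightarrow> complex \<Rightarrow> complex" where
  "wronskian k u z = Determinant.det (Matrix.mat k k (\<lambda>(i, j). (deriv ^^ i) (u j) z))"

lemma permutes_less: "p permutes {0..<k} \<Longrightarrow> i < k \<Longrightarrow> p i < (k::nat)"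
  using permutes_in_image[of p "{0..<k}" i] by simp

lemma det_mat_expand:
  "Determinant.det (Matrix.mat k k (\<lambda>(i, j). f i j)) =
    (\<Sum>p | p permutes {0..<k}. of_int (sign p) * (\<Prod>i = 0..<k. f i (p i)))"
proof -
  have "(\<Prod>i = 0..<k. Matrix.mat k k (\<lambda>(i, j). f i j) $$ (i, p i)) = (\<Prod>i = 0..<k. f i (p i))"
    if "p permutes {0..<k}" for p
    using that by (intro prod.cong) (auto simp: permutes_less)
  then show ?thesis by (subst det_def'[of _ k]) auto
qed

lemma holomorphic_det:
  assumes "\<And>i j. i < k \<Longrightarrow> j < k \<Longrightarrow> f i j holomorphic_on S"
  shows "(\<lambda>z. Determinant.det (Matrix.mat k k (\<lambda>(i, j). f i j z))) holomorphic_on S"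
  unfolding det_mat_expand using assms
  by (intro holomorphic_intros) (auto dest: permutes_less)

lemma holomorphic_wronskian:
  assumes "\<And>j. j < k \<Longrightarrow> u j holomorphic_on UNIV"
  shows "wronskian k u holomorphic_on UNIV"
proof -
  have "(\<lambda>z. wronskian k u z) holomorphic_on UNIV"
    unfolding wronskian_def using assms by (intro holomorphic_det holomorphic_higher_deriv) auto
  then show ?thesis by simp
qed

lemma higher_deriv_lincomb:
  assumes "finite A" "\<And>l. l \<in> A \<Longrightarrow> u l holomorphic_on UNIV"
  shows "(deriv ^^ i) (\<lambda>z. \<Sum>l\<in>A. c l * u l z) z = (\<Sum>l\<in>A. c l * (deriv ^^ i) (u l) z)"
  using assms
proof (induction A)
  case empty
  then show ?case by simp
next
  case (insert a A)
  have h: "(\<lambda>z. c a * u a z) holomorphic_on UNIV" "(\<lambda>z. \<Sum>l\<in>A. c l * u l z) holomorphic_on UNIV"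
    using insert.prems by (intro holomorphic_intros; simp)+
  have "(deriv ^^ i) (\<lambda>z. \<Sum>l\<in>insert a A. c l * u l z) z = (deriv ^^ i) (\<lambda>z. c a * u a z + (\<Sum>l\<in>A. c l * u l z)) z"
    using insert.hyps by simp
  also have "\<dots> = (deriv ^^ i) (\<lambda>z. c a * u a z) z + (deriv ^^ i) (\<lambda>z. \<Sum>l\<in>A. c l * u l z) z"
    using higher_deriv_add[OF h open_UNIV UNIV_I] .
  also have "(deriv ^^ i) (\<lambda>z. c a * u a z) z = c a * (deriv ^^ i) (u a) z"
    using higher_deriv_cmult[of "u a" UNIV z i "c a"] insert.prems by simp
  finally show ?case using insert by simp
qed

lemma wronskian_base_change:
  assumes "\<And>l. l < k \<Longrightarrow> u l holomorphic_on UNIV"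
    and "\<And>j z. j < k \<Longrightarrow> v j z = (\<Sum>l<k. c l j * u l z)"
  shows "wronskian k v z = wronskian k u z * Determinant.det (Matrix.mat k k (\<lambda>(l, j). c l j))"
proof -
  let ?U = "Matrix.mat k k (\<lambda>(i, j). (deriv ^^ i) (u j) z)" and ?C = "Matrix.mat k k (\<lambda>(l, j). c l j)"
  have "Matrix.mat k k (\<lambda>(i, j). (deriv ^^ i) (v j) z) = ?U * ?C"
  proof (rule eq_matI)
    fix i j assume ij: "i < dim_row (?U * ?C)" "j < dim_col (?U * ?C)"
    then have "i < k" "j < k" by auto
    have "v j = (\<lambda>z. \<Sum>l<k. c l j * u l z)" using assms(2) \<open>j < k\<close> by blast
    then have "(deriv ^^ i) (v j) z = (\<Sum>l<k. c l j * (deriv ^^ i) (u l) z)"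
      using higher_deriv_lincomb[of "{..<k}" u i "\<lambda>l. c l j" z] assms(1) by simp
    then show "Matrix.mat k k (\<lambda>(i, j). (deriv ^^ i) (v j) z) $$ (i, j) = (?U * ?C) $$ (i, j)"
      using \<open>i < k\<close> \<open>j < k\<close> by (simp add: scalar_prod_def lessThan_atLeast0 mult.commute)
  qed auto
  then show ?thesis unfolding wronskian_def by (simp add: det_mult[of _ k])
qed

text \<open>By Leibniz's rule the matrix of the products is a lower triangular matrix with diagonal
  \<open>g z\<close> times the matrix of the \<open>u j\<close>. With \<open>g = exp (- p)\<close>
  this passes to the functions normalized to be at most 1 on a disc.\<close>

lemma wronskian_mult:
  assumes "g holomorphic_on UNIV" "\<And>j. j < k \<Longrightarrow> u j holomorphic_on UNIV"
  shows "wronskian k (\<lambda>j z. g z * u j z) z = g z ^ k * wronskian k u z"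
proof -
  let ?U = "Matrix.mat k k (\<lambda>(i, j). (deriv ^^ i) (u j) z)"
  let ?L = "Matrix.mat k k (\<lambda>(i, l). if l \<le> i then of_nat (i choose l) * (deriv ^^ (i - l)) g z else 0)"
  have "Matrix.mat k k (\<lambda>(i, j). (deriv ^^ i) (\<lambda>z. g z * u j z) z) = ?L * ?U"
  proof (rule eq_matI)
    fix i j assume "i < dim_row (?L * ?U)" "j < dim_col (?L * ?U)"
    then have ij: "i < k" "j < k" by auto
    have "(deriv ^^ i) (\<lambda>z. u j z * g z) z = (\<Sum>l = 0..i. of_nat (i choose l) * (deriv ^^ l) (u j) z * (deriv ^^ (i - l)) g z)"
      by (rule higher_deriv_mult[OF assms(2)[OF ij(2)] assms(1) open_UNIV UNIV_I])
    also have "\<dots> = (\<Sum>l = 0..i. (if l \<le> i then of_nat (i choose l) * (deriv ^^ (i - l)) g z else 0) * (deriv ^^ l) (u j) z)"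
      by (intro sum.cong) auto
    also have "\<dots> = (\<Sum>l = 0..<k. (if l \<le> i then of_nat (i choose l) * (deriv ^^ (i - l)) g z else 0) * (deriv ^^ l) (u j) z)"
      using ij by (intro sum.mono_neutral_left) auto
    also have "(\<lambda>z. u j z * g z) = (\<lambda>z. g z * u j z)" by (simp add: mult.commute)
    finally show "Matrix.mat k k (\<lambda>(i, j). (deriv ^^ i) (\<lambda>z. g z * u j z) z) $$ (i, j) = (?L * ?U) $$ (i, j)"
      using ij by (simp add: scalar_prod_def)
  qed auto
  moreover have "Determinant.det ?L = g z ^ k"
  proof -
    have "Determinant.det ?L = prod_list (diag_mat ?L)" by (rule det_lower_triangular[of k]) auto
    also have "diag_mat ?L = map (\<lambda>_. g z) [0..<k]" by (simp add: diag_mat_def)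
    also have "prod_list \<dots> = g z ^ k" by (induction k) auto
    finally show ?thesis .
  qed
  ultimately show ?thesis unfolding wronskian_def by (simp add: det_mult[of _ k])
qed

lemma norm_wronskian_le:
  assumes "0 \<le> L" "\<And>i j. i < k \<Longrightarrow> j < k \<Longrightarrow> norm ((deriv ^^ i) (u j) z) \<le> L * norm (u j z)"
  shows "norm (wronskian k u z) \<le> fact k * L ^ k * (\<Prod>j<k. norm (u j z))"
proof -
  have "norm (wronskian k u z) \<le> (\<Sum>p | p permutes {0..<k}. norm (of_int (sign p) * (\<Prod>i = 0..<k. (deriv ^^ i) (u (p i)) z)))"
    unfolding wronskian_def det_mat_expand by (rule norm_sum)
  also have "\<dots> \<le> (\<Sum>p | p permutes {0..<k}. L ^ k * (\<Prod>j<k. norm (u j z)))"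
  proof (rule sum_mono)
    fix p assume "p \<in> {p. p permutes {0..<k}}"
    then have p: "p permutes {0..<k}" by simp
    have "norm (of_int (sign p) * (\<Prod>i = 0..<k. (deriv ^^ i) (u (p i)) z)) = (\<Prod>i = 0..<k. norm ((deriv ^^ i) (u (p i)) z))"
      by (simp add: norm_mult prod_norm sign_def)
    also have "\<dots> \<le> (\<Prod>i = 0..<k. L * norm (u (p i) z))"
      using assms p by (intro prod_mono) (auto simp: permutes_less)
    also have "\<dots> = L ^ k * (\<Prod>i = 0..<k. norm (u (p i) z))" by (simp add: prod.distrib)
    also have "(\<Prod>i = 0..<k. norm (u (p i) z)) = (\<Prod>j = 0..<k. norm (u j z))"
      using prod.permute[OF p, of "\<lambda>j. norm (u j z)"] by (simp add: o_def)
    finally show "norm (of_int (sign p) * (\<Prod>i = 0..<k. (deriv ^^ i) (u (p i)) z)) \<le> L ^ k * (\<Prod>j<k. norm (u j z))"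
      by (simp add: lessThan_atLeast0)
  qed
  also have "\<dots> = fact k * L ^ k * (\<Prod>j<k. norm (u j z))"
    by (simp add: card_permutations)
  finally show ?thesis .
qed

text \<open>Truncation at level \<open>k - 1\<close> enters here, as no derivative of order \<open>k\<close> or more occurs.\<close>

lemma wronskian_order:
  assumes "\<And>j. j < k \<Longrightarrow> g j holomorphic_on UNIV" "\<And>j w. j < k \<Longrightarrow> u j w = (w - a) ^ \<nu> j * g j w"
  shows "\<exists>G. G holomorphic_on UNIV \<and> (\<forall>w. wronskian k u w = (w - a) ^ (\<Sum>j<k. \<nu> j - (k - 1)) * G w)"
proof -
  have "\<exists>K. K holomorphic_on UNIV \<and> (\<forall>w. (deriv ^^ i) (u j) w = (w - a) ^ (\<nu> j - (k - 1)) * K w)"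
    if ij: "i < k" "j < k" for i j
  proof -
    obtain K where K: "K holomorphic_on UNIV" "\<And>w. (deriv ^^ i) (\<lambda>w. (w - a) ^ \<nu> j * g j w) w = (w - a) ^ (\<nu> j - i) * K w"
      using higher_deriv_factored[OF assms(1)[OF ij(2)]] by metis
    have "u j = (\<lambda>w. (w - a) ^ \<nu> j * g j w)" using assms(2) ij by blast
    moreover have "\<nu> j - i = (\<nu> j - (k - 1)) + ((\<nu> j - i) - (\<nu> j - (k - 1)))" using ij by linarith
    ultimately have "(deriv ^^ i) (u j) w = (w - a) ^ (\<nu> j - (k - 1)) * ((w - a) ^ ((\<nu> j - i) - (\<nu> j - (k - 1))) * K w)" for w
      using K(2) by (metis mult.assoc power_add)
    moreover have "(\<lambda>w. (w - a) ^ ((\<nu> j - i) - (\<nu> j - (k - 1))) * K w) holomorphic_on UNIV"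
      using K(1) by (intro holomorphic_intros)
    ultimately show ?thesis by blast
  qed
  then have "\<forall>i j. \<exists>K. i < k \<and> j < k \<longrightarrow> K holomorphic_on UNIV \<and> (\<forall>w. (deriv ^^ i) (u j) w = (w - a) ^ (\<nu> j - (k - 1)) * K w)"
    by blast
  then obtain K where K: "\<And>i j. i < k \<Longrightarrow> j < k \<Longrightarrow> K i j holomorphic_on UNIV"
    "\<And>i j w. i < k \<Longrightarrow> j < k \<Longrightarrow> (deriv ^^ i) (u j) w = (w - a) ^ (\<nu> j - (k - 1)) * K i j w"
    by metis
  define G where "G w = Determinant.det (Matrix.mat k k (\<lambda>(i, j). K i j w))" for w
  have "G holomorphic_on UNIV" unfolding G_def by (rule holomorphic_det[OF K(1)])
  moreover have "wronskian k u w = (w - a) ^ (\<Sum>j<k. \<nu> j - (k - 1)) * G w" for w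
  proof -
    have "(\<Prod>i = 0..<k. (deriv ^^ i) (u (p i)) w) = (w - a) ^ (\<Sum>j<k. \<nu> j - (k - 1)) * (\<Prod>i = 0..<k. K i (p i) w)"
      if p: "p permutes {0..<k}" for p
    proof -
      have "(\<Prod>i = 0..<k. (deriv ^^ i) (u (p i)) w) = (\<Prod>i = 0..<k. (w - a) ^ (\<nu> (p i) - (k - 1)) * K i (p i) w)"
        using p K(2) by (intro prod.cong) (auto simp: permutes_less)
      also have "\<dots> = (\<Prod>i = 0..<k. (w - a) ^ (\<nu> (p i) - (k - 1))) * (\<Prod>i = 0..<k. K i (p i) w)"
        by (rule prod.distrib)
      also have "(\<Prod>i = 0..<k. (w - a) ^ (\<nu> (p i) - (k - 1))) = (\<Prod>i = 0..<k. (w - a) ^ (\<nu> i - (k - 1)))"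
        using prod.permute[OF p, of "\<lambda>i. (w - a) ^ (\<nu> i - (k - 1))"] by (simp add: o_def)
      finally show ?thesis by (simp add: power_sum lessThan_atLeast0)
    qed
    then show ?thesis
      unfolding wronskian_def G_def det_mat_expand sum_distrib_left by (intro sum.cong) (auto simp: mult_ac)
  qed
  ultimately show ?thesis by blast
qed

text \<open>If the Wronskian vanished identically, a combination of the \<open>u j\<close> would vanish to order
  greater than \<open>k\<close> at a regular point of the linear differential operator of order \<open>k\<close>
  annihilating all the \<open>u j\<close>.\<close>

lemma wronskian_nonzero:
  assumes "\<And>j. j < k \<Longrightarrow> u j holomorphic_on UNIV"
    and "\<And>c. (\<And>z. (\<Sum>j<k. c j * u j z) = 0) \<Longrightarrow> \<forall>j<k. c j = 0"
  shows "\<exists>z. wronskian k u z \<noteq> 0"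
  using assms
proof (induction k)
  case 0
  then show ?case by (simp add: wronskian_def)
next
  case (Suc k)
  show ?case
  proof (rule ccontr)
    assume "\<not> ?case"
    then have zero: "wronskian (Suc k) u z = 0" for z by blast
    have "\<exists>z. wronskian k u z \<noteq> 0"
    proof (rule Suc.IH)
      show "u j holomorphic_on UNIV" if "j < k" for j using Suc.prems(1) that by simp
      fix c :: "nat \<Rightarrow> complex" assume c: "\<And>z. (\<Sum>j<k. c j * u j z) = 0"
      have "(\<Sum>j<Suc k. (if j < k then c j else 0) * u j z) = 0" for z using c[of z] by simp
      then have "\<forall>j<Suc k. (if j < k then c j else 0) = 0" by (rule Suc.prems(2))
      then show "\<forall>j<k. c j = 0" by (metis less_SucI)
    qed
    then obtain a where a: "wronskian k u a \<noteq> 0" by blast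
    let ?A = "Matrix.mat (Suc k) (Suc k) (\<lambda>(i, j). (deriv ^^ i) (u j) a)"
    \<comment> \<open>A kernel vector of the Wronskian matrix at \<open>a\<close> yields a
      combination \<open>y\<close> whose derivatives of order 0 to \<open>k\<close> vanish at
      \<open>a\<close>.\<close>
    obtain v where v: "v \<in> carrier_vec (Suc k)" "v \<noteq> 0\<^sub>v (Suc k)" "?A *\<^sub>v v = 0\<^sub>v (Suc k)"
      using zero[of a] det_0_iff_vec_prod_zero[of ?A "Suc k"] unfolding wronskian_def by auto
    define c where "c j = vec_index v j" for j
    define y where "y z = (\<Sum>j<Suc k. c j * u j z)" for z
    have hol_y: "y holomorphic_on UNIV" unfolding y_def using Suc.prems(1) by (intro holomorphic_intros) auto
    have van: "(deriv ^^ i) y a = 0" if "i \<le> k" for i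
    proof -
      have "(deriv ^^ i) y a = (\<Sum>j<Suc k. c j * (deriv ^^ i) (u j) a)"
        unfolding y_def using Suc.prems(1) by (intro higher_deriv_lincomb) auto
      also have "\<dots> = vec_index (?A *\<^sub>v v) i"
        using that v(1) by (simp add: scalar_prod_def c_def mult.commute lessThan_atLeast0)
      finally show ?thesis using v(3) that by simp
    qed
    have "\<exists>z. y z \<noteq> 0"
    proof (rule ccontr)
      assume "\<not> ?thesis"
      then have "(\<Sum>j<Suc k. c j * u j z) = 0" for z by (simp add: y_def)
      then have "\<forall>j<Suc k. c j = 0" by (rule Suc.prems(2))
      then have "v = 0\<^sub>v (Suc k)" using v(1) by (intro eq_vecI) (auto simp: c_def)
      then show False using v(2) by simp
    qed
    then obtain m g where g: "g holomorphic_on UNIV" "g a \<noteq> 0" "\<And>w. y w = (w - a) ^ m * g w"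
      using entire_factor_order[OF hol_y, of _ a] by metis
    have y_eq: "y = (\<lambda>w. (w - a) ^ m * g w)" using g(3) by blast
    have "\<forall>l. \<exists>K. K holomorphic_on UNIV \<and> (\<forall>w. (deriv ^^ l) y w = (w - a) ^ (m - l) * K w) \<and> (l \<le> m \<longrightarrow> K a \<noteq> 0)"
      unfolding y_eq using higher_deriv_factored[OF g(1)] g(2) by blast
    then obtain K where K: "\<And>l. K l holomorphic_on UNIV" "\<And>l w. (deriv ^^ l) y w = (w - a) ^ (m - l) * K l w"
      "\<And>l. l \<le> m \<Longrightarrow> K l a \<noteq> 0" by metis
    have "k < m"
    proof (rule ccontr)
      assume "\<not> k < m"
      then show False using van[of m] K(2)[of m a] K(3)[of m] by simp
    qed
    \<comment> \<open>Up to sign, these are the coefficients of the differential operator that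
      appears when a determinant with last column \<open>y\<close> is expanded along that column.
      The leading one, \<open>M k\<close>, is the Wronskian of the first \<open>k\<close> functions
      and nonzero at \<open>a\<close>.\<close>
    define M where "M i z = Determinant.det (Matrix.mat k k (\<lambda>(r, j). (deriv ^^ (if r < i then r else Suc r)) (u j) z))" for i z
    have hol_M: "M i holomorphic_on UNIV" for i
    proof -
      have "(\<lambda>z. M i z) holomorphic_on UNIV"
        unfolding M_def using Suc.prems(1) by (intro holomorphic_det holomorphic_higher_deriv) auto
      then show ?thesis by simp
    qed
    have Mk: "M k z = wronskian k u z" for z
      unfolding M_def wronskian_def by (intro arg_cong[where f = Determinant.det] eq_matI) auto
    \<comment> \<open>The operator applied to \<open>y\<close>, divided by
      \<open>(z - a) ^ (m - k)\<close>. At \<open>a\<close> only the term \<open>i = k\<close>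
      survives, and it is nonzero because \<open>y\<close> has order exactly
      \<open>m > k\<close>.\<close>
    define S where "S z = (\<Sum>i<Suc k. (z - a) ^ (k - i) * K i z * ((-1) ^ (i + k) * M i z))" for z
    have S0: "S z = 0" if "z \<noteq> a" for z
    proof -
      define w where "w j = (if j < k then u j else y)" for j
      have "wronskian (Suc k) w z = wronskian (Suc k) u z
          * Determinant.det (Matrix.mat (Suc k) (Suc k) (\<lambda>(l, j). if j < k then (if l = j then 1 else 0) else c l))"
      proof (rule wronskian_base_change)
        show "w j x = (\<Sum>l<Suc k. (if j < k then (if l = j then 1 else 0) else c l) * u l x)" if "j < Suc k" for j x
        proof (cases "j < k")
          case True
          have "(\<Sum>l<Suc k. (if l = j then 1 else 0) * u l x) = (\<Sum>l<Suc k. if l = j then u l x else 0)"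
            by (intro sum.cong) auto
          also have "\<dots> = u j x" using that by (subst sum.delta) auto
          finally show ?thesis using True by (simp add: w_def)
        next
          case False
          then show ?thesis by (simp add: w_def y_def)
        qed
      qed (use Suc.prems(1) in auto)
      then have "wronskian (Suc k) w z = 0" using zero by simp
      moreover have "wronskian (Suc k) w z = (\<Sum>i<Suc k. (deriv ^^ i) y z * ((-1) ^ (i + k) * M i z))"
      proof -
        let ?B = "Matrix.mat (Suc k) (Suc k) (\<lambda>(i, j). (deriv ^^ i) (w j) z)"
        have "wronskian (Suc k) w z = (\<Sum>i<Suc k. ?B $$ (i, k) * cofactor ?B i k)"
          unfolding wronskian_def by (rule laplace_expansion_column) auto
        also have "\<dots> = (\<Sum>i<Suc k. (deriv ^^ i) y z * ((-1) ^ (i + k) * M i z))"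
        proof (rule sum.cong[OF refl])
          fix i assume i: "i \<in> {..<Suc k}"
          have "mat_delete ?B i k = Matrix.mat k k (\<lambda>(r, j). (deriv ^^ (if r < i then r else Suc r)) (u j) z)"
            using i by (intro eq_matI) (auto simp: mat_delete_def w_def)
          then show "?B $$ (i, k) * cofactor ?B i k = (deriv ^^ i) y z * ((-1) ^ (i + k) * M i z)"
            using i by (simp add: cofactor_def M_def w_def)
        qed
        finally show ?thesis .
      qed
      moreover have "(deriv ^^ i) y z = (z - a) ^ (m - k) * ((z - a) ^ (k - i) * K i z)" if "i < Suc k" for i
      proof -
        have "m - i = (m - k) + (k - i)" using that \<open>k < m\<close> by simp
        then show ?thesis using K(2)[of i z] by (simp add: power_add)
      qed
      ultimately have "(z - a) ^ (m - k) * S z = 0"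
        by (simp add: S_def sum_distrib_left mult_ac del: sum.lessThan_Suc)
      then show ?thesis using that by simp
    qed
    have "S holomorphic_on UNIV"
      unfolding S_def using K(1) hol_M by (intro holomorphic_intros) auto
    then have "isCont S a"
      using holomorphic_on_imp_continuous_on continuous_on_eq_continuous_at by blast
    then have "(S \<longlongrightarrow> S a) (at a)" by (simp add: isCont_def)
    moreover have "(S \<longlongrightarrow> 0) (at a)"
      by (rule tendsto_eventually) (auto simp: eventually_at_filter S0)
    ultimately have "S a = 0" using tendsto_unique[OF trivial_limit_at] by blast
    moreover have "S a = K k a * ((-1) ^ (k + k) * M k a)"
    proof -
      have "S a = (\<Sum>i<Suc k. if i = k then K k a * ((-1) ^ (k + k) * M k a) else 0)"
        unfolding S_def by (intro sum.cong) auto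
      then show ?thesis by (simp add: sum.delta del: sum.lessThan_Suc)
    qed
    ultimately show False using Mk[of a] a K(3)[of k] \<open>k < m\<close> by simp
  qed
qed

section \<open>Linear systems with more unknowns than equations\<close>

lemma homogeneous_system_solution:
  fixes d :: "'x \<Rightarrow> 'i \<Rightarrow> 'f::field"
  assumes "finite I" "finite J" "card I < card J"
  shows "\<exists>c. (\<exists>x\<in>J. c x \<noteq> 0) \<and> (\<forall>i\<in>I. (\<Sum>x\<in>J. c x * d x i) = 0)"
  using assms
proof (induction I arbitrary: J d)
  case empty
  then have "J \<noteq> {}" by auto
  then show ?case by (intro exI[of _ "\<lambda>_. 1"]) auto
next
  case (insert i I)
  show ?case
  proof (cases "\<forall>x\<in>J. d x i = 0")
    case True
    have "card I < card J" using insert.prems(2) insert.hyps by simp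
    then obtain c where "\<exists>x\<in>J. c x \<noteq> 0" "\<forall>l\<in>I. (\<Sum>x\<in>J. c x * d x l) = 0"
      using insert.IH[OF insert.prems(1)] by blast
    then show ?thesis using True by (intro exI[of _ c]) auto
  next
    case False
    \<comment> \<open>Gaussian elimination: equation \<open>i\<close> is solved for the unknown
      \<open>p\<close>, which is then eliminated from the other equations.\<close>
    then obtain p where p: "p \<in> J" "d p i \<noteq> 0" by blast
    define J' where "J' = J - {p}"
    have J': "finite J'" "card I < card J'"
      using insert.prems insert.hyps p by (auto simp: J'_def)
    obtain c where c: "\<exists>x\<in>J'. c x \<noteq> 0" "\<forall>l\<in>I. (\<Sum>x\<in>J'. c x * (d x l - d x i / d p i * d p l)) = 0"
      using insert.IH[OF J', of "\<lambda>x l. d x l - d x i / d p i * d p l"] by blast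
    define s where "s = (\<Sum>x\<in>J'. c x * d x i)"
    define c' where "c' x = (if x = p then - s / d p i else c x)" for x
    have sum_eq: "(\<Sum>x\<in>J. c' x * d x l) = (\<Sum>x\<in>J'. c x * d x l) - s / d p i * d p l" for l
    proof -
      have "(\<Sum>x\<in>J. c' x * d x l) = c' p * d p l + (\<Sum>x\<in>J'. c' x * d x l)"
        using p insert.prems(1) by (simp add: J'_def sum.remove)
      also have "(\<Sum>x\<in>J'. c' x * d x l) = (\<Sum>x\<in>J'. c x * d x l)"
        by (intro sum.cong) (auto simp: c'_def J'_def)
      finally show ?thesis by (simp add: c'_def)
    qed
    have "(\<Sum>x\<in>J. c' x * d x l) = 0" if "l \<in> insert i I" for l
    proof (cases "l = i")
      case True
      then show ?thesis using p by (simp add: sum_eq s_def)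
    next
      case False
      then have "0 = (\<Sum>x\<in>J'. c x * (d x l - d x i / d p i * d p l))" using c(2) that by simp
      also have "\<dots> = (\<Sum>x\<in>J'. c x * d x l) - (\<Sum>x\<in>J'. (c x * d x i) * (d p l / d p i))"
        by (simp add: sum_subtractf[symmetric] algebra_simps)
      also have "(\<Sum>x\<in>J'. (c x * d x i) * (d p l / d p i)) = s * (d p l / d p i)"
        by (simp only: s_def sum_distrib_right)
      finally show ?thesis by (simp add: sum_eq)
    qed
    moreover have "\<exists>x\<in>J. c' x \<noteq> 0" using c(1) by (auto simp: c'_def J'_def)
    ultimately show ?thesis by blast
  qed
qed

text \<open>The hypothetical nonconstant curve after \<open>z \<mapsto> c + exp z\<close>: \<open>t i\<close> stands for \<open>1 / m\<^sub>i\<close>; periodicity makes the curve transcendental.\<close>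

locale orbifold_curve =
  fixes n q :: nat and h :: "nat \<Rightarrow> complex \<Rightarrow> complex" and t :: "nat \<Rightarrow> real"
  assumes n_pos: "1 \<le> n" and q_large: "2 * n < q"
    and hol: "\<And>i. i < q \<Longrightarrow> h i holomorphic_on UNIV"
    and base: "\<And>i. i < q \<Longrightarrow> h i 0 \<noteq> 0"
    and no_common_zero: "\<And>z. \<exists>i<q. h i z \<noteq> 0"
    and span: "\<And>B j. B \<subseteq> {..<q} \<Longrightarrow> card B = n + 1 \<Longrightarrow> j < q \<Longrightarrow> \<exists>d. \<forall>z. h j z = (\<Sum>i\<in>B. d i * h i z)"
    and t_nonneg: "\<And>i. i < q \<Longrightarrow> 0 \<le> t i"
    and t_sum: "(\<Sum>i<q. t i) * real n < real q - real n - 1"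
    and multiplicity: "\<And>i a \<nu> g. i < q \<Longrightarrow> 0 < \<nu> \<Longrightarrow> g holomorphic_on UNIV \<Longrightarrow> g a \<noteq> 0 \<Longrightarrow>
      (\<And>w. h i w = (w - a) ^ \<nu> * g w) \<Longrightarrow> 1 \<le> t i * real \<nu>"
    and periodic: "\<And>i k. i < q \<Longrightarrow> h i (2 * of_real pi * \<i> * of_nat k) = h i 0"
    and nonconst: "\<exists>i<q. \<exists>j<q. \<exists>z. h i 0 * h j z \<noteq> h j 0 * h i z"
begin

section \<open>The linear matroid of the functions \<open>h i\<close>\<close>

definition indep :: "nat set \<Rightarrow> bool" where
  "indep I \<longleftrightarrow> I \<subseteq> {..<q} \<and> (\<forall>c. (\<forall>z. (\<Sum>i\<in>I. c i * h i z) = 0) \<longrightarrow> (\<forall>i\<in>I. c i = 0))"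

lemma indep_zero:
  assumes "indep I" "\<And>z. (\<Sum>i\<in>I. c i * h i z) = 0" "i \<in> I"
  shows "c i = 0"
  using assms(1)[unfolded indep_def, THEN conjunct2, THEN spec[of _ c]] assms(2,3) by blast

definition in_span :: "nat set \<Rightarrow> (complex \<Rightarrow> complex) \<Rightarrow> bool" where
  "in_span I f \<longleftrightarrow> (\<exists>d. \<forall>z. f z = (\<Sum>i\<in>I. d i * h i z))"

lemma in_span_member: "finite I \<Longrightarrow> i \<in> I \<Longrightarrow> in_span I (h i)"
  unfolding in_span_def by (intro exI[of _ "\<lambda>j. if j = i then 1 else 0"]) (simp add: if_distrib[of "\<lambda>x. x * _"] cong: if_cong)

lemma in_span_trans:
  assumes "in_span B f" "\<And>b. b \<in> B \<Longrightarrow> in_span I (h b)"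
  shows "in_span I f"
proof -
  obtain d where d: "\<And>z. f z = (\<Sum>b\<in>B. d b * h b z)" using assms(1) by (auto simp: in_span_def)
  have "\<forall>b\<in>B. \<exists>e. \<forall>z. h b z = (\<Sum>i\<in>I. e i * h i z)" using assms(2) by (auto simp: in_span_def)
  then obtain e where e: "\<And>b z. b \<in> B \<Longrightarrow> h b z = (\<Sum>i\<in>I. e b i * h i z)"
    using bchoice[of B "\<lambda>b e. \<forall>z. h b z = (\<Sum>i\<in>I. e i * h i z)"] by blast
  have eq: "f z = (\<Sum>i\<in>I. (\<Sum>b\<in>B. d b * e b i) * h i z)" for z
  proof -
    have "f z = (\<Sum>b\<in>B. \<Sum>i\<in>I. d b * e b i * h i z)"
      unfolding d by (intro sum.cong) (auto simp: e sum_distrib_left mult.assoc)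
    also have "\<dots> = (\<Sum>i\<in>I. \<Sum>b\<in>B. d b * e b i * h i z)" by (rule sum.swap)
    finally show ?thesis by (simp add: sum_distrib_right)
  qed
  show ?thesis unfolding in_span_def by (intro exI[of _ "\<lambda>i. \<Sum>b\<in>B. d b * e b i"] allI eq)
qed

lemma dependent_in_span:
  assumes "indep I" "x < q" "x \<notin> I" "\<not> indep (insert x I)"
  shows "in_span I (h x)"
proof -
  have fin: "finite I" using assms(1) finite_subset by (auto simp: indep_def)
  obtain c where c: "\<And>z. (\<Sum>i\<in>insert x I. c i * h i z) = 0" "\<exists>i\<in>insert x I. c i \<noteq> 0"
    using assms by (auto simp: indep_def)
  have eq: "c x * h x z + (\<Sum>i\<in>I. c i * h i z) = 0" for z using c(1)[of z] fin assms(3) by simp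
  have cx: "c x \<noteq> 0"
  proof
    assume "c x = 0"
    then have "\<forall>z. (\<Sum>i\<in>I. c i * h i z) = 0" using eq by simp
    then have "\<forall>i\<in>I. c i = 0" using assms(1) unfolding indep_def by blast
    then show False using c(2) \<open>c x = 0\<close> by auto
  qed
  have "h x z = (\<Sum>i\<in>I. (- c i / c x) * h i z)" for z
  proof -
    have "c x * h x z = (\<Sum>i\<in>I. - c i * h i z)" using eq[of z] by (simp add: sum_negf eq_neg_iff_add_eq_0)
    then have "h x z = (\<Sum>i\<in>I. - c i * h i z) / c x" using cx by (simp add: field_simps)
    then show ?thesis by (simp add: sum_divide_distrib)
  qed
  then show ?thesis unfolding in_span_def by (intro exI[of _ "\<lambda>i. - c i / c x"]) auto
qed

text \<open>Exchange is Steinitz's argument: if no element of \<open>J\<close> enlarges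
  \<open>I\<close>, all of \<open>J\<close> lies in the span of \<open>I\<close>, and
  \<open>card J\<close> vectors with only \<open>card I\<close> coordinates are dependent.\<close>

sublocale M: finite_matroid "{..<q}" indep
proof
  show "indep J" if I: "indep I" and J: "J \<subseteq> I" for I J
  proof -
    have fin: "finite I" using I finite_subset by (auto simp: indep_def)
    have "\<forall>i\<in>J. c i = 0" if c: "\<forall>z. (\<Sum>i\<in>J. c i * h i z) = 0" for c
    proof -
      have "(\<Sum>i\<in>I. (if i \<in> J then c i else 0) * h i z) = 0" for z
      proof -
        have "(\<Sum>i\<in>I. (if i \<in> J then c i else 0) * h i z) = (\<Sum>i\<in>J. c i * h i z)"
          using fin J by (intro sum.mono_neutral_cong_right) auto
        then show ?thesis using c by simp
      qed
      then have "(if i \<in> J then c i else 0) = 0" if "i \<in> I" for i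
        using indep_zero[OF I, of "\<lambda>i. if i \<in> J then c i else 0" i] that by blast
      then show ?thesis using J by (metis subsetD)
    qed
    then show ?thesis using I J by (auto simp: indep_def)
  qed
  show "\<exists>x\<in>J - I. indep (insert x I)" if IJ: "indep I" "indep J" "card I < card J" for I J
  proof (rule ccontr)
    assume con: "\<not> ?thesis"
    have fin: "finite I" "finite J" using IJ finite_subset by (auto simp: indep_def)
    have "in_span I (h x)" if "x \<in> J" for x
    proof (cases "x \<in> I")
      case True
      then show ?thesis using in_span_member fin by blast
    next
      case False
      then show ?thesis using dependent_in_span[OF IJ(1), of x] con that IJ(2) by (auto simp: indep_def)
    qed
    then have "\<forall>x\<in>J. \<exists>e. \<forall>z. h x z = (\<Sum>i\<in>I. e i * h i z)" by (auto simp: in_span_def)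
    then obtain d where d: "\<And>x z. x \<in> J \<Longrightarrow> h x z = (\<Sum>i\<in>I. d x i * h i z)"
      using bchoice[of J "\<lambda>b e. \<forall>z. h b z = (\<Sum>i\<in>I. e i * h i z)"] by blast
    obtain c where c: "\<exists>x\<in>J. c x \<noteq> 0" "\<forall>i\<in>I. (\<Sum>x\<in>J. c x * d x i) = 0"
      using homogeneous_system_solution[OF fin IJ(3)] by blast
    have "(\<Sum>x\<in>J. c x * h x z) = 0" for z
    proof -
      have "(\<Sum>x\<in>J. c x * h x z) = (\<Sum>x\<in>J. \<Sum>i\<in>I. c x * d x i * h i z)"
        by (intro sum.cong) (auto simp: d sum_distrib_left mult.assoc)
      also have "\<dots> = (\<Sum>i\<in>I. \<Sum>x\<in>J. c x * d x i * h i z)" by (rule sum.swap)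
      also have "\<dots> = (\<Sum>i\<in>I. (\<Sum>x\<in>J. c x * d x i) * h i z)" by (simp add: sum_distrib_right)
      also have "\<dots> = 0" using c(2) by simp
      finally show ?thesis .
    qed
    then have "\<forall>x\<in>J. c x = 0" using IJ(2) unfolding indep_def by blast
    then show False using c(1) by blast
  qed
qed (auto simp: indep_def)

definition R :: nat where "R = M.rk {..<q}"

definition basis :: "nat set \<Rightarrow> bool" where "basis B \<longleftrightarrow> indep B \<and> card B = R"

lemma basis_finite: "basis B \<Longrightarrow> finite B" "basis B \<Longrightarrow> B \<subseteq> {..<q}"
  using M.finite_indep by (auto simp: basis_def indep_def)

lemma basis_in_span:
  assumes "basis B" "j < q" shows "in_span B (h j)"
proof (cases "j \<in> B")
  case True
  then show ?thesis using in_span_member basis_finite[OF assms(1)] by blast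
next
  case False
  have "\<not> indep (insert j B)"
  proof
    assume I: "indep (insert j B)"
    then have "card (insert j B) \<le> R" unfolding R_def by (intro M.card_indep_le_rk) (auto simp: indep_def)
    then show False using False assms(1) basis_finite[OF assms(1)] by (simp add: basis_def)
  qed
  then show ?thesis using dependent_in_span False assms by (auto simp: basis_def)
qed

lemma basis_extend:
  assumes "indep I" shows "\<exists>B. I \<subseteq> B \<and> basis B"
  using M.indep_extend[OF assms, of "{..<q}"] assms by (auto simp: basis_def indep_def R_def)

text \<open>What survives of general position in a degenerate curve: \<open>n + 1\<close> of the
  functions may be dependent but still generate the whole span. It is the spanning hypothesis for
  the Nochka weights.\<close>

lemma rk_full:
  assumes "B \<subseteq> {..<q}" "card B = n + 1" shows "M.rk B = R"
proof (rule antisym)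
  show "M.rk B \<le> R" unfolding R_def using assms(1) by (rule M.rk_mono)
  obtain I where I: "I \<subseteq> B" "indep I" "card I = M.rk B" using M.rk_witness by blast
  obtain J where J: "basis J" using basis_extend[OF M.indep_empty] by blast
  have finI: "finite I" using M.finite_indep I by blast
  show "R \<le> M.rk B"
  proof (rule ccontr)
    assume "\<not> R \<le> M.rk B"
    then have "card I < card J" using I J by (simp add: basis_def)
    then obtain x where x: "x \<in> J - I" "indep (insert x I)"
      using M.exchange[OF I(2), of J] J by (auto simp: basis_def)
    have "in_span I (h b)" if "b \<in> B" for b
    proof (cases "b \<in> I")
      case True
      then show ?thesis using in_span_member finI by blast
    next
      case False
      have "\<not> indep (insert b I)"
      proof
        assume "indep (insert b I)"
        then have "card (insert b I) \<le> M.rk B" using that I by (intro M.card_indep_le_rk) auto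
        then show False using False finI I by simp
      qed
      then show ?thesis using dependent_in_span[OF I(2) _ False] that assms by auto
    qed
    moreover have "in_span B (h x)"
      using span[OF assms, of x] x(2) by (auto simp: in_span_def indep_def)
    ultimately have "in_span I (h x)" using in_span_trans by blast
    then obtain d where d: "\<And>z. h x z = (\<Sum>i\<in>I. d i * h i z)" by (auto simp: in_span_def)
    have "(\<Sum>i\<in>insert x I. (if i = x then - 1 else d i) * h i z) = 0" for z
    proof -
      have "(\<Sum>i\<in>I. (if i = x then - 1 else d i) * h i z) = (\<Sum>i\<in>I. d i * h i z)"
        using x by (intro sum.cong) auto
      then show ?thesis using x finI d[of z] by simp
    qed
    then have "(if x = x then - 1 else d x) = 0"
      using indep_zero[OF x(2), of "\<lambda>i. if i = x then - 1 else d i" x] by blast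
    then show False by simp
  qed
qed

lemma R_ge: "2 \<le> R"
proof -
  obtain i j z where ij: "i < q" "j < q" "h i 0 * h j z \<noteq> h j 0 * h i z" using nonconst by blast
  have ne: "i \<noteq> j" using ij by auto
  have "indep {i, j}"
  proof -
    have "c i = 0 \<and> c j = 0" if c: "\<forall>w. (\<Sum>l\<in>{i, j}. c l * h l w) = 0" for c
    proof -
      have e: "c i * h i w + c j * h j w = 0" for w using c[rule_format, of w] ne by simp
      have "c i * (h i 0 * h j z - h j 0 * h i z) = (c i * h i 0 + c j * h j 0) * h j z - (c i * h i z + c j * h j z) * h j 0"
        by (simp add: algebra_simps)
      then have ci: "c i = 0" using e[of 0] e[of z] ij(3) by simp
      then have "c j = 0" using e[of 0] base[OF ij(2)] by simp
      then show ?thesis using ci by simp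
    qed
    then show ?thesis using ij by (auto simp: indep_def)
  qed
  then have "card {i, j} \<le> R" unfolding R_def using ij by (intro M.card_indep_le_rk) auto
  then show ?thesis using ne by simp
qed

lemma R_le: "R \<le> n + 1"
proof -
  have "card {..<n + 1} = n + 1" "{..<n + 1} \<subseteq> {..<q}" using q_large by auto
  then show ?thesis using rk_full[of "{..<n + 1}"] M.rk_le_card[of "{..<n + 1}"] by simp
qed

section \<open>The Wronskian of the curve\<close>

text \<open>Wronskians of two bases differ by a constant factor, so one fixed \<open>W\<close> can
  be estimated at each point through the basis best suited to that point. In the second estimate the
  factor \<open>exp (- p)\<close> appears to the power \<open>R\<close> on both sides and cancels,
  so bounds for the normalized functions bound \<open>W\<close> itself.\<close>

lemma wronskian_of_curve:
  obtains W C where "W holomorphic_on UNIV" "\<exists>z. W z \<noteq> 0" "0 < C"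
    "\<forall>B a \<nu> g. basis B \<longrightarrow> (\<forall>i\<in>B. g i holomorphic_on UNIV) \<longrightarrow>
      (\<forall>i\<in>B. \<forall>w. h i w = (w - a) ^ \<nu> i * g i w) \<longrightarrow>
      (\<exists>G. G holomorphic_on UNIV \<and> (\<forall>w. W w = (w - a) ^ (\<Sum>i\<in>B. \<nu> i - (R - 1)) * G w))"
    "\<forall>B p z L. basis B \<longrightarrow> p holomorphic_on UNIV \<longrightarrow> 0 \<le> L \<longrightarrow>
      (\<forall>i\<in>B. \<forall>l<R. norm ((deriv ^^ l) (\<lambda>z. h i z * exp (- p z)) z) \<le> L * norm (h i z * exp (- p z))) \<longrightarrow>
      norm (W z) \<le> C * L ^ R * (\<Prod>i\<in>B. norm (h i z))"
proof -
  have "\<exists>e. bij_betw e {..<R} B" if "basis B" for B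
    using ex_bij_betw_nat_finite[OF basis_finite(1)[OF that]] that by (simp add: basis_def lessThan_atLeast0)
  then have "\<forall>B. \<exists>e. basis B \<longrightarrow> bij_betw e {..<R} B" by blast
  then obtain e where e: "\<And>B. basis B \<Longrightarrow> bij_betw (e B) {..<R} B" by metis
  have e_in: "e B j \<in> B" if "basis B" "j < R" for B j using e[OF that(1)] that(2) by (auto simp: bij_betw_def)
  have e_q: "e B j < q" if "basis B" "j < R" for B j using e_in[OF that] basis_finite[OF that(1)] by auto
  define w where "w B = wronskian R (\<lambda>j. h (e B j))" for B
  obtain B0 where B0: "basis B0" using basis_extend[OF M.indep_empty] by blast
  have hol_w: "w B holomorphic_on UNIV" if "basis B" for B
    unfolding w_def using e_q[OF that] hol by (intro holomorphic_wronskian) auto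
  have sum_e: "(\<Sum>j<R. f (e B j)) = (\<Sum>i\<in>B. f i)" if "basis B" for B and f :: "nat \<Rightarrow> 'b::comm_monoid_add"
    using sum.reindex_bij_betw[OF e[OF that]] .
  have prod_e: "(\<Prod>j<R. f (e B j)) = (\<Prod>i\<in>B. f i)" if "basis B" for B and f :: "nat \<Rightarrow> 'b::comm_monoid_mult"
    using prod.reindex_bij_betw[OF e[OF that]] .
  have "\<exists>c. \<forall>z. w B0 z = w B z * c" if B: "basis B" for B
  proof -
    have "\<forall>j. \<exists>d. j < R \<longrightarrow> (\<forall>z. h (e B0 j) z = (\<Sum>i\<in>B. d i * h i z))"
      using basis_in_span[OF B] e_q[OF B0] by (auto simp: in_span_def)
    then obtain d where d: "\<And>j z. j < R \<Longrightarrow> h (e B0 j) z = (\<Sum>i\<in>B. d j i * h i z)" by metis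
    have "w B0 z = w B z * Determinant.det (Matrix.mat R R (\<lambda>(l, j). d j (e B l)))" for z
      unfolding w_def
    proof (rule wronskian_base_change)
      show "h (e B0 j) z = (\<Sum>l<R. d j (e B l) * h (e B l) z)" if "j < R" for j z
        using d[OF that] sum_e[OF B, of "\<lambda>i. d j i * h i z"] by simp
    qed (use e_q[OF B] hol in auto)
    then show ?thesis by blast
  qed
  then obtain c where c: "\<And>B z. basis B \<Longrightarrow> w B0 z = w B z * c B" by metis
  define C where "C = fact R * (1 + (\<Sum>B\<in>Pow {..<q}. norm (c B)))"
  have C_ge: "fact R * norm (c B) \<le> C" if "basis B" for B
  proof -
    have "norm (c B) \<le> (\<Sum>B\<in>Pow {..<q}. norm (c B))"
      using basis_finite[OF that] by (intro member_le_sum) auto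
    then show ?thesis unfolding C_def by (intro mult_left_mono) auto
  qed
  show thesis
  proof
    show "w B0 holomorphic_on UNIV" using hol_w B0 .
    show "\<exists>z. w B0 z \<noteq> 0"
      unfolding w_def
    proof (rule wronskian_nonzero)
      fix cf :: "nat \<Rightarrow> complex" assume cf: "\<And>z. (\<Sum>j<R. cf j * h (e B0 j) z) = 0"
      define f where "f i = cf (inv_into {..<R} (e B0) i)" for i
      have fe: "f (e B0 j) = cf j" if "j < R" for j
        using bij_betw_inv_into_left[OF e[OF B0]] that by (simp add: f_def)
      have "(\<Sum>i\<in>B0. f i * h i z) = 0" for z
      proof -
        have "(\<Sum>i\<in>B0. f i * h i z) = (\<Sum>j<R. f (e B0 j) * h (e B0 j) z)"
          using sum_e[OF B0, of "\<lambda>i. f i * h i z"] by simp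
        also have "\<dots> = (\<Sum>j<R. cf j * h (e B0 j) z)" by (intro sum.cong) (auto simp: fe)
        finally show ?thesis using cf by simp
      qed
      then have "\<forall>i\<in>B0. f i = 0" using B0 unfolding basis_def indep_def by blast
      then show "\<forall>j<R. cf j = 0" using fe e_in[OF B0] by metis
    qed (use e_q[OF B0] hol in auto)
    show "0 < C" unfolding C_def by (intro mult_pos_pos add_pos_nonneg sum_nonneg) auto
  next
    show "\<forall>B a \<nu> g. basis B \<longrightarrow> (\<forall>i\<in>B. g i holomorphic_on UNIV) \<longrightarrow>
      (\<forall>i\<in>B. \<forall>w. h i w = (w - a) ^ \<nu> i * g i w) \<longrightarrow>
      (\<exists>G. G holomorphic_on UNIV \<and> (\<forall>x. w B0 x = (x - a) ^ (\<Sum>i\<in>B. \<nu> i - (R - 1)) * G x))"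
    proof (intro allI impI)
      fix B a \<nu> and g :: "nat \<Rightarrow> complex \<Rightarrow> complex"
      assume B: "basis B" and g: "\<forall>i\<in>B. g i holomorphic_on UNIV"
        "\<forall>i\<in>B. \<forall>w. h i w = (w - a) ^ \<nu> i * g i w"
      have "\<exists>G. G holomorphic_on UNIV \<and> (\<forall>x. wronskian R (\<lambda>j. h (e B j)) x = (x - a) ^ (\<Sum>j<R. \<nu> (e B j) - (R - 1)) * G x)"
        using g e_in[OF B] by (intro wronskian_order[where g = "\<lambda>j. g (e B j)"]) auto
      then obtain G where G: "G holomorphic_on UNIV" "\<And>x. w B x = (x - a) ^ (\<Sum>i\<in>B. \<nu> i - (R - 1)) * G x"
        unfolding w_def sum_e[OF B, of "\<lambda>i. \<nu> i - (R - 1)"] by blast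
      have "w B0 x = (x - a) ^ (\<Sum>i\<in>B. \<nu> i - (R - 1)) * (G x * c B)" for x
        using c[OF B, of x] G(2)[of x] by simp
      moreover have "(\<lambda>x. G x * c B) holomorphic_on UNIV" using G(1) by (intro holomorphic_intros)
      ultimately show "\<exists>G. G holomorphic_on UNIV \<and> (\<forall>x. w B0 x = (x - a) ^ (\<Sum>i\<in>B. \<nu> i - (R - 1)) * G x)"
        by blast
    qed
  next
    show "\<forall>B p z L. basis B \<longrightarrow> p holomorphic_on UNIV \<longrightarrow> 0 \<le> L \<longrightarrow>
      (\<forall>i\<in>B. \<forall>l<R. norm ((deriv ^^ l) (\<lambda>z. h i z * exp (- p z)) z) \<le> L * norm (h i z * exp (- p z))) \<longrightarrow>
      norm (w B0 z) \<le> C * L ^ R * (\<Prod>i\<in>B. norm (h i z))"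
    proof (intro allI impI)
      fix B and p :: "complex \<Rightarrow> complex" and z L
      assume B: "basis B" and p: "p holomorphic_on UNIV" and L: "0 \<le> L"
        and bound: "\<forall>i\<in>B. \<forall>l<R. norm ((deriv ^^ l) (\<lambda>z. h i z * exp (- p z)) z) \<le> L * norm (h i z * exp (- p z))"
      let ?E = "\<lambda>z. exp (- p z)"
      have "wronskian R (\<lambda>j z. exp (- p z) * h (e B j) z) z = ?E z ^ R * w B z"
        unfolding w_def using p e_q[OF B] hol by (intro wronskian_mult) (auto intro!: holomorphic_intros)
      then have "norm (?E z) ^ R * norm (w B z) = norm (wronskian R (\<lambda>j z. exp (- p z) * h (e B j) z) z)"
        by (simp add: norm_mult norm_power)
      also have "\<dots> \<le> fact R * L ^ R * (\<Prod>j<R. norm (?E z * h (e B j) z))"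
      proof (rule norm_wronskian_le[OF L])
        fix l j assume lj: "l < R" "j < R"
        have comm: "?E x * h (e B j) x = h (e B j) x * ?E x" for x by (rule mult.commute)
        show "norm ((deriv ^^ l) (\<lambda>z. ?E z * h (e B j) z) z) \<le> L * norm (?E z * h (e B j) z)"
          unfolding comm using bound e_in[OF B lj(2)] lj(1) by blast
      qed
      also have "(\<Prod>j<R. norm (?E z * h (e B j) z)) = norm (?E z) ^ R * (\<Prod>i\<in>B. norm (h i z))"
        using prod_e[OF B, of "\<lambda>i. norm (h i z)"] by (simp add: norm_mult prod.distrib del: norm_exp_eq_Re)
      finally have "norm (?E z) ^ R * norm (w B z) \<le> norm (?E z) ^ R * (fact R * L ^ R * (\<Prod>i\<in>B. norm (h i z)))"
        by (simp add: mult_ac del: norm_exp_eq_Re)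
      then have wB: "norm (w B z) \<le> fact R * L ^ R * (\<Prod>i\<in>B. norm (h i z))"
        by (rule mult_left_le_imp_le) simp
      have "norm (w B0 z) = norm (w B z) * norm (c B)" using c[OF B, of z] by (simp add: norm_mult)
      also have "\<dots> \<le> (fact R * L ^ R * (\<Prod>i\<in>B. norm (h i z))) * norm (c B)"
        using wB by (intro mult_right_mono) auto
      also have "\<dots> = (fact R * norm (c B)) * (L ^ R * (\<Prod>i\<in>B. norm (h i z)))" by simp
      also have "\<dots> \<le> C * (L ^ R * (\<Prod>i\<in>B. norm (h i z)))"
        using C_ge[OF B] L by (intro mult_right_mono mult_nonneg_nonneg prod_nonneg) auto
      finally show "norm (w B0 z) \<le> C * L ^ R * (\<Prod>i\<in>B. norm (h i z))" by (simp add: mult_ac)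
    qed
  qed
qed

text \<open>Plays the role of the norm of the curve, expressed through the forms instead of
  coordinates.\<close>

definition H :: "complex \<Rightarrow> real" where "H z = (\<Sum>i<q. norm (h i z))"

lemma H_pos: "0 < H z"
proof -
  obtain i where i: "i < q" "h i z \<noteq> 0" using no_common_zero by blast
  then have "norm (h i z) \<le> H z" unfolding H_def by (intro member_le_sum) auto
  moreover have "0 < norm (h i z)" using i by simp
  ultimately show ?thesis by linarith
qed

lemma norm_le_H: "i < q \<Longrightarrow> norm (h i z) \<le> H z"
  unfolding H_def by (intro member_le_sum) auto

text \<open>Quantitative form of subgeneral position: as any \<open>n + 1\<close> functions generate
  all others, at most \<open>n\<close> of them can be much smaller than \<open>H\<close> at a point.
  There are finitely many index sets, so one constant suffices.\<close>

lemma H_le_subset: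
  obtains C where "0 < C" "\<And>B z. B \<subseteq> {..<q} \<Longrightarrow> card B = n + 1 \<Longrightarrow> H z \<le> C * (\<Sum>i\<in>B. norm (h i z))"
proof -
  have "\<forall>B j. \<exists>d. B \<subseteq> {..<q} \<and> card B = n + 1 \<and> j < q \<longrightarrow> (\<forall>z. h j z = (\<Sum>i\<in>B. d i * h i z))"
    using span by blast
  then obtain d where d: "\<And>B j z. B \<subseteq> {..<q} \<Longrightarrow> card B = n + 1 \<Longrightarrow> j < q \<Longrightarrow> h j z = (\<Sum>i\<in>B. d B j i * h i z)"
    by metis
  define C where "C = 1 + (\<Sum>B\<in>Pow {..<q}. \<Sum>j<q. \<Sum>i<q. norm (d B j i))"
  have "H z \<le> C * (\<Sum>i\<in>B. norm (h i z))" if B: "B \<subseteq> {..<q}" "card B = n + 1" for B z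
  proof -
    have finB: "finite B" using B finite_subset by blast
    have "H z \<le> (\<Sum>j<q. \<Sum>i\<in>B. norm (d B j i) * norm (h i z))"
      unfolding H_def
    proof (rule sum_mono)
      fix j assume "j \<in> {..<q}"
      then have "h j z = (\<Sum>i\<in>B. d B j i * h i z)" using d[OF B] by simp
      then have "norm (h j z) \<le> (\<Sum>i\<in>B. norm (d B j i * h i z))" by (simp only: norm_sum)
      then show "norm (h j z) \<le> (\<Sum>i\<in>B. norm (d B j i) * norm (h i z))" by (simp add: norm_mult)
    qed
    also have "\<dots> = (\<Sum>i\<in>B. (\<Sum>j<q. norm (d B j i)) * norm (h i z))"
      by (subst sum.swap) (simp add: sum_distrib_right)
    also have "\<dots> \<le> (\<Sum>i\<in>B. C * norm (h i z))"
    proof (intro sum_mono mult_right_mono)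
      fix i assume i: "i \<in> B"
      have "(\<Sum>j<q. norm (d B j i)) \<le> (\<Sum>j<q. \<Sum>i<q. norm (d B j i))"
        using i B by (intro sum_mono member_le_sum) auto
      also have "\<dots> \<le> (\<Sum>B\<in>Pow {..<q}. \<Sum>j<q. \<Sum>i<q. norm (d B j i))"
        using B by (intro member_le_sum[where f = "\<lambda>B. \<Sum>j<q. \<Sum>i<q. norm (d B j i)"] sum_nonneg) auto
      finally show "(\<Sum>j<q. norm (d B j i)) \<le> C" by (simp add: C_def)
    qed auto
    finally show ?thesis by (simp add: sum_distrib_left)
  qed
  moreover have "0 < C" unfolding C_def by (intro add_pos_nonneg sum_nonneg) auto
  ultimately show thesis using that by blast
qed

end

context orbifold_curve
begin

section \<open>The auxiliary function\<close>

lemma card_common_zeros: "card {i. i < q \<and> h i z = 0} \<le> n"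
proof (rule ccontr)
  assume "\<not> ?thesis"
  then have "n + 1 \<le> card {i. i < q \<and> h i z = 0}" by simp
  then obtain B where B: "B \<subseteq> {i. i < q \<and> h i z = 0}" "card B = n + 1" "finite B"
    by (rule obtain_subset_with_card_n)
  obtain C where "H z \<le> C * (\<Sum>i\<in>B. norm (h i z))"
    using H_le_subset B by (metis (mono_tags, lifting) lessThan_iff mem_Collect_eq subset_eq)
  moreover have "(\<Sum>i\<in>B. norm (h i z)) = 0" using B by (intro sum.neutral) auto
  ultimately show False using H_pos[of z] by simp
qed

text \<open>The inequality to reach is that \<open>\<Sum> w i * s i\<close> exceeds
  \<open>R\<close>, where \<open>s i\<close> is the share of an order that is sure to survive
  truncation at \<open>R - 1\<close>. Scaling by a large \<open>N\<close> and rounding down keeps it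
  strict; the surplus becomes the power of \<open>H\<close> won in
  \<open>auxiliary_function\<close>.\<close>

lemma exponents:
  obtains w :: "nat \<Rightarrow> real" and p :: "nat \<Rightarrow> nat" and N :: nat where
    "\<forall>i<q. 0 \<le> w i" "\<forall>B\<subseteq>{..<q}. card B \<le> n \<longrightarrow> sum w B \<le> real (M.rk B)"
    "\<forall>i<q. real (p i) \<le> real N * w i * max 0 (1 - (real R - 1) * t i)"
    "N * R < (\<Sum>i<q. p i)"
proof -
  have "\<exists>w l. 0 < l \<and> (\<forall>i\<in>{..<q}. 0 \<le> w i \<and> w i \<le> l)
    \<and> sum w {..<q} = l * (real (card {..<q}) - 2 * real n - 2 + real (M.rk {..<q})) + real (M.rk {..<q})
    \<and> (\<forall>B\<subseteq>{..<q}. card B \<le> n \<longrightarrow> sum w B \<le> real (M.rk B))"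
    using q_large R_ge rk_full by (intro M.nochka_weights) (auto simp: R_def)
  then obtain w l where l: "0 < l" and w: "\<forall>i<q. 0 \<le> w i \<and> w i \<le> l"
    "sum w {..<q} = l * (real q - 2 * real n - 2 + real R) + real R"
    "\<forall>B\<subseteq>{..<q}. card B \<le> n \<longrightarrow> sum w B \<le> real (M.rk B)"
    by (auto simp: R_def)
  define s where "s i = max 0 (1 - (real R - 1) * t i)" for i
  define k where "k = real R - 1"
  have k: "0 < k" "k \<le> real n" using R_ge R_le by (auto simp: k_def)
  have "real R < (\<Sum>i<q. w i * s i)"
  proof -
    have "(\<Sum>i<q. w i * t i) \<le> (\<Sum>i<q. l * t i)"
      using w(1) t_nonneg by (intro sum_mono mult_right_mono) auto
    then have 1: "k * (\<Sum>i<q. w i * t i) \<le> k * (l * (\<Sum>i<q. t i))"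
      using k by (intro mult_left_mono) (auto simp: sum_distrib_left)
    have "(\<Sum>i<q. t i) < (real q - real n - 1) / real n"
      using t_sum n_pos by (simp add: field_simps)
    then have "k * (l * (\<Sum>i<q. t i)) < k * (l * ((real q - real n - 1) / real n))"
      using k l by (intro mult_strict_left_mono) auto
    \<comment> \<open>Both sides are affine in \<open>k\<close>. They agree at \<open>k = n\<close>,
      and at \<open>k = 0\<close> they differ by \<open>l * (q - 2 * n - 1)\<close>, which is
      nonnegative.\<close>
    also have "\<dots> \<le> l * (real q - 2 * real n - 1 + k)"
    proof -
      have "0 \<le> (real q - 2 * real n - 1) * (real n - k)"
        using q_large k by (intro mult_nonneg_nonneg) auto
      then have "k * (real q - real n - 1) \<le> real n * (real q - 2 * real n - 1 + k)"
        by (simp add: algebra_simps)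
      then have "k * ((real q - real n - 1) / real n) \<le> real q - 2 * real n - 1 + k"
        using n_pos by (simp add: field_simps)
      then have "l * (k * ((real q - real n - 1) / real n)) \<le> l * (real q - 2 * real n - 1 + k)"
        using l by (intro mult_left_mono) auto
      then show ?thesis by (simp add: mult_ac)
    qed
    finally have 2: "k * (l * (\<Sum>i<q. t i)) < l * (real q - 2 * real n - 1 + k)" .
    have 3: "k * (l * (\<Sum>i<q. t i)) < l * (real q - 2 * real n - 2 + real R)"
    proof -
      have "real q - 2 * real n - 1 + k = real q - 2 * real n - 2 + real R" by (simp add: k_def)
      then show ?thesis using 2 by (simp only:)
    qed
    have "real R < sum w {..<q} - k * (\<Sum>i<q. w i * t i)"
      using 1 3 w(2) by linarith
    also have "\<dots> = (\<Sum>i<q. w i * (1 - k * t i))"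
      by (simp add: algebra_simps sum_subtractf sum_distrib_left)
    also have "\<dots> \<le> (\<Sum>i<q. w i * s i)"
      using w(1) by (intro sum_mono mult_left_mono) (auto simp: s_def k_def)
    finally show ?thesis .
  qed
  \<comment> \<open>Rounding down costs at most 1 for each of the \<open>q\<close> indices, so the
    scaled surplus has to exceed \<open>q\<close>.\<close>
  then obtain N :: nat where N: "real q < real N * ((\<Sum>i<q. w i * s i) - real R)"
    using reals_Archimedean3[of "(\<Sum>i<q. w i * s i) - real R"] by auto
  define p where "p i = nat \<lfloor>real N * w i * s i\<rfloor>" for i
  have nn: "0 \<le> real N * w i * s i" if "i < q" for i
    using w(1) that by (auto intro!: mult_nonneg_nonneg simp: s_def)
  have p: "real (p i) \<le> real N * w i * s i" "real N * w i * s i - 1 \<le> real (p i)" if "i < q" for i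
    using nn[OF that] unfolding p_def by linarith+
  have "real N * (\<Sum>i<q. w i * s i) - real q = (\<Sum>i<q. real N * w i * s i - 1)"
    by (simp add: sum_subtractf sum_distrib_left mult.assoc)
  also have "\<dots> \<le> (\<Sum>i<q. real (p i))" using p(2) by (intro sum_mono) auto
  finally have "real N * real R < real (\<Sum>i<q. p i)" using N by (simp add: algebra_simps)
  then have "N * R < (\<Sum>i<q. p i)" by (metis of_nat_less_iff of_nat_mult)
  then show thesis using that[of w p N] w p(1) by (auto simp: s_def)
qed

text \<open>The form in which the Nochka weights are used. \<open>e\<close> is once the truncated
  order of vanishing at a point and once the logarithmic closeness to the hyperplanes; in both cases
  at most \<open>n\<close> indices matter.\<close>

lemma dominating_basis:
  assumes "S \<subseteq> {..<q}" "card S \<le> n" "\<And>B. B \<subseteq> {..<q} \<Longrightarrow> card B \<le> n \<Longrightarrow> sum w B \<le> real (M.rk B)"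
    and "\<And>i. i < q \<Longrightarrow> 0 \<le> e i"
  obtains B where "basis B" "(\<Sum>i\<in>S. w i * e i) \<le> (\<Sum>i\<in>B. e i)"
proof -
  have finS: "finite S" using assms(1) finite_subset by blast
  have "sum w B \<le> real (M.rk B)" if "B \<subseteq> S" for B
    using assms(3)[of B] that assms(1,2) card_mono[OF finS that] by simp
  then obtain I where I: "I \<subseteq> S" "indep I" "(\<Sum>i\<in>S. w i * e i) \<le> (\<Sum>i\<in>I. e i)"
    using M.greedy_independent[of S e w] assms(1,4) by auto
  obtain B where B: "I \<subseteq> B" "basis B" using basis_extend[OF I(2)] by blast
  have "(\<Sum>i\<in>I. e i) \<le> (\<Sum>i\<in>B. e i)"
    using B basis_finite[OF B(2)] assms(4) by (intro sum_mono2) auto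
  then show thesis using that B I by fastforce
qed

text \<open>The order of \<open>Q\<close> at a zero is at most \<open>N\<close> times the truncated
  orders over a suitable basis, hence at most the order of \<open>W ^ N\<close>. The same comparison
  with logarithms of sizes bounds \<open>W ^ N / Q\<close>. The exponent \<open>\<delta>\<close> is
  what remains of \<open>H\<close> when its \<open>\<Sum> p i\<close> copies from \<open>Q\<close>
  are set against the \<open>N * R\<close> copies from \<open>W ^ N\<close>.\<close>

lemma auxiliary_function:
  obtains G and \<delta> :: nat and K where "G holomorphic_on UNIV" "\<exists>z. G z \<noteq> 0" "1 \<le> \<delta>" "0 \<le> K"
    "\<forall>z p L. p holomorphic_on UNIV \<longrightarrow> 1 \<le> L \<longrightarrow> (\<forall>i<q. h i z \<noteq> 0) \<longrightarrow>
      (\<forall>i<q. \<forall>l<R. norm ((deriv ^^ l) (\<lambda>z. h i z * exp (- p z)) z) \<le> L * norm (h i z * exp (- p z))) \<longrightarrow>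
      G z \<noteq> 0 \<longrightarrow> ln (norm (G z)) + real \<delta> * ln (H z) \<le> K * (1 + ln L)"
proof -
  obtain W C where W: "W holomorphic_on UNIV" "\<exists>z. W z \<noteq> 0" "0 < C" and
    W_order: "\<forall>B a \<nu> g. basis B \<longrightarrow> (\<forall>i\<in>B. g i holomorphic_on UNIV) \<longrightarrow>
      (\<forall>i\<in>B. \<forall>w. h i w = (w - a) ^ \<nu> i * g i w) \<longrightarrow>
      (\<exists>G. G holomorphic_on UNIV \<and> (\<forall>w. W w = (w - a) ^ (\<Sum>i\<in>B. \<nu> i - (R - 1)) * G w))" and
    W_bound: "\<forall>B p z L. basis B \<longrightarrow> p holomorphic_on UNIV \<longrightarrow> 0 \<le> L \<longrightarrow>
      (\<forall>i\<in>B. \<forall>l<R. norm ((deriv ^^ l) (\<lambda>z. h i z * exp (- p z)) z) \<le> L * norm (h i z * exp (- p z))) \<longrightarrow>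
      norm (W z) \<le> C * L ^ R * (\<Prod>i\<in>B. norm (h i z))"
    by (rule wronskian_of_curve)
  obtain w p N where w': "\<forall>i<q. 0 \<le> w i" "\<forall>B\<subseteq>{..<q}. card B \<le> n \<longrightarrow> sum w B \<le> real (M.rk B)"
    and p': "\<forall>i<q. real (p i) \<le> real N * w i * max 0 (1 - (real R - 1) * t i)"
      "N * R < (\<Sum>i<q. p i)"
    by (rule exponents)
  have w: "\<And>i. i < q \<Longrightarrow> 0 \<le> w i" "\<And>B. B \<subseteq> {..<q} \<Longrightarrow> card B \<le> n \<Longrightarrow> sum w B \<le> real (M.rk B)"
    using w' by blast+
  have p: "\<And>i. i < q \<Longrightarrow> real (p i) \<le> real N * w i * max 0 (1 - (real R - 1) * t i)" "N * R < (\<Sum>i<q. p i)"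
    using p' by blast+
  have p_le: "real (p i) \<le> real N * w i" if "i < q" for i
  proof -
    have "max 0 (1 - (real R - 1) * t i) \<le> 1" using R_ge t_nonneg[OF that] by simp
    then have "real N * w i * max 0 (1 - (real R - 1) * t i) \<le> real N * w i * 1"
      using w(1)[OF that] by (intro mult_left_mono) auto
    then show ?thesis using p(1)[OF that] by simp
  qed
  define Q where "Q z = (\<Prod>i<q. h i z ^ p i)" for z
  have "\<exists>\<nu> P g. P holomorphic_on UNIV \<and> g holomorphic_on UNIV \<and> g a \<noteq> 0
      \<and> (\<forall>x. W x ^ N = (x - a) ^ \<nu> * P x) \<and> (\<forall>x. Q x = (x - a) ^ \<nu> * g x)" for a
  proof -
    have "\<forall>i. \<exists>\<nu> g. i < q \<longrightarrow> g holomorphic_on UNIV \<and> g a \<noteq> 0 \<and> (\<forall>x. h i x = (x - a) ^ \<nu> * g x)"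
      using entire_factor_order[OF hol base, of _ a] by metis
    then obtain \<nu> g where g: "\<And>i. i < q \<Longrightarrow> g i holomorphic_on UNIV" "\<And>i. i < q \<Longrightarrow> g i a \<noteq> 0"
      "\<And>i x. i < q \<Longrightarrow> h i x = (x - a) ^ \<nu> i * g i x"
      by metis
    define e where "e i = real (\<nu> i - (R - 1))" for i
    \<comment> \<open>Since \<open>t i * \<nu> i \<ge> 1\<close> at a zero, the truncated order
      \<open>\<nu> i - (R - 1)\<close> is at least the fraction \<open>1 - (R - 1) * t i\<close> of
      \<open>\<nu> i\<close>.\<close>
    have pe: "real (p i) * real (\<nu> i) \<le> real N * w i * e i" if i: "i < q" for i
    proof (cases "\<nu> i = 0")
      case True
      then show ?thesis by (simp add: e_def)
    next
      case False
      then have "1 \<le> t i * real (\<nu> i)" using multiplicity[of i "\<nu> i" "g i" a] g i by auto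
      then have "(real R - 1) * 1 \<le> (real R - 1) * (t i * real (\<nu> i))"
        using R_ge by (intro mult_left_mono) auto
      then have "(1 - (real R - 1) * t i) * real (\<nu> i) \<le> real (\<nu> i) - (real R - 1)" by (simp add: algebra_simps)
      also have "\<dots> \<le> e i" using R_ge by (simp add: e_def of_nat_diff_real)
      finally have "max 0 (1 - (real R - 1) * t i) * real (\<nu> i) \<le> e i" by (simp add: max_def e_def)
      then have "real N * w i * (max 0 (1 - (real R - 1) * t i) * real (\<nu> i)) \<le> real N * w i * e i"
        using w(1)[OF i] by (intro mult_left_mono) auto
      moreover have "real (p i) * real (\<nu> i) \<le> real N * w i * max 0 (1 - (real R - 1) * t i) * real (\<nu> i)"
        using p(1)[OF i] by (intro mult_right_mono) auto
      ultimately show ?thesis by (simp add: mult.assoc)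
    qed
    define S where "S = {i. i < q \<and> h i a = 0}"
    have S_iff: "i \<in> S \<longleftrightarrow> \<nu> i \<noteq> 0" if "i < q" for i
      using g(2,3)[OF that] that by (auto simp: S_def)
    obtain B where B: "basis B" "(\<Sum>i\<in>S. w i * e i) \<le> (\<Sum>i\<in>B. e i)"
      by (rule dominating_basis[of S w e]) (use card_common_zeros w(2) in \<open>auto simp: S_def e_def\<close>)
    define D where "D = (\<Sum>i\<in>B. \<nu> i - (R - 1))"
    have "\<exists>G. G holomorphic_on UNIV \<and> (\<forall>x. W x = (x - a) ^ D * G x)"
      unfolding D_def using g basis_finite[OF B(1)] by (intro W_order[rule_format, OF B(1), of g]) auto
    then obtain G where G: "G holomorphic_on UNIV" "\<And>x. W x = (x - a) ^ D * G x" by blast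
    define m where "m = (\<Sum>i<q. p i * \<nu> i)"
    have "real m \<le> (\<Sum>i<q. real N * w i * e i)"
      unfolding m_def of_nat_sum of_nat_mult using pe by (intro sum_mono) auto
    also have "\<dots> = (\<Sum>i\<in>S. real N * w i * e i)"
      using S_iff by (intro sum.mono_neutral_right) (auto simp: S_def e_def)
    also have "\<dots> = real N * (\<Sum>i\<in>S. w i * e i)" by (simp add: sum_distrib_left mult.assoc)
    also have "\<dots> \<le> real N * (\<Sum>i\<in>B. e i)" using B(2) by (intro mult_left_mono) auto
    also have "\<dots> = real (N * D)" by (simp add: e_def D_def)
    finally have mD: "m \<le> N * D" by linarith
    have "W x ^ N = (x - a) ^ m * ((x - a) ^ (N * D - m) * G x ^ N)" for x
    proof -
      have "W x ^ N = (x - a) ^ (m + (N * D - m)) * G x ^ N"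
        using mD by (simp add: G power_mult_distrib power_mult[symmetric] mult.commute)
      then show ?thesis by (simp add: power_add)
    qed
    moreover have "Q x = (x - a) ^ m * (\<Prod>i<q. g i x ^ p i)" for x
    proof -
      have "Q x = (\<Prod>i<q. (x - a) ^ (p i * \<nu> i) * g i x ^ p i)"
        unfolding Q_def by (intro prod.cong) (auto simp: g(3) power_mult_distrib power_mult[symmetric] mult.commute)
      then show ?thesis by (simp add: prod.distrib power_sum m_def)
    qed
    moreover have "(\<lambda>x. (x - a) ^ (N * D - m) * G x ^ N) holomorphic_on UNIV"
      using G(1) by (intro holomorphic_intros)
    moreover have "(\<lambda>x. \<Prod>i<q. g i x ^ p i) holomorphic_on UNIV"
      using g(1) by (intro holomorphic_intros) auto
    moreover have "(\<Prod>i<q. g i a ^ p i) \<noteq> 0" using g(2) by auto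
    ultimately show ?thesis by blast
  qed
  then obtain G where G: "G holomorphic_on UNIV" "\<And>x. W x ^ N = G x * Q x"
    using entire_quotient[of "\<lambda>x. W x ^ N" Q] by blast
  define \<delta> where "\<delta> = (\<Sum>i<q. p i) - N * R"
  obtain C0 where C0: "0 < C0" "\<And>B z. B \<subseteq> {..<q} \<Longrightarrow> card B = n + 1 \<Longrightarrow> H z \<le> C0 * (\<Sum>i\<in>B. norm (h i z))"
    using H_le_subset by blast
  define C1 where "C1 = max 1 ((real n + 1) * C0)"
  have C1: "1 \<le> C1" "(real n + 1) * C0 \<le> C1" by (auto simp: C1_def)
  define K where "K = real N * (\<bar>ln C\<bar> + real R + (\<Sum>i<q. w i) * ln C1)"
  have w_sum: "0 \<le> (\<Sum>i<q. w i)" using w(1) by (intro sum_nonneg) auto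
  show thesis
  proof
    show "G holomorphic_on UNIV" by (rule G)
    show "\<exists>z. G z \<noteq> 0"
      using W(2) G(2) by (metis mult_zero_left power_eq_0_iff)
    show "1 \<le> \<delta>" using p(2) by (simp add: \<delta>_def)
    show "0 \<le> K" unfolding K_def using w_sum C1 by (intro mult_nonneg_nonneg add_nonneg_nonneg) auto
  next
    show "\<forall>z p L. p holomorphic_on UNIV \<longrightarrow> 1 \<le> L \<longrightarrow> (\<forall>i<q. h i z \<noteq> 0) \<longrightarrow>
      (\<forall>i<q. \<forall>l<R. norm ((deriv ^^ l) (\<lambda>z. h i z * exp (- p z)) z) \<le> L * norm (h i z * exp (- p z))) \<longrightarrow>
      G z \<noteq> 0 \<longrightarrow> ln (norm (G z)) + real \<delta> * ln (H z) \<le> K * (1 + ln L)"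
    proof (intro allI impI)
      fix z L and P :: "complex \<Rightarrow> complex"
      assume P: "P holomorphic_on UNIV" and L: "1 \<le> L" and nz': "\<forall>i<q. h i z \<noteq> 0"
        and bound: "\<forall>i<q. \<forall>l<R. norm ((deriv ^^ l) (\<lambda>z. h i z * exp (- P z)) z) \<le> L * norm (h i z * exp (- P z))"
        and Gz: "G z \<noteq> 0"
      have nz: "h i z \<noteq> 0" if "i < q" for i using nz' that by blast
      have Hz: "0 < H z" by (rule H_pos)
      \<comment> \<open>\<open>ln (E i)\<close> is the proximity of the curve to the hyperplane, the
        analogue of the order \<open>\<nu> i\<close> in the first half.\<close>
      define E where "E i = H z / norm (h i z)" for i
      have E1: "1 \<le> E i" if "i < q" for i
        using nz[OF that] norm_le_H[OF that, of z] by (simp add: E_def)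
      have lnE: "ln (norm (h i z)) = ln (H z) - ln (E i)" if "i < q" for i
        using nz[OF that] Hz by (simp add: E_def ln_div)
      define S where "S = {i. i < q \<and> norm (h i z) < H z / C1}"
      have cardS: "card S \<le> n"
      proof (rule ccontr)
        assume "\<not> ?thesis"
        then have "n + 1 \<le> card S" by simp
        then obtain B where B: "B \<subseteq> S" "card B = n + 1" using obtain_subset_with_card_n by metis
        then have "B \<noteq> {}" "finite B" by (auto intro: card_ge_0_finite)
        then have "(\<Sum>i\<in>B. norm (h i z)) < (\<Sum>i\<in>B. H z / C1)"
          using B(1) by (intro sum_strict_mono) (auto simp: S_def)
        also have "\<dots> = (real n + 1) * (H z / C1)" using B(2) by simp
        finally have "C0 * (\<Sum>i\<in>B. norm (h i z)) < C0 * ((real n + 1) * (H z / C1))"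
          using C0(1) by (intro mult_strict_left_mono) auto
        moreover have "H z \<le> C0 * (\<Sum>i\<in>B. norm (h i z))" using B by (intro C0(2)) (auto simp: S_def)
        moreover have "C0 * ((real n + 1) * (H z / C1)) = ((real n + 1) * C0 / C1) * H z" by simp
        moreover have "((real n + 1) * C0 / C1) * H z \<le> 1 * H z"
          using C1 Hz by (intro mult_right_mono) auto
        ultimately show False by linarith
      qed
      \<comment> \<open>Subtracting \<open>ln C1\<close> makes \<open>e\<close> vanish off
        \<open>S\<close>, which leaves at most \<open>n\<close> indices for
        \<open>dominating_basis\<close>. The price is the constant
        \<open>(\<Sum>i<q. w i) * ln C1\<close>.\<close>
      define e where "e i = max 0 (ln (E i) - ln C1)" for i
      obtain B where B: "basis B" "(\<Sum>i\<in>S. w i * e i) \<le> (\<Sum>i\<in>B. e i)"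
        by (rule dominating_basis[of S w e]) (use cardS w(2) in \<open>auto simp: S_def e_def\<close>)
      have Bq: "i < q" if "i \<in> B" for i using basis_finite[OF B(1)] that by auto
      have e_notin: "e i = 0" if "i < q" "i \<notin> S" for i
      proof -
        have "H z / C1 \<le> norm (h i z)" using that by (auto simp: S_def)
        then have "E i \<le> C1" using nz[OF that(1)] C1 by (simp add: E_def field_simps)
        then have "ln (E i) \<le> ln C1" using E1[OF that(1)] by (intro ln_mono) auto
        then show ?thesis by (simp add: e_def)
      qed
      have "(\<Sum>i<q. w i * ln (E i)) \<le> (\<Sum>i<q. w i * (ln C1 + e i))"
        using w(1) by (intro sum_mono mult_left_mono) (auto simp: e_def)
      also have "\<dots> = (\<Sum>i<q. w i) * ln C1 + (\<Sum>i<q. w i * e i)"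
        by (simp add: distrib_left sum.distrib sum_distrib_right)
      also have "(\<Sum>i<q. w i * e i) = (\<Sum>i\<in>S. w i * e i)"
        using e_notin by (intro sum.mono_neutral_right) (auto simp: S_def)
      also have "\<dots> \<le> (\<Sum>i\<in>B. e i)" by (rule B(2))
      also have "\<dots> \<le> (\<Sum>i\<in>B. ln (E i))"
        using E1 Bq C1 by (intro sum_mono) (auto simp: e_def)
      finally have wE: "(\<Sum>i<q. w i * ln (E i)) \<le> (\<Sum>i<q. w i) * ln C1 + (\<Sum>i\<in>B. ln (E i))" by simp
      have Qz: "Q z \<noteq> 0" using nz by (auto simp: Q_def)
      have Wz: "norm (W z) ^ N = norm (G z) * norm (Q z)"
        using arg_cong[OF G(2)[of z], of norm] by (simp add: norm_mult norm_power)
      have lnQ: "ln (norm (Q z)) = real (\<Sum>i<q. p i) * ln (H z) - (\<Sum>i<q. real (p i) * ln (E i))"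
      proof -
        have "ln (norm (Q z)) = (\<Sum>i<q. ln (norm (h i z) ^ p i))"
          unfolding Q_def prod_norm[symmetric] norm_power using nz by (subst ln_prod) auto
        also have "\<dots> = (\<Sum>i<q. real (p i) * (ln (H z) - ln (E i)))"
          using nz by (intro sum.cong) (auto simp: ln_realpow lnE)
        finally show ?thesis by (simp add: right_diff_distrib sum_subtractf sum_distrib_right)
      qed
      have "real N * ln (norm (W z)) \<le> real N * (ln C + real R * ln L + real R * ln (H z) - (\<Sum>i\<in>B. ln (E i)))"
      proof (cases "N = 0")
        case False
        then have Wnz: "0 < norm (W z)" 
        proof -
          have "norm (W z) ^ N \<noteq> 0" using Wz Gz Qz by simp
          then show ?thesis using False by simp
        qed
        have "norm (W z) \<le> C * L ^ R * (\<Prod>i\<in>B. norm (h i z))"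
          using bound Bq L by (intro W_bound[rule_format, OF B(1) P]) auto
        then have "ln (norm (W z)) \<le> ln (C * L ^ R * (\<Prod>i\<in>B. norm (h i z)))"
          using Wnz by (intro ln_mono) auto
        also have "\<dots> = ln C + real R * ln L + ln (\<Prod>i\<in>B. norm (h i z))"
          using W(3) L nz Bq basis_finite[OF B(1)] by (simp add: ln_mult ln_realpow prod_pos)
        also have "ln (\<Prod>i\<in>B. norm (h i z)) = (\<Sum>i\<in>B. ln (H z) - ln (E i))"
          using nz Bq basis_finite[OF B(1)] by (subst ln_prod) (auto simp: lnE intro!: sum.cong)
        also have "\<dots> = real R * ln (H z) - (\<Sum>i\<in>B. ln (E i))"
          using B(1) by (simp add: sum_subtractf basis_def)
        finally show ?thesis by (intro mult_left_mono) auto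
      qed simp
      moreover have "real N * ln (norm (W z)) = ln (norm (G z)) + ln (norm (Q z))"
      proof -
        have "ln (norm (W z) ^ N) = ln (norm (G z)) + ln (norm (Q z))"
          unfolding Wz using Gz Qz by (simp add: ln_mult)
        moreover have "ln (norm (W z) ^ N) = real N * ln (norm (W z))"
        proof (cases "W z = 0")
          case True
          then have "N = 0" using Wz Gz Qz by (metis mult_eq_0_iff norm_eq_zero norm_zero power_0_left zero_neq_one)
          then show ?thesis by simp
        qed (simp add: ln_realpow)
        ultimately show ?thesis by simp
      qed
      moreover have "(\<Sum>i<q. real (p i) * ln (E i)) \<le> real N * (\<Sum>i<q. w i * ln (E i))"
      proof -
        have "(\<Sum>i<q. real (p i) * ln (E i)) \<le> (\<Sum>i<q. real N * w i * ln (E i))"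
          using p_le E1 by (intro sum_mono mult_right_mono) auto
        then show ?thesis by (simp add: sum_distrib_left mult.assoc)
      qed
      moreover have "real N * (\<Sum>i<q. w i * ln (E i)) \<le> real N * ((\<Sum>i<q. w i) * ln C1 + (\<Sum>i\<in>B. ln (E i)))"
        using wE by (intro mult_left_mono) auto
      moreover have "real \<delta> * ln (H z) = real (\<Sum>i<q. p i) * ln (H z) - real N * real R * ln (H z)"
      proof -
        have "real \<delta> = real (\<Sum>i<q. p i) - real N * real R"
          using p(2) by (simp add: \<delta>_def of_nat_diff)
        then show ?thesis by (simp only: left_diff_distrib)
      qed
      ultimately have "ln (norm (G z)) + real \<delta> * ln (H z)
          \<le> real N * (ln C + real R * ln L + (\<Sum>i<q. w i) * ln C1)"
        using lnQ by (simp add: algebra_simps)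
      also have "\<dots> \<le> K * (1 + ln L)"
      proof -
        have l: "0 \<le> ln L" using L by simp
        have "0 \<le> (\<bar>ln C\<bar> + (\<Sum>i<q. w i) * ln C1) * ln L" using l w_sum C1 by simp
        then have "ln C + real R * ln L + (\<Sum>i<q. w i) * ln C1
            \<le> (\<bar>ln C\<bar> + real R + (\<Sum>i<q. w i) * ln C1) * (1 + ln L)"
          by (simp add: algebra_simps)
        then have "real N * (ln C + real R * ln L + (\<Sum>i<q. w i) * ln C1)
            \<le> real N * ((\<bar>ln C\<bar> + real R + (\<Sum>i<q. w i) * ln C1) * (1 + ln L))"
          by (intro mult_left_mono) auto
        then show ?thesis by (simp add: K_def mult.assoc)
      qed
      finally show "ln (norm (G z)) + real \<delta> * ln (H z) \<le> K * (1 + ln L)" .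
    qed
  qed
qed

end

context orbifold_curve
begin

section \<open>Growth of the curve\<close>

text \<open>\<open>Re (p 0)\<close> is, up to a bounded error, the Cartan characteristic of the curve at radius \<open>r\<close>.\<close>

lemma harmonic_normalization:
  assumes "0 < r"
  shows "\<exists>p. p holomorphic_on UNIV \<and> (\<forall>z. norm z \<le> r \<longrightarrow> (\<forall>i<q. norm (h i z * exp (- p z)) \<le> 1))
    \<and> (\<forall>z. norm z = r \<longrightarrow> Re (p z) \<le> ln (H z) + 2)"
proof -
  have cont: "continuous_on UNIV (h i)" if "i < q" for i
    using hol[OF that] holomorphic_on_imp_continuous_on by blast
  have "continuous_on (sphere 0 r) (\<lambda>z. ln (H z))"
  proof (intro continuous_on_ln ballI)
    show "continuous_on (sphere 0 r) H"
      unfolding H_def using cont by (intro continuous_intros) (auto intro: continuous_on_subset)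
    show "H z \<noteq> 0" for z using H_pos[of z] by simp
  qed
  from harmonic_approximation_circle[OF this, of 1]
  obtain p0 where p0: "p0 holomorphic_on UNIV" "\<And>z. norm z = r \<Longrightarrow> \<bar>ln (H z) - Re (p0 z)\<bar> < 1"
    by auto
  \<comment> \<open>The shift by 1 puts \<open>Re p\<close> above \<open>ln H\<close> on the circle,
    as the maximum principle needs, while keeping it within 2 of \<open>ln H\<close>.\<close>
  define p where "p z = p0 z + 1" for z
  have p: "p holomorphic_on UNIV" unfolding p_def using p0(1) by (intro holomorphic_intros)
  have "norm (h i z * exp (- p z)) \<le> 1" if "norm z \<le> r" "i < q" for z i
  proof (rule maximum_modulus_cball[OF _ assms _ that(1)])
    show "(\<lambda>z. h i z * exp (- p z)) holomorphic_on UNIV"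
      using p hol[OF that(2)] by (intro holomorphic_intros)
    fix z :: complex assume "norm z = r"
    then have "ln (H z) \<le> Re (p z)" using p0(2)[of z] by (simp add: p_def)
    then have "H z \<le> exp (Re (p z))" using H_pos[of z] by (metis exp_le_cancel_iff exp_ln)
    then have "norm (h i z) \<le> exp (Re (p z))" using norm_le_H[OF that(2), of z] by linarith
    then show "norm (h i z * exp (- p z)) \<le> 1" by (simp add: norm_mult norm_divide exp_minus field_simps)
  qed
  moreover have "Re (p z) \<le> ln (H z) + 2" if "norm z = r" for z
    using p0(2)[OF that] by (simp add: p_def)
  ultimately show ?thesis using p by blast
qed

text \<open>The maximum principle is evaluated at 0, so a zero there must be divided out. Dividing
  by a power of \<open>z\<close> does not increase the modulus where \<open>norm z \<ge> 1\<close>,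
  which is why only radii of at least 1 occur later.\<close>

lemma strip_zero_at_origin:
  assumes "f holomorphic_on UNIV" "f z0 \<noteq> 0"
  obtains g where "g holomorphic_on UNIV" "g 0 \<noteq> 0" "\<And>z. 1 \<le> norm z \<Longrightarrow> norm (g z) \<le> norm (f z)"
    "\<And>z. f z = 0 \<Longrightarrow> z \<noteq> 0 \<Longrightarrow> g z = 0"
proof -
  obtain \<nu> g where g: "g holomorphic_on UNIV" "g 0 \<noteq> 0" "\<And>w. f w = (w - 0) ^ \<nu> * g w"
    using entire_factor_order[OF assms] by metis
  have "norm (g z) \<le> norm (f z)" if "1 \<le> norm z" for z
    using that one_le_power[OF that, of \<nu>] mult_right_mono[of 1 "norm z ^ \<nu>" "norm (g z)"]
    by (simp add: g(3) norm_mult norm_power)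
  then show thesis using that g by simp
qed

theorem no_such_curve: False
proof -
  have q0: "0 < q" using q_large by simp
  obtain G \<delta> K where G: "G holomorphic_on UNIV" "\<exists>z. G z \<noteq> 0" "1 \<le> \<delta>" "0 \<le> K"
    and aux: "\<forall>z p L. p holomorphic_on UNIV \<longrightarrow> 1 \<le> L \<longrightarrow> (\<forall>i<q. h i z \<noteq> 0) \<longrightarrow>
      (\<forall>i<q. \<forall>l<R. norm ((deriv ^^ l) (\<lambda>z. h i z * exp (- p z)) z) \<le> L * norm (h i z * exp (- p z))) \<longrightarrow>
      G z \<noteq> 0 \<longrightarrow> ln (norm (G z)) + real \<delta> * ln (H z) \<le> K * (1 + ln L)"
    by (rule auxiliary_function)
  obtain G1 where G1: "G1 holomorphic_on UNIV" "G1 0 \<noteq> 0" "\<And>z. 1 \<le> norm z \<Longrightarrow> norm (G1 z) \<le> norm (G z)"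
    using strip_zero_at_origin[OF G(1)] G(2) by metis
  have "\<forall>r. \<exists>p. 0 < r \<longrightarrow> p holomorphic_on UNIV \<and> (\<forall>z. norm z \<le> r \<longrightarrow> (\<forall>i<q. norm (h i z * exp (- p z)) \<le> 1))
    \<and> (\<forall>z. norm z = r \<longrightarrow> Re (p z) \<le> ln (H z) + 2)"
    using harmonic_normalization by blast
  then obtain P where P: "\<And>r. 0 < r \<Longrightarrow> P r holomorphic_on UNIV"
    "\<And>r z i. 0 < r \<Longrightarrow> norm z \<le> r \<Longrightarrow> i < q \<Longrightarrow> norm (h i z * exp (- P r z)) \<le> 1"
    "\<And>r z. 0 < r \<Longrightarrow> norm z = r \<Longrightarrow> Re (P r z) \<le> ln (H z) + 2"
    by metis
  define T where "T r = Re (P r 0)" for r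
  have h_le: "norm (h i z) \<le> exp (Re (P r z))" if "0 < r" "norm z \<le> r" "i < q" for r z i
    using P(2)[OF that] by (simp add: norm_mult norm_divide exp_minus field_simps)
  have H_le: "ln (H z) \<le> ln (real q) + Re (P r z)" if "0 < r" "norm z \<le> r" for r z
  proof -
    have "H z \<le> (\<Sum>i<q. exp (Re (P r z)))"
      unfolding H_def using h_le[OF that] by (intro sum_mono) auto
    then have "ln (H z) \<le> ln (real q * exp (Re (P r z)))"
      using H_pos[of z] by (intro ln_mono) auto
    then show ?thesis using q0 by (simp add: ln_mult)
  qed
  \<comment> \<open>\<open>T\<close> is only almost increasing, because each \<open>P r\<close> is
    an approximation chosen separately. On the circle of radius \<open>\<rho>\<close>,
    \<open>Re (P \<rho>)\<close> is at most \<open>ln H + 2\<close>, hence at most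
    \<open>Re (P r) + ln q + 2\<close>; the maximum principle carries this to 0.\<close>
  have mono: "T \<rho> \<le> T r + (ln (real q) + 2)" if "0 < \<rho>" "\<rho> < r" for \<rho> r
  proof -
    have r: "0 < r" using that by simp
    have "norm (exp (P \<rho> 0 - P r 0)) \<le> exp (ln (real q) + 2)"
    proof (rule maximum_modulus_cball[of "\<lambda>z. exp (P \<rho> z - P r z)" \<rho>])
      show "(\<lambda>z. exp (P \<rho> z - P r z)) holomorphic_on UNIV"
        using P(1) that r by (intro holomorphic_intros) auto
      fix z :: complex assume z: "norm z = \<rho>"
      have "Re (P \<rho> z) - Re (P r z) \<le> ln (real q) + 2"
        using P(3)[OF that(1) z] H_le[OF r, of z] z that by simp
      then show "norm (exp (P \<rho> z - P r z)) \<le> exp (ln (real q) + 2)" by simp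
    qed (use that in auto)
    then show ?thesis by (simp add: T_def)
  qed
  define L' where "L' = (\<Sum>i<q. \<bar>ln (norm (h i 0))\<bar>)"
  obtain C where C: "1 \<le> C" "\<And>X \<rho> r g. 1 \<le> X \<Longrightarrow> 0 < \<rho> \<Longrightarrow> \<rho> < r \<Longrightarrow> r \<le> X \<Longrightarrow> 3 / (r - \<rho>) \<le> X \<Longrightarrow>
    (\<forall>i<q. g i holomorphic_on UNIV \<and> (\<forall>z. norm z \<le> r \<longrightarrow> norm (g i z) \<le> 1) \<and> exp (- X) \<le> norm (g i 0)) \<Longrightarrow>
    (\<exists>s. \<rho> < s \<and> s < r \<and> (\<forall>i<q. \<forall>z. norm z = s \<longrightarrow> g i z \<noteq> 0 \<and>
      (\<forall>l\<le>R. norm ((deriv ^^ l) (g i) z) \<le> C * X ^ (12 * R) * norm (g i z))))"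
    using logarithmic_derivatives_on_circle[of q R] by blast
  define D where "D = (ln (real q) + 2) + (K * (1 + ln C) + \<bar>ln (norm (G1 0))\<bar>) / real \<delta> + 2 + K * (12 * real R) / real \<delta>"
  have d0: "0 < real \<delta>" using G(3) by simp
  have log: "T \<rho> \<le> D * (1 + ln X)"
    if rho: "1 \<le> \<rho>" "\<rho> < r" and X: "T r + L' \<le> X" "r \<le> X" "3 / (r - \<rho>) \<le> X" "1 \<le> X" for \<rho> r X
  proof -
    have r: "0 < \<rho>" "0 < r" using rho by auto
    let ?g = "\<lambda>i z. h i z * exp (- P r z)"
    have "?g i holomorphic_on UNIV \<and> (\<forall>z. norm z \<le> r \<longrightarrow> norm (?g i z) \<le> 1) \<and> exp (- X) \<le> norm (?g i 0)"
      if i: "i < q" for i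
    proof (intro conjI allI impI)
      show "?g i holomorphic_on UNIV" using hol[OF i] P(1)[OF r(2)] by (intro holomorphic_intros)
      show "norm (?g i z) \<le> 1" if "norm z \<le> r" for z using P(2)[OF r(2) that i] .
      have "\<bar>ln (norm (h i 0))\<bar> \<le> L'" unfolding L'_def using i by (intro member_le_sum) auto
      then have "- X \<le> ln (norm (h i 0)) - Re (P r 0)" using X(1) by (simp add: T_def)
      then have "exp (- X) \<le> exp (ln (norm (h i 0)) - Re (P r 0))" by simp
      then show "exp (- X) \<le> norm (?g i 0)"
        using base[OF i] by (simp add: exp_diff norm_mult norm_divide exp_minus field_simps)
    qed
    then obtain s where s: "\<rho> < s" "s < r" and bd: "\<And>i z. i < q \<Longrightarrow> norm z = s \<Longrightarrow> ?g i z \<noteq> 0 \<and>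
      (\<forall>l\<le>R. norm ((deriv ^^ l) (?g i) z) \<le> C * X ^ (12 * R) * norm (?g i z))"
      using C(2)[OF X(4) r(1) rho(2) X(2,3), of ?g] by blast
    define L where "L = C * X ^ (12 * R)"
    have L: "1 \<le> L" unfolding L_def using C(1) X(4) by (intro mult_ge1_I one_le_power) auto
    have lnL: "ln L = ln C + 12 * real R * ln X"
      unfolding L_def using C(1) X(4) by (simp add: ln_mult ln_realpow)
    have s0: "0 < s" "1 \<le> s" using s rho by auto
    define E where "E = K * (1 + ln L) + 2 * real \<delta>"
    \<comment> \<open>Two normalizations meet: \<open>P r\<close>, from the larger disc, controls
      the logarithmic derivatives on \<open>norm z = s\<close>, whereas \<open>P s\<close> replaces
      \<open>ln H\<close> on that circle up to 2. Comparing with the value at 0 then bounds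
      \<open>T s\<close>.\<close>
    have "norm (G1 0 * exp (real \<delta> * P s 0)) \<le> exp E"
    proof (rule maximum_modulus_cball[of "\<lambda>z. G1 z * exp (real \<delta> * P s z)" s])
      show "(\<lambda>z. G1 z * exp (real \<delta> * P s z)) holomorphic_on UNIV"
        using G1(1) P(1)[OF s0(1)] by (intro holomorphic_intros)
      fix z :: complex assume z: "norm z = s"
      show "norm (G1 z * exp (real \<delta> * P s z)) \<le> exp E"
      proof (cases "G z = 0")
        case True
        then have "G1 z = 0" using G1(3)[of z] z s0 by simp
        then show ?thesis by simp
      next
        case False
        have "ln (norm (G z)) + real \<delta> * ln (H z) \<le> K * (1 + ln L)"
          using bd[OF _ z] by (intro aux[rule_format, OF P(1)[OF r(2)] L _ _ False]) (auto simp: L_def)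
        moreover have "real \<delta> * Re (P s z) \<le> real \<delta> * (ln (H z) + 2)"
          using P(3)[OF s0(1) z] by (intro mult_left_mono) auto
        ultimately have "ln (norm (G z)) + real \<delta> * Re (P s z) \<le> E"
          by (simp add: E_def algebra_simps)
        then have "exp (ln (norm (G z)) + real \<delta> * Re (P s z)) \<le> exp E" by simp
        then have "norm (G z) * exp (real \<delta> * Re (P s z)) \<le> exp E" using False by (simp add: exp_add)
        moreover have "norm (G1 z) * exp (real \<delta> * Re (P s z)) \<le> norm (G z) * exp (real \<delta> * Re (P s z))"
          using G1(3)[of z] z s0 by (intro mult_right_mono) auto
        moreover have "norm (G1 z * exp (real \<delta> * P s z)) = norm (G1 z) * exp (real \<delta> * Re (P s z))"
          by (simp add: norm_mult)
        ultimately show ?thesis by linarith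
      qed
    qed (use s0 in auto)
    then have "norm (G1 0) * exp (real \<delta> * T s) \<le> exp E" by (simp add: norm_mult T_def)
    then have "ln (norm (G1 0) * exp (real \<delta> * T s)) \<le> ln (exp E)"
      using G1(2) by (intro ln_mono) auto
    then have "real \<delta> * T s \<le> E + \<bar>ln (norm (G1 0))\<bar>" using G1(2) by (simp add: ln_mult)
    then have "T s \<le> (E + \<bar>ln (norm (G1 0))\<bar>) / real \<delta>" using d0 by (simp add: field_simps)
    also have "\<dots> = (K * (1 + ln C) + \<bar>ln (norm (G1 0))\<bar>) / real \<delta> + 2 + K * (12 * real R) / real \<delta> * ln X"
      using d0 by (simp add: E_def lnL field_simps)
    finally have "T \<rho> \<le> (ln (real q) + 2) + (K * (1 + ln C) + \<bar>ln (norm (G1 0))\<bar>) / real \<delta> + 2 + K * (12 * real R) / real \<delta> * ln X"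
      using mono[OF r(1) s(1)] by linarith
    also have "\<dots> \<le> D * (1 + ln X)"
    proof -
      have lX: "0 \<le> ln X" using X by simp
      have "0 \<le> ln (real q)" "0 \<le> ln C" using q0 C(1) by auto
      then have "0 \<le> ((ln (real q) + 2) + (K * (1 + ln C) + \<bar>ln (norm (G1 0))\<bar>) / real \<delta> + 2) * ln X"
        using lX G(4) by (intro mult_nonneg_nonneg add_nonneg_nonneg divide_nonneg_nonneg) auto
      moreover have "0 \<le> K * (12 * real R) / real \<delta>" using G(4) by simp
      ultimately show ?thesis unfolding D_def by (simp only: distrib_left distrib_right mult_1_right)
    qed
    finally show ?thesis .
  qed
  obtain i j z0 where ij: "i < q" "j < q" "h i 0 * h j z0 \<noteq> h j 0 * h i z0" using nonconst by blast
  \<comment> \<open>By periodicity \<open>f\<close> vanishes at every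
    \<open>2 * pi * \<i> * m\<close>; by \<open>nonconst\<close> it is not identically zero.\<close>
  define f where "f z = h i 0 * h j z - h j 0 * h i z" for z
  have hol_f: "f holomorphic_on UNIV" unfolding f_def using hol ij by (intro holomorphic_intros) auto
  obtain g where g: "g holomorphic_on UNIV" "g 0 \<noteq> 0" "\<And>z. 1 \<le> norm z \<Longrightarrow> norm (g z) \<le> norm (f z)"
    "\<And>z. f z = 0 \<Longrightarrow> z \<noteq> 0 \<Longrightarrow> g z = 0"
    using strip_zero_at_origin[OF hol_f, of z0] ij(3) by (auto simp: f_def)
  define c where "c = norm (h i 0) + norm (h j 0)"
  have c0: "0 < c" using base ij by (simp add: c_def add_pos_pos)
  have lin: "ln 2 / (4 * pi) * r - (ln 2 - ln (norm (g 0) / c)) \<le> T r" if r: "1 \<le> r" for r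
  proof -
    have r0: "0 < r" using r by simp
    have f_le: "norm (f z) \<le> c * exp (Re (P r z))" if "norm z \<le> r" for z
    proof -
      have "norm (f z) \<le> norm (h i 0) * norm (h j z) + norm (h j 0) * norm (h i z)"
        unfolding f_def by (rule order_trans[OF norm_triangle_ineq4]) (simp add: norm_mult)
      also have "\<dots> \<le> norm (h i 0) * exp (Re (P r z)) + norm (h j 0) * exp (Re (P r z))"
        using h_le[OF r0 that] ij by (intro add_mono mult_left_mono) auto
      finally show ?thesis by (simp add: c_def distrib_right)
    qed
    define k where "k z = g z * exp (- P r z) / of_real c" for z
    have hol_k: "k holomorphic_on UNIV" unfolding k_def using g(1) P(1)[OF r0] c0 by (intro holomorphic_intros) auto
    have k_le: "norm (k z) \<le> 1" if "norm z \<le> r" for z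
    proof (rule maximum_modulus_cball[OF hol_k r0 _ that])
      fix z :: complex assume z: "norm z = r"
      have "norm (g z) \<le> c * exp (Re (P r z))" using g(3)[of z] f_le[of z] z r by simp
      then show "norm (k z) \<le> 1" using c0 by (simp add: k_def norm_mult norm_divide exp_minus field_simps)
    qed
    \<comment> \<open>The zeros with index \<open>m\<close> from 1 to \<open>J\<close> lie in the
      disc of radius \<open>r / 2\<close>, and each halves the bound on \<open>norm (k 0)\<close>.
      The index 0 is left out because the zero at the origin has been stripped.\<close>
    define J where "J = nat \<lfloor>r / (4 * pi)\<rfloor>"
    have "0 \<le> r / (4 * pi)" using r0 by simp
    then have J: "real J \<le> r / (4 * pi)" "r / (4 * pi) - 1 \<le> real J" unfolding J_def by linarith+
    define S where "S = (\<lambda>m::nat. 2 * of_real pi * \<i> * of_nat m) ` {1..J}"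
    have cardS: "card S = J"
      unfolding S_def by (subst card_image) (auto simp: inj_on_def)
    have "norm (k 0) \<le> ((r / 2) / r) ^ card S"
    proof (rule norm_le_power_zeros[OF _ r0])
      show "S \<subseteq> cball 0 (r / 2)"
      proof
        fix x assume "x \<in> S"
        then obtain m where m: "m \<in> {1..J}" "x = 2 * of_real pi * \<i> * of_nat m" by (auto simp: S_def)
        have "norm x = 2 * pi * real m" unfolding m(2) by (simp add: norm_mult)
        also have "\<dots> \<le> 2 * pi * (r / (4 * pi))" using m(1) J(1) by (intro mult_left_mono) auto
        finally show "x \<in> cball 0 (r / 2)" by simp
      qed
      show "k z = 0" if zS: "z \<in> S" for z
      proof -
        obtain m :: nat where m: "m \<in> {1..J}" "z = 2 * of_real pi * \<i> * of_nat m" using zS unfolding S_def by blast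
        have "f z = 0" unfolding m(2) f_def using periodic ij by simp
        moreover have "z \<noteq> 0" using m by auto
        ultimately show ?thesis using g(4) by (simp add: k_def)
      qed
      show "finite S" by (simp add: S_def)
    qed (use r0 hol_k k_le in auto)
    also have "\<dots> = (1 / 2) ^ J" using r0 by (simp add: cardS)
    finally have "norm (g 0) / c * exp (- T r) \<le> (1 / 2) ^ J"
      using c0 by (simp add: k_def norm_mult norm_divide T_def)
    then have "ln (norm (g 0) / c * exp (- T r)) \<le> ln ((1 / 2) ^ J)"
      using g(2) c0 by (intro ln_mono) auto
    then have "ln (norm (g 0) / c) - T r \<le> - (real J * ln 2)"
      using g(2) c0 by (simp add: ln_mult ln_realpow ln_div)
    moreover have "(r / (4 * pi) - 1) * ln 2 \<le> real J * ln 2" using J(2) by (intro mult_right_mono) auto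
    ultimately show ?thesis by (simp add: algebra_simps)
  qed
  show False
  proof (rule no_slow_self_growth[of T])
    show "T \<rho> \<le> T r + (ln (real q) + 2)" if "0 < \<rho>" "\<rho> < r" for \<rho> r using mono that .
    show "0 < ln 2 / (4 * pi)" by simp
    show "ln 2 / (4 * pi) * r - (ln 2 - ln (norm (g 0) / c)) \<le> T r" if "1 \<le> r" for r using lin that .
    show "T \<rho> \<le> D * (1 + ln X)" if "1 \<le> \<rho>" "\<rho> < r" "T r + L' \<le> X" "r \<le> X" "3 / (r - \<rho>) \<le> X" "1 \<le> X" for \<rho> r X
      using log that .
  qed
qed

end

section \<open>Passage from orbifold morphisms to the periodic curve\<close>

lemma general_position_span:
  assumes "hyp_general_position n q a" and B: "B \<subseteq> {..<q}" "card B = n + 1" and "j \<le> n"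
  shows "\<exists>d. \<forall>F. F j = (\<Sum>i\<in>B. d i * lin_form n (a i) F)"
proof -
  have finB: "finite B" using B finite_subset by blast
  have qB: "q \<notin> B" using B by auto
  \<comment> \<open>The index \<open>q\<close>, which is not in \<open>B\<close>, carries the
    \<open>j\<close>-th coordinate form: \<open>n + 2\<close> vectors in dimension
    \<open>n + 1\<close> are dependent, and general position forces this form to take part in the
    relation.\<close>
  define v where "v x l = (if x = q then (if l = j then 1 else 0) else a x l)" for x l
  obtain c where c: "\<exists>x\<in>insert q B. c x \<noteq> 0" "\<forall>l\<in>{..n}. (\<Sum>x\<in>insert q B. c x * v x l) = 0"
    using homogeneous_system_solution[of "{..n}" "insert q B" v] finB qB B by auto
  have rel: "c q * (if l = j then 1 else 0) + (\<Sum>x\<in>B. c x * a x l) = 0" if "l \<le> n" for l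
  proof -
    have eq: "(\<Sum>x\<in>B. c x * v x l) = (\<Sum>x\<in>B. c x * a x l)"
      using qB by (intro sum.cong) (auto simp: v_def)
    have vq: "v q l = (if l = j then 1 else 0)" by (simp add: v_def)
    have "c q * v q l + (\<Sum>x\<in>B. c x * v x l) = 0" using c(2) that finB qB by simp
    then show ?thesis unfolding eq vq .
  qed
  have cq: "c q \<noteq> 0"
  proof
    assume z: "c q = 0"
    then have "\<forall>l\<le>n. (\<Sum>x\<in>B. c x * a x l) = 0" using rel by simp
    then have "\<forall>x\<in>B. c x = 0" using assms(1) B unfolding hyp_general_position_def by blast
    then show False using c(1) z by auto
  qed
  have d: "(\<Sum>x\<in>B. (- c x / c q) * a x l) = (if l = j then 1 else 0)" if "l \<le> n" for l
  proof -
    have "(\<Sum>x\<in>B. (- c x / c q) * a x l) = - (\<Sum>x\<in>B. c x * a x l) / c q"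
      by (simp add: sum_divide_distrib sum_negf)
    also have "\<dots> = (if l = j then 1 else 0)" using rel[OF that] cq by (auto simp: field_simps add_eq_0_iff2)
    finally show ?thesis .
  qed
  have "F j = (\<Sum>i\<in>B. (- c i / c q) * lin_form n (a i) F)" for F
  proof -
    have "(\<Sum>i\<in>B. (- c i / c q) * lin_form n (a i) F) = (\<Sum>i\<in>B. \<Sum>l\<le>n. (- c i / c q) * a i l * F l)"
      by (simp add: lin_form_def sum_distrib_left mult.assoc)
    also have "\<dots> = (\<Sum>l\<le>n. (\<Sum>i\<in>B. (- c i / c q) * a i l) * F l)"
      by (subst sum.swap) (simp add: sum_distrib_right)
    also have "\<dots> = (\<Sum>l\<le>n. (if l = j then 1 else 0) * F l)" using d by (intro sum.cong) auto
    also have "\<dots> = (\<Sum>l\<le>n. if l = j then F l else 0)" by (intro sum.cong) auto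
    also have "\<dots> = F j" using assms(4) by simp
    finally show ?thesis by simp
  qed
  then show ?thesis by (intro exI[of _ "\<lambda>i. - c i / c q"]) blast
qed

lemma mult_ge_le_order:
  assumes "mult_ge f a k" "g holomorphic_on UNIV" "g a \<noteq> 0" "\<And>w. f w = (w - a) ^ \<nu> * g w"
  shows "k \<le> \<nu>"
proof (rule ccontr)
  assume "\<not> k \<le> \<nu>"
  then have "(deriv ^^ \<nu>) f a = 0" using assms(1) by (simp add: mult_ge_def)
  moreover have "f = (\<lambda>w. (w - a) ^ \<nu> * g w)" using assms(4) by blast
  ultimately show False using higher_deriv_factored[OF assms(2), of \<nu> a \<nu>] assms(3) by auto
qed

text \<open>\<open>exp w - exp a\<close> is divisible by \<open>w - a\<close>, so composing with
  \<open>c + exp\<close> cannot lower the order, and the multiplicity condition survives the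
  substitution.\<close>

lemma exp_order:
  assumes "f holomorphic_on UNIV" "f z0 \<noteq> 0"
    and g: "g holomorphic_on UNIV" "g a \<noteq> 0" "\<And>w. f (c + exp w) = (w - a) ^ \<nu> * g w"
    and m: "mult_ge f (c + exp a) k"
  shows "k \<le> \<nu>"
proof -
  obtain \<mu> k' where k': "k' holomorphic_on UNIV" "k' (c + exp a) \<noteq> 0" "\<And>x. f x = (x - (c + exp a)) ^ \<mu> * k' x"
    using entire_factor_order[OF assms(1,2), of "c + exp a"] by metis
  have "(\<lambda>w. exp w - exp a) holomorphic_on UNIV" by (intro holomorphic_intros)
  then obtain E where E: "E holomorphic_on UNIV" "\<And>w. exp w - exp a = (w - a) * E w"
    using entire_divide_root[of "\<lambda>w. exp w - exp a" a] by auto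
  have "(\<lambda>w. c + exp w) holomorphic_on UNIV" by (intro holomorphic_intros)
  then have "(k' \<circ> (\<lambda>w. c + exp w)) holomorphic_on UNIV"
    by (rule holomorphic_on_compose_gen[OF _ k'(1)]) auto
  then have kE: "(\<lambda>w. E w ^ \<mu> * k' (c + exp w)) holomorphic_on UNIV"
    using E(1) unfolding o_def by (intro holomorphic_intros)
  have fw: "f (c + exp w) = (w - a) ^ \<mu> * (E w ^ \<mu> * k' (c + exp w))" for w
    by (simp add: k'(3) E(2) power_mult_distrib mult.assoc)
  have "k \<le> \<mu>" using mult_ge_le_order[OF m k'] .
  moreover have "\<mu> \<le> \<nu>"
  proof (rule mult_ge_le_order[OF _ g])
    have "\<exists>K. \<forall>w. (deriv ^^ l) (\<lambda>w. (w - a) ^ \<mu> * (E w ^ \<mu> * k' (c + exp w))) w = (w - a) ^ (\<mu> - l) * K w" for l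
      using higher_deriv_factored[OF kE, of l a \<mu>] by blast
    then have "(deriv ^^ l) (\<lambda>w. f (c + exp w)) a = 0" if "l < \<mu>" for l
      using that unfolding fw by (metis diff_self mult_zero_left power_eq_0_iff zero_less_diff)
    then show "mult_ge (\<lambda>w. f (c + exp w)) a \<mu>" by (simp add: mult_ge_def)
  qed
  ultimately show ?thesis by simp
qed

theorem theorem5p3:
  fixes n q :: nat and a :: "nat \<Rightarrow> nat \<Rightarrow> complex" and m :: "nat \<Rightarrow> enat"
    and F :: "nat \<Rightarrow> complex \<Rightarrow> complex"
  assumes "n \<ge> 1"
    and "q > 2 * n"
    and "hyp_general_position n q a"
    and "\<forall>i<q. m i \<ge> 1"
    and "(\<Sum>i<q. orbifold_weight (m i)) > real q - real q / real n + 1 + 1 / real n"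
    and "orbifold_morphism n q a m F"
  shows "constant_proj n F"
proof (rule ccontr)
  assume nonconstant: "\<not> constant_proj n F"
  define f where "f i = hyp_pullback n (a i) F" for i
  have F_hol: "F j holomorphic_on UNIV" if "j \<le> n" for j
    using assms(6) that by (auto simp: orbifold_morphism_def reduced_rep_def)
  have F_nz: "\<exists>j\<le>n. F j z \<noteq> 0" for z
    using assms(6) by (auto simp: orbifold_morphism_def reduced_rep_def)
  obtain z0 where z0: "\<And>i. i < q \<Longrightarrow> f i z0 \<noteq> 0"
    using assms(6) by (auto simp: orbifold_morphism_def f_def)
  have mult: "\<And>i x. i < q \<Longrightarrow> f i x = 0 \<Longrightarrow> (case m i of enat k \<Rightarrow> mult_ge (f i) x k | \<infinity> \<Rightarrow> False)"
    using assms(6) unfolding orbifold_morphism_def f_def by blast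
  have f_eq: "f i z = (\<Sum>j\<le>n. a i j * F j z)" for i z
    by (simp add: f_def hyp_pullback_def lin_form_def)
  have f_hol: "f i holomorphic_on UNIV" for i
  proof -
    have "(\<lambda>z. \<Sum>j\<le>n. a i j * F j z) holomorphic_on UNIV" using F_hol by (intro holomorphic_intros) auto
    then show ?thesis using f_eq by presburger
  qed
  have F_span: "\<exists>d. \<forall>z. F j z = (\<Sum>i\<in>B. d i * f i z)" if B: "B \<subseteq> {..<q}" "card B = n + 1" "j \<le> n" for B j
  proof -
    obtain d where "\<forall>G. G j = (\<Sum>i\<in>B. d i * lin_form n (a i) G)"
      using general_position_span[OF assms(3) B] by blast
    then have "\<forall>z. F j z = (\<Sum>i\<in>B. d i * f i z)" unfolding f_def hyp_pullback_def by fast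
    then show ?thesis by blast
  qed
  have B0: "{..<n + 1} \<subseteq> {..<q}" "card {..<n + 1} = n + 1" using assms(2) by auto
  \<comment> \<open>Makes \<open>c + exp 0 = z0\<close>, a point lying on none of the
    hyperplanes.\<close>
  define c where "c = z0 - 1"
  define h where "h i w = f i (c + exp w)" for i w
  \<comment> \<open>For \<open>m i = \<infinity>\<close> this is 0, which is consistent because
    \<open>f i\<close> then has no zero.\<close>
  define t where "t i = 1 - orbifold_weight (m i)" for i
  have nonconst: "\<exists>i<q. \<exists>j<q. \<exists>z. f i z0 * f j z \<noteq> f j z0 * f i z"
  proof (rule ccontr)
    assume "\<not> ?thesis"
    then have ratio: "f i z0 * f j z = f j z0 * f i z" if "i < q" "j < q" for i j z using that by blast
    have q0: "0 < q" using assms(2) by simp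
    define \<phi> where "\<phi> z = f 0 z / f 0 z0" for z
    have f\<phi>: "f i z = \<phi> z * f i z0" if "i < q" for i z
      using ratio[OF q0 that, of z] z0[OF q0] by (simp add: \<phi>_def field_simps)
    have F\<phi>: "F j z = \<phi> z * F j z0" if jn: "j \<le> n" for j z
    proof -
      obtain d where d: "\<And>z. F j z = (\<Sum>i\<in>{..<n + 1}. d i * f i z)" using F_span[OF B0 jn] by blast
      have "F j z = (\<Sum>i\<in>{..<n + 1}. \<phi> z * (d i * f i z0))"
        unfolding d
      proof (rule sum.cong[OF refl])
        fix i assume "i \<in> {..<n + 1}"
        then have "i < q" using assms(2) by simp
        then show "d i * f i z = \<phi> z * (d i * f i z0)" using f\<phi>[of i z] by simp
      qed
      then show ?thesis unfolding d[of z0] sum_distrib_left .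
    qed
    have \<phi>_nz: "\<phi> z \<noteq> 0" for z using F_nz[of z] F\<phi>[of _ z] by auto
    have "constant_proj n F"
      unfolding constant_proj_def
    proof (intro allI exI impI)
      fix z w j assume j: "j \<le> n"
      show "F j w = \<phi> w / \<phi> z * F j z"
        using F\<phi>[OF j, of w] F\<phi>[OF j, of z] \<phi>_nz[of z] by simp
    qed
    then show False using nonconstant by simp
  qed
  have "orbifold_curve n q h t"
  proof
    show "1 \<le> n" "2 * n < q" by fact+
    show "h i holomorphic_on UNIV" if "i < q" for i
    proof -
      have "(\<lambda>w. c + exp w) holomorphic_on UNIV" by (intro holomorphic_intros)
      then have "(f i \<circ> (\<lambda>w. c + exp w)) holomorphic_on UNIV"
        by (rule holomorphic_on_compose_gen[OF _ f_hol]) auto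
      then show ?thesis by (simp add: h_def[abs_def] o_def)
    qed
    show "h i 0 \<noteq> 0" if "i < q" for i using z0[OF that] by (simp add: h_def c_def)
    show "\<exists>i<q. h i z \<noteq> 0" for z
    proof (rule ccontr)
      assume "\<not> ?thesis"
      then have zero: "f i (c + exp z) = 0" if "i < q" for i using that by (auto simp: h_def)
      obtain j where j: "j \<le> n" "F j (c + exp z) \<noteq> 0" using F_nz by blast
      obtain d where d: "\<And>z. F j z = (\<Sum>i\<in>{..<n + 1}. d i * f i z)" using F_span[OF B0 j(1)] by blast
      have "F j (c + exp z) = 0" unfolding d using zero B0(1) by (intro sum.neutral) auto
      then show False using j(2) by simp
    qed
    show "\<exists>d. \<forall>z. h j z = (\<Sum>i\<in>B. d i * h i z)" if B: "B \<subseteq> {..<q}" "card B = n + 1" and "j < q" for B j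
    proof -
      have "\<forall>l. \<exists>d. l \<le> n \<longrightarrow> (\<forall>z. F l z = (\<Sum>i\<in>B. d i * f i z))" using F_span[OF B] by blast
      then obtain d where d: "\<And>l z. l \<le> n \<Longrightarrow> F l z = (\<Sum>i\<in>B. d l i * f i z)" by metis
      have "f j z = (\<Sum>i\<in>B. (\<Sum>l\<le>n. a j l * d l i) * f i z)" for z
      proof -
        have "f j z = (\<Sum>l\<le>n. \<Sum>i\<in>B. a j l * d l i * f i z)"
          unfolding f_eq[of j] by (intro sum.cong) (auto simp: d sum_distrib_left mult.assoc)
        also have "\<dots> = (\<Sum>i\<in>B. (\<Sum>l\<le>n. a j l * d l i) * f i z)"
          by (subst sum.swap) (simp add: sum_distrib_right)
        finally show ?thesis .
      qed
      then show ?thesis unfolding h_def by (intro exI[of _ "\<lambda>i. \<Sum>l\<le>n. a j l * d l i"]) blast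
    qed
    show "0 \<le> t i" if "i < q" for i
      by (cases "m i") (auto simp: t_def orbifold_weight_def)
    show "(\<Sum>i<q. t i) * real n < real q - real n - 1"
    proof -
      have "(\<Sum>i<q. t i) < real q / real n - 1 - 1 / real n"
        using assms(5) by (simp add: t_def sum_subtractf)
      then have "(\<Sum>i<q. t i) * real n < (real q / real n - 1 - 1 / real n) * real n"
        using assms(1) by (intro mult_strict_right_mono) auto
      also have "\<dots> = real q - real n - 1" using assms(1) by (simp add: field_simps)
      finally show ?thesis .
    qed
    show "1 \<le> t i * real \<nu>" if i: "i < q" and \<nu>: "0 < \<nu>" and g: "g holomorphic_on UNIV" "g x \<noteq> 0"
      "\<And>w. h i w = (w - x) ^ \<nu> * g w" for i x \<nu> g
    proof -
      have "h i x = 0" using g(3)[of x] \<nu> by simp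
      then have "f i (c + exp x) = 0" by (simp add: h_def)
      from mult[OF i this] obtain k where k: "m i = enat k" "mult_ge (f i) (c + exp x) k"
        by (cases "m i") auto
      have "k \<le> \<nu>"
        using exp_order[OF f_hol z0[OF i] g(1,2) _ k(2)] g(3) by (simp add: h_def)
      \<comment> \<open>Excludes the value \<open>1 / 0 = 0\<close>, so that \<open>t i\<close>
        really is the reciprocal of a positive \<open>k\<close>.\<close>
      moreover have "1 \<le> k" using assms(4) i k(1) by (metis enat_ord_simps(1) one_enat_def)
      ultimately show ?thesis using k(1) by (simp add: t_def orbifold_weight_def)
    qed
    show "h i (2 * of_real pi * \<i> * of_nat k) = h i 0" if "i < q" for i k
    proof -
      have "exp (2 * of_real pi * \<i> * of_nat k) = (exp (2 * of_real pi * \<i>) :: complex) ^ k"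
        by (rule exp_of_nat2_mult)
      then show ?thesis by (simp add: h_def)
    qed
    show "\<exists>i<q. \<exists>j<q. \<exists>z. h i 0 * h j z \<noteq> h j 0 * h i z"
    proof (rule ccontr)
      assume con: "\<not> ?thesis"
      obtain i j z where ij: "i < q" "j < q" "f i z0 * f j z \<noteq> f j z0 * f i z" using nonconst by blast
      define D where "D x = f i z0 * f j x - f j z0 * f i x" for x
      \<comment> \<open>\<open>c + exp\<close> takes every value except \<open>c\<close>; the
        remaining point is reached by continuity of \<open>D\<close>.\<close>
      have off: "D x = 0" if "x \<noteq> c" for x
      proof -
        have "c + exp (Ln (x - c)) = x" using that by simp
        then show ?thesis using con ij by (auto simp: h_def D_def c_def) (metis (no_types))
      qed
      have "D holomorphic_on UNIV" unfolding D_def by (intro holomorphic_intros f_hol)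
      then have "isCont D c" using holomorphic_on_imp_continuous_on continuous_on_eq_continuous_at by blast
      then have "(D \<longlongrightarrow> D c) (at c)" by (simp add: isCont_def)
      moreover have "(D \<longlongrightarrow> 0) (at c)" by (rule tendsto_eventually) (auto simp: eventually_at_filter off)
      ultimately have "D c = 0" using tendsto_unique[OF trivial_limit_at] by blast
      then show False using off[of z] ij(3) by (cases "z = c") (auto simp: D_def)
    qed
  qed
  then show False by (rule orbifold_curve.no_such_curve)
qed

end
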